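(* Let $\mathbf{r}=(r_1,r_2,\ldots)$ be a sequence of positive integers and let $k\ge 1$. There is a bijection between the set of equivalence classes of irreducible complex representations of the iterated wreath product $W(\mathbf{r}|_k)=S_{r_1}\wr\cdots\wr S_{r_k}$ and the set of $W(\mathbf{r}|_k)$-orbits of valid $\mathbf{r}|_k$-labels (two valid $\mathbf{r}|_k$-labels being in the same orbit if and only if they are equivalent under an automorphism of the rooted tree $\mathcal{T}(\mathbf{r}|_k)$).
   Context: Iterated wreath product: for a finite group $G$ and $H\le S_n$, $G\wr H$ is $G^n\times H$ with multiplication $(a;\pi)(b;\tau)=(ab^\pi;\pi\tau)$, where $b^\pi=(b_{\pi^{-1}(1)},\ldots,b_{\pi^{-1}(n)})$. Set $W(\mathbf{r}|_0)=\{1\}$ and $W(\mathbf{r}|_k)=W(\mathbf{r}|_{k-1})\wr S_{r_k}$. Trees: a rooted tree is a connected simple graph without cycles with a distinguished vertex, the root. $\mathcal{T}(\mathbf{r}|_1)$ is the tree consisting of a root only. For $k>1$, $\mathcal{T}(\mathbf{r}|_k)$ consists of a root with $r_k$ children, each of which is the root of a copy of $\mathcal{T}(\mathbf{r}|_{k-1})$ (so $\mathcal{T}(\mathbf{r}|_k)$ has $k$ levels of nodes). $V_{\mathcal{T}(\mathbf{r}|_k)}$ is its vertex set. For a vertex $v$, $\mathcal{T}_v$ is the subtree rooted at $v$ consisting of $v$ and all its descendants. If $v$ is a child of the root then $\mathcal{T}_v$ is identified with $\mathcal{T}(\mathbf{r}|_{k-1})$. For a partition $\alpha=(\alpha_1\ge\cdots\ge\alpha_m\geq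 1)$ of $n$ let $S_\alpha=S_{\alpha_1}\times\cdots\times S_{\alpha_m}$, and let $\widehat{S}_\alpha$ be the set of irreducible complex representations of $S_\alpha$ up to equivalence. Put $\widehat{S}_*=\bigsqcup_{n\ge1}\bigsqcup_{\alpha\vdash n}\widehat{S}_\alpha$. An $\mathbf{r}|_k$-label is a function $\phi:V_{\mathcal{T}(\mathbf{r}|_k)}\to\widehat{S}_*$. Two labels $\phi,\psi$ are equivalent if there is a root-preserving automorphism $\sigma\in\operatorname{Aut}(\mathcal{T}(\mathbf{r}|_k))$ with $\phi^\sigma=\psi$, where $\phi^\sigma(v):=\phi(v^\sigma)$. The group $W(\mathbf{r}|_k)$ acts on $\mathcal{T}(\mathbf{r}|_k)$, and hence on labels, through its natural surjection onto $\operatorname{Aut}(\mathcal{T}(\mathbf{r}|_k))$, where the factor $S_{r_j}$, $j\ge 2$, permutes the $r_j$ maximal subtrees below a vertex having $r_j$ children and the factors $S_{r_1}$ act trivially. Valid $\mathbf{r}|_k$-labels are defined recursively: (1) An $\mathbf{r}|_1$-label $\phi$ is valid if $\phi(\text{root})\in\widehat{S}_{r_1}$. (2) For $k>1$, an $\mathbf{r}|_k$-label $\phi$ is valid if (a) for each child $v$ of the root, the restriction $\phi|_{\mathcal{T}_v}$ is a valid $\mathbf{r}|_{k-1}$-label; and (b) $\phi(\text{root})\in\widehat{S}_\alpha$, where $\alpha\vdash r_k$ is the partition whose parts are the numbers of the $r_k$ sublabels $\phi|_{\mathcal{T}_v}$ ($v$ a child of the root) lying in each nonempty equivalence class of $\mathbf{r}|_{k-1}$-labels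 (so that $S_\alpha$ is the stabilizer, in $S_{r_k}$ permuting the children of the root, of the equivalence classes of the sublabels). *)

theory Defs
  imports
    "HOL-Algebra.Algebra"
    "Jordan_Normal_Form.VS_Connect"
begin

section \<open>Iterated wreath products\<close>

text \<open>
  \<open>wreath G n H\<close> is meant for a group \<open>H\<close> of permutations of \<open>{1..n}\<close> with product \<open>(\<circ>)\<close>.
  The \<open>i\<close>-th entry of \<open>b^\<pi>\<close> is the entry of \<open>b\<close> at \<open>\<pi>\<inverse>(i)\<close>.
\<close>

definition wreath ::
  "('a, 'm) monoid_scheme \<Rightarrow> nat \<Rightarrow> (nat \<Rightarrow> nat) monoid \<Rightarrow> ((nat \<Rightarrow> 'a) \<times> (nat \<Rightarrow> nat)) monoid"
  where "wreath G n H =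
    \<lparr> carrier = ({1..n} \<rightarrow>\<^sub>E carrier G) \<times> carrier H,
      monoid.mult = (\<lambda>(a, p) (b, q).
        (\<lambda>i\<in>{1..n}. a i \<otimes>\<^bsub>G\<^esub> b (inv_into UNIV p i), p \<otimes>\<^bsub>H\<^esub> q)),
      one = (\<lambda>i\<in>{1..n}. \<one>\<^bsub>G\<^esub>, \<one>\<^bsub>H\<^esub>) \<rparr>"

text \<open>
  The element type of \<^const>\<open>wreath\<close> grows with each iteration. The constructor \<open>Wr\<close>, which is
  injective, folds it back into one type, and \<^const>\<open>image_group\<close> transports the group structure.
\<close>

datatype wr = Triv | Wr "(nat \<Rightarrow> wr) \<times> (nat \<Rightarrow> nat)"

primrec W :: "(nat \<Rightarrow> nat) \<Rightarrow> nat \<Rightarrow> wr monoid" where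
  "W r 0 = singleton_group Triv"
| "W r (Suc k) = image_group Wr (wreath (W r k) (r (Suc k)) (sym_group (r (Suc k))))"


section \<open>Irreducible complex representations\<close>

definition GL :: "nat \<Rightarrow> complex mat monoid" where
  "GL n = units_of (ring_mat TYPE(complex) n ())"

text \<open>A representation is recorded together with its degree.\<close>

definition reps :: "('g, 'm) monoid_scheme \<Rightarrow> (nat \<times> ('g \<Rightarrow> complex mat)) set" where
  "reps G = {(n, \<rho>). \<rho> \<in> hom G (GL n)}"

definition irreps :: "('g, 'm) monoid_scheme \<Rightarrow> (nat \<times> ('g \<Rightarrow> complex mat)) set" where
  "irreps G = {(n, \<rho>). (n, \<rho>) \<in> reps G \<and> n > 0 \<and>
     (\<forall>U. VectorSpace.subspace class_ring U (module_vec TYPE(complex) n) \<and>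
          (\<forall>g\<in>carrier G. \<forall>u\<in>U. \<rho> g *\<^sub>v u \<in> U)
        \<longrightarrow> U = {0\<^sub>v n} \<or> U = carrier_vec n)}"

definition rep_equiv ::
  "('g, 'm) monoid_scheme \<Rightarrow> ((nat \<times> ('g \<Rightarrow> complex mat)) \<times> (nat \<times> ('g \<Rightarrow> complex mat))) set"
  where "rep_equiv G = {((m, \<rho>), (n, \<sigma>)). (m, \<rho>) \<in> reps G \<and> (n, \<sigma>) \<in> reps G \<and> m = n \<and>
     (\<exists>P\<in>carrier (GL n). \<forall>g\<in>carrier G. P * \<rho> g = \<sigma> g * P)}"

definition Irr :: "('g, 'm) monoid_scheme \<Rightarrow> (nat \<times> ('g \<Rightarrow> complex mat)) set set" where
  "Irr G = irreps G // rep_equiv G"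


section \<open>The label set\<close>

definition partitions :: "nat \<Rightarrow> nat list set" where
  "partitions n = {\<alpha>. sorted_wrt (\<ge>) \<alpha> \<and> (\<forall>a\<in>set \<alpha>. a \<ge> 1) \<and> sum_list \<alpha> = n}"

definition S_part :: "nat list \<Rightarrow> (nat \<Rightarrow> nat \<Rightarrow> nat) monoid" where
  "S_part \<alpha> = product_group {..<length \<alpha>} (\<lambda>j. sym_group (\<alpha> ! j))"

type_synonym label = "nat list \<times> (nat \<times> ((nat \<Rightarrow> nat \<Rightarrow> nat) \<Rightarrow> complex mat)) set"

text \<open>
  The symmetric group \<open>S_n\<close> itself occurs as the one-factor product \<open>S_part [n]\<close>.
  The tag \<open>\<alpha>\<close> makes the union in \<open>S_hat_star\<close> disjoint.
\<close>

definition S_hat :: "nat list \<Rightarrow> label set" where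
  "S_hat \<alpha> = {\<alpha>} \<times> Irr (S_part \<alpha>)"

definition S_hat_star :: "label set" where
  "S_hat_star = (\<Union>n\<in>{1..}. \<Union>\<alpha>\<in>partitions n. S_hat \<alpha>)"


section \<open>Trees\<close>

text \<open>
  A vertex is the list of child numbers along the path from the root \<open>[]\<close> to it, so the vertices
  of the subtree rooted at the child \<open>[i]\<close> are the \<open>i # v\<close>, and \<open>i # v \<mapsto> v\<close> identifies that
  subtree with the tree of one level less. Trees and labels of level \<open>0\<close> are dummies.
\<close>

fun tree_verts :: "(nat \<Rightarrow> nat) \<Rightarrow> nat \<Rightarrow> nat list set" where
  "tree_verts r 0 = {}"
| "tree_verts r (Suc 0) = {[]}"
| "tree_verts r (Suc (Suc k)) =
     {[]} \<union> {i # v | i v. i \<in> {1..r (Suc (Suc k))} \<and> v \<in> tree_verts r (Suc k)}"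

fun tree_edges :: "(nat \<Rightarrow> nat) \<Rightarrow> nat \<Rightarrow> nat list set set" where
  "tree_edges r 0 = {}"
| "tree_edges r (Suc 0) = {}"
| "tree_edges r (Suc (Suc k)) =
     {{[], [i]} | i. i \<in> {1..r (Suc (Suc k))}} \<union>
     {(#) i ` e | i e. i \<in> {1..r (Suc (Suc k))} \<and> e \<in> tree_edges r (Suc k)}"

definition tree_aut :: "(nat \<Rightarrow> nat) \<Rightarrow> nat \<Rightarrow> (nat list \<Rightarrow> nat list) set" where
  "tree_aut r k = {\<sigma>. \<sigma> permutes tree_verts r k \<and> \<sigma> [] = [] \<and>
     (\<forall>u\<in>tree_verts r k. \<forall>v\<in>tree_verts r k.
        {u, v} \<in> tree_edges r k \<longleftrightarrow> {\<sigma> u, \<sigma> v} \<in> tree_edges r k)}"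


section \<open>Labels\<close>

definition labels :: "(nat \<Rightarrow> nat) \<Rightarrow> nat \<Rightarrow> (nat list \<Rightarrow> label) set" where
  "labels r k = tree_verts r k \<rightarrow>\<^sub>E S_hat_star"

definition relabel ::
  "(nat \<Rightarrow> nat) \<Rightarrow> nat \<Rightarrow> (nat list \<Rightarrow> nat list) \<Rightarrow> (nat list \<Rightarrow> label) \<Rightarrow> nat list \<Rightarrow> label"
  where "relabel r k \<sigma> \<phi> = (\<lambda>v\<in>tree_verts r k. \<phi> (\<sigma> v))"

definition label_equiv ::
  "(nat \<Rightarrow> nat) \<Rightarrow> nat \<Rightarrow> ((nat list \<Rightarrow> label) \<times> (nat list \<Rightarrow> label)) set"
  where "label_equiv r k = {(\<phi>, \<psi>). \<phi> \<in> labels r k \<and> \<psi> \<in> labels r k \<and>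
     (\<exists>\<sigma>\<in>tree_aut r k. relabel r k \<sigma> \<phi> = \<psi>)}"

definition sublabel ::
  "(nat \<Rightarrow> nat) \<Rightarrow> nat \<Rightarrow> (nat list \<Rightarrow> label) \<Rightarrow> nat \<Rightarrow> nat list \<Rightarrow> label"
  where "sublabel r k \<phi> i = (\<lambda>v\<in>tree_verts r k. \<phi> (i # v))"

text \<open>
  For a label \<open>\<phi>\<close> of level \<open>Suc k\<close>: the partition of \<open>r (Suc k)\<close> whose parts are the numbers of
  sublabels lying in each of the equivalence classes that contain some sublabel.
\<close>

definition root_partition :: "(nat \<Rightarrow> nat) \<Rightarrow> nat \<Rightarrow> (nat list \<Rightarrow> label) \<Rightarrow> nat list" where
  "root_partition r k \<phi> =
     (let I = {1..r (Suc k)};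
          Cs = {C \<in> labels r k // label_equiv r k. \<exists>i\<in>I. sublabel r k \<phi> i \<in> C}
      in rev (sorted_list_of_multiset
           (image_mset (\<lambda>C. card {i\<in>I. sublabel r k \<phi> i \<in> C}) (mset_set Cs))))"

fun valid_label :: "(nat \<Rightarrow> nat) \<Rightarrow> nat \<Rightarrow> (nat list \<Rightarrow> label) \<Rightarrow> bool" where
  "valid_label r 0 \<phi> \<longleftrightarrow> False"
| "valid_label r (Suc 0) \<phi> \<longleftrightarrow> \<phi> \<in> labels r (Suc 0) \<and> \<phi> [] \<in> S_hat [r 1]"
| "valid_label r (Suc (Suc k)) \<phi> \<longleftrightarrow> \<phi> \<in> labels r (Suc (Suc k)) \<and>
     (\<forall>i\<in>{1..r (Suc (Suc k))}. valid_label r (Suc k) (sublabel r (Suc k) \<phi> i)) \<and>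
     \<phi> [] \<in> S_hat (root_partition r (Suc k) \<phi>)"

definition valid_labels :: "(nat \<Rightarrow> nat) \<Rightarrow> nat \<Rightarrow> (nat list \<Rightarrow> label) set" where
  "valid_labels r k = {\<phi>. valid_label r k \<phi>}"


section \<open>The action of the wreath product\<close>

text \<open>
  Left action on vertices: \<open>(a; \<pi>)\<close> first lets \<open>\<pi>\<close> permute the subtrees below the root and then
  applies \<open>a i\<close> inside the subtree that has arrived at position \<open>i\<close>. As vertices of the tree of
  level \<open>k\<close> have length less than \<open>k\<close>, the factors at the bottom act trivially on them.
\<close>

fun vertex_act :: "wr \<Rightarrow> nat list \<Rightarrow> nat list" where
  "vertex_act g [] = []"
| "vertex_act Triv (i # v) = i # v"
| "vertex_act (Wr (a, p)) (i # v) = p i # vertex_act (a (p i)) v"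

text \<open>
  The exponent in \<open>\<phi>\<^sup>g(v) = \<phi>(v\<^sup>g)\<close> is a right action on vertices, namely that of the inverse
  of \<open>g\<close>, just as \<open>b^\<pi>\<close> has entries \<open>b (\<pi>\<inverse>(i))\<close>. Hence \<open>\<phi> \<mapsto> \<phi>\<^sup>g\<close> is a left action.
\<close>

definition label_act ::
  "(nat \<Rightarrow> nat) \<Rightarrow> nat \<Rightarrow> wr \<Rightarrow> (nat list \<Rightarrow> label) \<Rightarrow> nat list \<Rightarrow> label"
  where "label_act r k g = (\<lambda>\<phi>\<in>labels r k. relabel r k (vertex_act (inv\<^bsub>W r k\<^esub> g)) \<phi>)"

end

theory Submission
  imports Defs "Jordan_Normal_Form.Spectral_Radius"
begin

text \<open>
  Both sides are finite, and they are counted. A finite group has as many irreducible complex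
  representations as conjugacy classes, so the left-hand side is the number of conjugacy classes of
  \<open>W r k\<close>. An element \<open>(a; \<pi>)\<close> of \<open>wreath G n (sym_group n)\<close> colours each \<open>i\<close> by the
  conjugacy class in \<open>G\<close> of the product of \<open>a\<close> along the cycle of \<open>\<pi>\<close> through \<open>i\<close>. This colouring
  is invariant under \<open>\<pi>\<close>, and the numbers \<open>m C\<close> of points of colour \<open>C\<close> together with the conjugacy
  classes in \<open>sym_group (m C)\<close> of the restrictions of \<open>\<pi>\<close> to the colour classes form a complete
  invariant of conjugacy, without further constraints. Likewise a class of valid labels of level
  \<open>Suc k\<close> amounts to the numbers \<open>m C\<close> of sublabels in each class \<open>C\<close> of level \<open>k\<close> and an
  irreducible representation of the product of the groups \<open>sym_group (m C)\<close>. Hence both numbers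
  satisfy the same recursion.
\<close>

section \<open>Linear algebra\<close>

text \<open>The bijection comes from an equality of finite cardinalities, so it is not explicit.
  Representation theory enters only through \<open>card_Irr\<close>, and it does so twice: for the
  group \<open>W r k\<close>, and for the groups \<open>S_part \<alpha>\<close> whose irreducible
  representations label the vertices. The harder half of \<open>card_Irr\<close> is that a class
  function orthogonal to every irreducible character vanishes, which is seen on the regular
  representation. The passage from one level to the next is the function
  \<open>coloured_class_count\<close>. It depends on the set of colours only up to bijection, so
  conjugacy classes of groups and classes of valid labels can serve as colours alike. Two
  conventions make the recursions agree. A colour of multiplicity 0 contributes the trivial group
  \<open>sym_group 0\<close>, hence a factor 1, although \<open>root_partition\<close> records only
  the classes that occur. On the group side the recursion starts from \<open>W r 0\<close> with a
  single colour, whereas level 0 is a dummy for labels, so the comparison starts at level 1.\<close>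

text \<open>Induction on the equations: one with a nonzero coefficient is solved for its unknown,
  which is eliminated from the others. This dimension count bounds the length of independent
  families and compares irreducible characters with conjugacy classes in both directions.\<close>

lemma homogeneous_system_nontrivial:
  fixes M :: "'a \<Rightarrow> 'b \<Rightarrow> 'f::field"
  assumes "finite A" "finite B" "card A < card B"
  shows "\<exists>x. (\<exists>b\<in>B. x b \<noteq> 0) \<and> (\<forall>a\<in>A. (\<Sum>b\<in>B. M a b * x b) = 0)"
  using assms
proof (induction A arbitrary: B M rule: finite_induct)
  case empty
  then have "B \<noteq> {}" by auto
  then show ?case by (intro exI[of _ "\<lambda>_. 1"]) auto
next
  case (insert a A)
  show ?case
  proof (cases "\<forall>b\<in>B. M a b = 0")
    case True
    from insert.prems insert.hyps have "card A < card B" by simp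
    from insert.IH[OF insert.prems(1) this, of M] obtain x
      where x: "\<exists>b\<in>B. x b \<noteq> 0" "\<forall>a\<in>A. (\<Sum>b\<in>B. M a b * x b) = 0" by blast
    have "(\<Sum>b\<in>B. M a b * x b) = 0" using True by (simp add: sum.neutral)
    with x show ?thesis by auto
  next
    case False
    then obtain b0 where b0: "b0 \<in> B" "M a b0 \<noteq> 0" by blast
    define B' where "B' = B - {b0}"
    have fB': "finite B'" and cB': "card A < card B'"
      using insert b0 by (auto simp: B'_def)
    \<comment> \<open>A multiple of the equation of \<open>a\<close> is subtracted from each other
      equation so that \<open>b0\<close> disappears.\<close>
    define M' where "M' = (\<lambda>a' b. M a' b - M a' b0 / M a b0 * M a b)"
    from insert.IH[OF fB' cB', of M'] obtain x where
      x: "\<exists>b\<in>B'. x b \<noteq> 0" "\<forall>a\<in>A. (\<Sum>b\<in>B'. M' a b * x b) = 0" by blast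
    define s where "s = (\<Sum>b\<in>B'. M a b * x b)"
    \<comment> \<open>The value at \<open>b0\<close> is forced by the equation of
      \<open>a\<close>.\<close>
    define y where "y = (\<lambda>b. if b = b0 then - s / M a b0 else x b)"
    have split: "(\<Sum>b\<in>B. M a' b * y b) = M a' b0 * (- s / M a b0) + (\<Sum>b\<in>B'. M a' b * x b)" for a'
    proof -
      have "(\<Sum>b\<in>B. M a' b * y b) = M a' b0 * y b0 + (\<Sum>b\<in>B'. M a' b * y b)"
        using b0 insert.prems unfolding B'_def by (simp add: sum.remove)
      also have "(\<Sum>b\<in>B'. M a' b * y b) = (\<Sum>b\<in>B'. M a' b * x b)"
        by (rule sum.cong) (auto simp: y_def B'_def)
      finally show ?thesis by (simp add: y_def)
    qed
    have "(\<Sum>b\<in>B. M a' b * y b) = 0" if "a' \<in> A" for a'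
    proof -
      have "0 = (\<Sum>b\<in>B'. M' a' b * x b)" using x that by simp
      also have "\<dots> = (\<Sum>b\<in>B'. M a' b * x b) - M a' b0 / M a b0 * s"
        unfolding M'_def s_def by (simp add: algebra_simps sum_subtractf sum_distrib_left)
      finally show ?thesis using split[of a'] by simp
    qed
    moreover have "(\<Sum>b\<in>B. M a b * y b) = 0"
      using split[of a] b0 by (simp add: s_def)
    moreover have "\<exists>b\<in>B. y b \<noteq> 0" using x by (auto simp: y_def B'_def)
    ultimately show ?thesis by auto
  qed
qed

section \<open>Subspaces and their bases\<close>

definition lin_subspace :: "nat \<Rightarrow> complex vec set \<Rightarrow> bool" where
  "lin_subspace n U \<longleftrightarrow> U \<subseteq> carrier_vec n \<and> 0\<^sub>v n \<in> U \<and>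
     (\<forall>u\<in>U. \<forall>v\<in>U. u + v \<in> U) \<and> (\<forall>c. \<forall>u\<in>U. c \<cdot>\<^sub>v u \<in> U)"

lemma subspace_iff_lin_subspace:
  "VectorSpace.subspace class_ring U (module_vec TYPE(complex) n) \<longleftrightarrow> lin_subspace n U"
proof -
  have vs: "vectorspace class_ring (module_vec TYPE(complex) n)"
    by (rule vec_vs)
  then have "Module.module class_ring (module_vec TYPE(complex) n)"
    by (simp add: vectorspace_def)
  with vs show ?thesis
    unfolding VectorSpace.subspace_def submodule_def lin_subspace_def
    by (auto simp: module_vec_simps)
qed

text \<open>Linear independence of the columns; such a matrix stands for a basis of its
  range.\<close>

definition inj_mat :: "complex mat \<Rightarrow> bool" where
  "inj_mat B \<longleftrightarrow> (\<forall>v\<in>carrier_vec (dim_col B). B *\<^sub>v v = 0\<^sub>v (dim_row B) \<longrightarrow> v = 0\<^sub>v (dim_col B))"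

lemma inj_matD:
  assumes "inj_mat B" "B \<in> carrier_mat n d" "v \<in> carrier_vec d" "B *\<^sub>v v = 0\<^sub>v n"
  shows "v = 0\<^sub>v d"
  using assms by (auto simp: inj_mat_def)

lemma inj_mat_dim_le:
  assumes B: "B \<in> carrier_mat n d" and inj: "inj_mat B"
  shows "d \<le> n"
proof (rule ccontr)
  assume "\<not> d \<le> n"
  then have "card {0..<n} < card {0..<d}" by simp
  from homogeneous_system_nontrivial[OF _ _ this, of "\<lambda>i j. B $$ (i, j)"]
  obtain x where x: "\<exists>j\<in>{0..<d}. x j \<noteq> 0" "\<forall>i\<in>{0..<n}. (\<Sum>j=0..<d. B $$ (i, j) * x j) = 0"
    by auto
  have "B *\<^sub>v vec d x = 0\<^sub>v n"
    using B x(2) by (intro eq_vecI) (auto simp: scalar_prod_def)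
  from inj_matD[OF inj B _ this] have "vec d x = 0\<^sub>v d" by simp
  then have "x j = 0" if "j < d" for j
    using that by (metis index_vec index_zero_vec(1))
  with x(1) show False by auto
qed

lemma inj_mat_mult:
  assumes "B \<in> carrier_mat n d" "C \<in> carrier_mat d e" "inj_mat B" "inj_mat C"
  shows "inj_mat (B * C)"
  unfolding inj_mat_def
proof (intro ballI impI)
  fix v assume v: "v \<in> carrier_vec (dim_col (B * C))" and 0: "B * C *\<^sub>v v = 0\<^sub>v (dim_row (B * C))"
  have v: "v \<in> carrier_vec e" using v assms by simp
  have "B *\<^sub>v (C *\<^sub>v v) = 0\<^sub>v n" using 0 assms v by (simp add: assoc_mult_mat_vec[of _ n d _ e])
  then have "C *\<^sub>v v = 0\<^sub>v d" using inj_matD[OF assms(3,1)] assms v by simp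
  then have "v = 0\<^sub>v e" using inj_matD[OF assms(4,2)] v by simp
  then show "v = 0\<^sub>v (dim_col (B * C))" using assms by simp
qed

text \<open>In a relation between the columns of \<open>C\<close> the coefficient of
  \<open>u\<close> must vanish, since otherwise \<open>u\<close> could be solved for and would lie
  in the range of \<open>B\<close>.\<close>

lemma inj_mat_extend:
  assumes B: "B \<in> carrier_mat n d" and inj: "inj_mat B" and u: "u \<in> carrier_vec n"
    and notin: "u \<notin> (\<lambda>v. B *\<^sub>v v) ` carrier_vec d"
  defines "C \<equiv> mat n (Suc d) (\<lambda>(i, j). if j < d then B $$ (i, j) else u $ i)"
  shows "inj_mat C" and
    "\<And>v. v \<in> carrier_vec (Suc d) \<Longrightarrow> C *\<^sub>v v = B *\<^sub>v vec d (\<lambda>i. v $ i) + (v $ d) \<cdot>\<^sub>v u"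
proof -
  show Cv: "C *\<^sub>v v = B *\<^sub>v vec d (\<lambda>i. v $ i) + (v $ d) \<cdot>\<^sub>v u" if "v \<in> carrier_vec (Suc d)" for v
    using that B u
    by (intro eq_vecI) (auto simp: C_def scalar_prod_def algebra_simps intro!: sum.cong)
  show "inj_mat C" unfolding inj_mat_def
  proof (intro ballI impI)
    fix v assume "v \<in> carrier_vec (dim_col C)" and "C *\<^sub>v v = 0\<^sub>v (dim_row C)"
    then have v: "v \<in> carrier_vec (Suc d)" and 0: "C *\<^sub>v v = 0\<^sub>v n" by (auto simp: C_def)
    define w where "w = vec d (\<lambda>i. v $ i)"
    have w: "w \<in> carrier_vec d" by (simp add: w_def)
    have eq: "B *\<^sub>v w + (v $ d) \<cdot>\<^sub>v u = 0\<^sub>v n" using Cv[OF v] 0 by (simp add: w_def)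
    have vd: "v $ d = 0"
    proof (rule ccontr)
      assume nz: "v $ d \<noteq> 0"
      have "u = B *\<^sub>v ((- 1 / v $ d) \<cdot>\<^sub>v w)"
      proof (rule eq_vecI)
        fix i assume i: "i < dim_vec (B *\<^sub>v ((- 1 / v $ d) \<cdot>\<^sub>v w))"
        then have i: "i < n" using B by simp
        have "(B *\<^sub>v w + (v $ d) \<cdot>\<^sub>v u) $ i = 0" using eq i by simp
        then have "(B *\<^sub>v w) $ i + v $ d * u $ i = 0" using i B u by simp
        then have "u $ i = - (1 / v $ d) * (B *\<^sub>v w) $ i"
          using nz by (simp add: field_simps add_eq_0_iff)
        then show "u $ i = (B *\<^sub>v ((- 1 / v $ d) \<cdot>\<^sub>v w)) $ i"
          using i B w by (simp add: mult_mat_vec[OF B w])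
      qed (use B u in auto)
      then show False using notin w by auto
    qed
    moreover have "0 \<cdot>\<^sub>v u = 0\<^sub>v n" using u by (intro eq_vecI) auto
    ultimately have "B *\<^sub>v w = 0\<^sub>v n" using eq mult_mat_vec_carrier[OF B w] by simp
    then have "w = 0\<^sub>v d" using inj_matD[OF inj B w] by simp
    then have "v $ i = 0" if "i < d" for i
      using that unfolding w_def by (metis index_vec index_zero_vec(1))
    with vd have "v $ i = 0" if "i < Suc d" for i using that by (auto simp: less_Suc_eq)
    then show "v = 0\<^sub>v (dim_col C)" using v by (intro eq_vecI) (auto simp: C_def)
  qed
qed

text \<open>A longest family of independent columns inside \<open>U\<close> spans \<open>U\<close>;
  it exists because \<open>inj_mat_dim_le\<close> bounds its length by \<open>n\<close>. The last
  two conclusions provide the strict drop of dimension needed when a minimal invariant subspace is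
  shown to be irreducible.\<close>

lemma lin_subspace_basis:
  assumes U: "lin_subspace n U"
  obtains d B where "B \<in> carrier_mat n d" "inj_mat B" "(\<lambda>v. B *\<^sub>v v) ` carrier_vec d = U"
    "U \<noteq> carrier_vec n \<longrightarrow> d < n" "U \<noteq> {0\<^sub>v n} \<longrightarrow> d > 0"
proof -
  define P where "P = (\<lambda>d. \<exists>B. B \<in> carrier_mat n d \<and> inj_mat B \<and> (\<lambda>v. B *\<^sub>v v) ` carrier_vec d \<subseteq> U)"
  have P0: "P 0"
  proof -
    have "inj_mat (0\<^sub>m n 0)" by (auto simp: inj_mat_def)
    moreover have "0\<^sub>m n 0 *\<^sub>v v = 0\<^sub>v n" if "v \<in> carrier_vec 0" for v :: "complex vec"
      using that by (intro eq_vecI) (auto simp: scalar_prod_def)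
    then have "(\<lambda>v. 0\<^sub>m n 0 *\<^sub>v v) ` carrier_vec 0 \<subseteq> U"
      using U by (auto simp: lin_subspace_def)
    ultimately show ?thesis unfolding P_def by (intro exI[of _ "0\<^sub>m n 0"]) auto
  qed
  have bound: "\<forall>d. P d \<longrightarrow> d \<le> n" unfolding P_def using inj_mat_dim_le by blast
  obtain d where d: "P d" and max: "\<And>e. P e \<Longrightarrow> e \<le> d"
    using Nat.ex_has_greatest_nat[where P = P, OF P0 bound] by blast
  then obtain B where B: "B \<in> carrier_mat n d" "inj_mat B" "(\<lambda>v. B *\<^sub>v v) ` carrier_vec d \<subseteq> U"
    by (auto simp: P_def)
  have "U \<subseteq> (\<lambda>v. B *\<^sub>v v) ` carrier_vec d"
  proof (rule subsetI, rule ccontr)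
    \<comment> \<open>Such a \<open>u\<close> could be appended as a further column, against the
      maximality of \<open>d\<close>.\<close>
    fix u assume u: "u \<in> U" "u \<notin> (\<lambda>v. B *\<^sub>v v) ` carrier_vec d"
    have uc: "u \<in> carrier_vec n" using u U by (auto simp: lin_subspace_def)
    have "(\<lambda>v. mat n (Suc d) (\<lambda>(i, j). if j < d then B $$ (i, j) else u $ i) *\<^sub>v v)
      ` carrier_vec (Suc d) \<subseteq> U"
      using U u(1) B(3) inj_mat_extend(2)[OF B(1,2) uc u(2)]
      by (auto simp: lin_subspace_def image_subset_iff)
    then have "P (Suc d)" unfolding P_def
      using inj_mat_extend(1)[OF B(1,2) uc u(2)] by (intro exI[of _ "mat n (Suc d) _"]) auto
    from max[OF this] show False by simp
  qed
  with B have im: "(\<lambda>v. B *\<^sub>v v) ` carrier_vec d = U" by auto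
  have "d < n" if ne: "U \<noteq> carrier_vec n"
  proof -
    have "U \<subseteq> carrier_vec n" using U by (auto simp: lin_subspace_def)
    with ne obtain u where u: "u \<in> carrier_vec n" "u \<notin> (\<lambda>v. B *\<^sub>v v) ` carrier_vec d"
      using im by auto
    \<comment> \<open>A vector outside \<open>U\<close> appended to the basis still leaves the
      columns independent, now \<open>Suc d\<close> of them.\<close>
    from inj_mat_dim_le[of _ n "Suc d", OF _ inj_mat_extend(1)[OF B(1,2) u]] show ?thesis by simp
  qed
  moreover have "d > 0" if "U \<noteq> {0\<^sub>v n}"
  proof (rule ccontr)
    assume "\<not> d > 0"
    then have "U = {B *\<^sub>v v | v. v \<in> carrier_vec 0}" using im by auto
    also have "\<dots> = {0\<^sub>v n}"
    proof -
      have "B *\<^sub>v v = 0\<^sub>v n" if "v \<in> carrier_vec 0" for v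
        using that B \<open>\<not> d > 0\<close> by (intro eq_vecI) (auto simp: scalar_prod_def)
      then show ?thesis by (auto intro!: exI[of _ "0\<^sub>v 0"])
    qed
    finally show False using that by simp
  qed
  ultimately show thesis using that B im by blast
qed

lemma mat_eqI_mult_vec:
  fixes A B :: "complex mat"
  assumes "A \<in> carrier_mat m n" "B \<in> carrier_mat m n"
    and "\<And>v. v \<in> carrier_vec n \<Longrightarrow> A *\<^sub>v v = B *\<^sub>v v"
  shows "A = B"
proof (rule eq_matI)
  fix i j assume ij: "i < dim_row B" "j < dim_col B"
  have "(A *\<^sub>v unit_vec n j) $ i = (B *\<^sub>v unit_vec n j) $ i" using assms(3) by simp
  then show "A $$ (i, j) = B $$ (i, j)"
    using assms(1,2) ij by simp
qed (use assms in auto)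

section \<open>Traces, sums of matrices and matrix units\<close>

definition mat_trace :: "complex mat \<Rightarrow> complex" where
  "mat_trace A = (\<Sum>i<dim_row A. A $$ (i, i))"

lemma mat_trace_carrier: "A \<in> carrier_mat n n \<Longrightarrow> mat_trace A = (\<Sum>i<n. A $$ (i, i))"
  by (simp add: mat_trace_def)

lemma mat_trace_mult_commute:
  assumes "A \<in> carrier_mat m n" "B \<in> carrier_mat n m"
  shows "mat_trace (A * B) = mat_trace (B * A)"
proof -
  have "mat_trace (A * B) = (\<Sum>i<m. \<Sum>j<n. A $$ (i, j) * B $$ (j, i))"
    using assms by (auto simp: mat_trace_def scalar_prod_def lessThan_atLeast0 intro!: sum.cong)
  also have "\<dots> = (\<Sum>j<n. \<Sum>i<m. A $$ (i, j) * B $$ (j, i))" by (rule sum.swap)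
  also have "\<dots> = mat_trace (B * A)"
    using assms by (auto simp: mat_trace_def scalar_prod_def lessThan_atLeast0 mult.commute
      intro!: sum.cong)
  finally show ?thesis .
qed

text \<open>The dimensions are parameters because the type of matrices does not determine them, and
  an empty sum still has to be an \<open>m\<close> by \<open>n\<close> matrix.\<close>

definition mat_sum :: "nat \<Rightarrow> nat \<Rightarrow> ('a \<Rightarrow> complex mat) \<Rightarrow> 'a set \<Rightarrow> complex mat" where
  "mat_sum m n F A = mat m n (\<lambda>(i, j). \<Sum>x\<in>A. F x $$ (i, j))"

lemma mat_sum_carrier [simp]: "mat_sum m n F A \<in> carrier_mat m n"
  by (simp add: mat_sum_def)

lemma mat_sum_index [simp]:
  "i < m \<Longrightarrow> j < n \<Longrightarrow> mat_sum m n F A $$ (i, j) = (\<Sum>x\<in>A. F x $$ (i, j))"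
  by (simp add: mat_sum_def)

lemma mat_sum_dim [simp]: "dim_row (mat_sum m n F A) = m" "dim_col (mat_sum m n F A) = n"
  by (simp_all add: mat_sum_def)

lemma mat_sum_cong: "(\<And>x. x \<in> A \<Longrightarrow> F x = F' x) \<Longrightarrow> mat_sum m n F A = mat_sum m n F' A"
  by (simp add: mat_sum_def)

lemma mat_sum_reindex: "bij_betw h A B \<Longrightarrow> mat_sum m n F B = mat_sum m n (\<lambda>x. F (h x)) A"
  by (simp add: mat_sum_def sum.reindex_bij_betw[of h A B, symmetric])

lemma mult_mat_sum:
  assumes T: "T \<in> carrier_mat l m" and F: "\<And>x. x \<in> A \<Longrightarrow> F x \<in> carrier_mat m n"
  shows "T * mat_sum m n F A = mat_sum l n (\<lambda>x. T * F x) A"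
proof (rule eq_matI)
  fix i j assume "i < dim_row (mat_sum l n (\<lambda>x. T * F x) A)" "j < dim_col (mat_sum l n (\<lambda>x.
    T * F x) A)"
  then have ij: "i < l" "j < n" by auto
  have "(T * mat_sum m n F A) $$ (i, j) = (\<Sum>k = 0..<m. \<Sum>x\<in>A. T $$ (i, k) * F x $$ (k, j))"
    using T ij by (simp add: scalar_prod_def sum_distrib_left)
  also have "\<dots> = (\<Sum>x\<in>A. \<Sum>k = 0..<m. T $$ (i, k) * F x $$ (k, j))" by (rule sum.swap)
  also have "\<dots> = (\<Sum>x\<in>A. (T * F x) $$ (i, j))"
  proof (rule sum.cong)
    fix x assume "x \<in> A"
    from F[OF this] show "(\<Sum>k = 0..<m. T $$ (i, k) * F x $$ (k, j)) = (T * F x) $$ (i, j)"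
      using T ij by (simp add: scalar_prod_def)
  qed simp
  finally show "(T * mat_sum m n F A) $$ (i, j) = mat_sum l n (\<lambda>x. T * F x) A $$ (i, j)"
    using ij by simp
qed (use T in auto)

lemma mat_sum_mult:
  assumes T: "T \<in> carrier_mat n l" and F: "\<And>x. x \<in> A \<Longrightarrow> F x \<in> carrier_mat m n"
  shows "mat_sum m n F A * T = mat_sum m l (\<lambda>x. F x * T) A"
proof (rule eq_matI)
  fix i j assume "i < dim_row (mat_sum m l (\<lambda>x. F x * T) A)" "j < dim_col (mat_sum m l (\<lambda>x.
    F x * T) A)"
  then have ij: "i < m" "j < l" by auto
  have "(mat_sum m n F A * T) $$ (i, j) = (\<Sum>k = 0..<n. \<Sum>x\<in>A. F x $$ (i, k) * T $$ (k, j))"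
    using T ij by (simp add: scalar_prod_def sum_distrib_right)
  also have "\<dots> = (\<Sum>x\<in>A. \<Sum>k = 0..<n. F x $$ (i, k) * T $$ (k, j))" by (rule sum.swap)
  also have "\<dots> = (\<Sum>x\<in>A. (F x * T) $$ (i, j))"
  proof (rule sum.cong)
    fix x assume "x \<in> A"
    from F[OF this] show "(\<Sum>k = 0..<n. F x $$ (i, k) * T $$ (k, j)) = (F x * T) $$ (i, j)"
      using T ij by (simp add: scalar_prod_def)
  qed simp
  finally show "(mat_sum m n F A * T) $$ (i, j) = mat_sum m l (\<lambda>x. F x * T) A $$ (i, j)"
    using ij by simp
qed (use T in auto)

lemma lin_subspace_range:
  fixes T :: "complex mat"
  assumes T: "T \<in> carrier_mat m n"
  shows "lin_subspace m ((\<lambda>v. T *\<^sub>v v) ` carrier_vec n)"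
  unfolding lin_subspace_def
proof (intro conjI ballI allI)
    show "(\<lambda>v. T *\<^sub>v v) ` carrier_vec n \<subseteq> carrier_vec m" using T by auto
    show "0\<^sub>v m \<in> (\<lambda>v. T *\<^sub>v v) ` carrier_vec n" using T
      by (intro image_eqI[of _ _ "0\<^sub>v n"]) (auto intro!: eq_vecI simp: scalar_prod_def)
    fix u v assume "u \<in> (\<lambda>v. T *\<^sub>v v) ` carrier_vec n" "v \<in> (\<lambda>v. T *\<^sub>v v) ` carrier_vec n"
    then obtain u' v' where "u' \<in> carrier_vec n" "v' \<in> carrier_vec n" "u = T *\<^sub>v u'" "v = T *\<^sub>v v'"
      by auto
    then show "u + v \<in> (\<lambda>v. T *\<^sub>v v) ` carrier_vec n"
      using T by (intro image_eqI[of _ _ "u' + v'"]) (auto simp: mult_add_distrib_mat_vec[of _ m n])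
  next
    fix c u assume "u \<in> (\<lambda>v. T *\<^sub>v v) ` carrier_vec n"
    then obtain u' where "u' \<in> carrier_vec n" "u = T *\<^sub>v u'" by auto
    then show "c \<cdot>\<^sub>v u \<in> (\<lambda>v. T *\<^sub>v v) ` carrier_vec n"
      using T by (intro image_eqI[of _ _ "c \<cdot>\<^sub>v u'"]) (auto simp: mult_mat_vec[of _ m n])
qed

definition mat_unit :: "nat \<Rightarrow> nat \<Rightarrow> nat \<Rightarrow> nat \<Rightarrow> complex mat" where
  "mat_unit m n j k = mat m n (\<lambda>(a, b). if a = j \<and> b = k then 1 else 0)"

lemma mat_unit_carrier [simp]: "mat_unit m n j k \<in> carrier_mat m n"
  by (simp add: mat_unit_def)

text \<open>With a matrix unit in the middle, an entry of the product isolates one entry of each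
  outer factor. Averaged over a group, this produces the sums in the orthogonality
  relations.\<close>

lemma mult_mat_unit_mult_index:
  assumes A: "A \<in> carrier_mat m m" and B: "B \<in> carrier_mat n n"
    and "i < m" "j < m" "k < n" "l < n"
  shows "(A * mat_unit m n j k * B) $$ (i, l) = A $$ (i, j) * B $$ (k, l)"
proof -
  have 1: "(A * mat_unit m n j k) $$ (i, b) = (if b = k then A $$ (i, j) else 0)" if "b < n" for b
  proof -
    have "(A * mat_unit m n j k) $$ (i, b) = (\<Sum>a = 0..<m. if a = j then (if b =
      k then A $$ (i, a) else 0) else 0)"
    proof -
      have "(A * mat_unit m n j k) $$ (i, b) = (\<Sum>a =
        0..<m. A $$ (i, a) * mat_unit m n j k $$ (a, b))"
        using A assms(3) that mat_unit_carrier[of m n j k]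
          by (simp add: scalar_prod_def mat_unit_def)
      also have "\<dots> = (\<Sum>a = 0..<m. if a = j then (if b = k then A $$ (i, a) else 0) else 0)"
        using that by (intro sum.cong) (auto simp: mat_unit_def)
      finally show ?thesis .
    qed
    also have "\<dots> = (if b = k then A $$ (i, j) else 0)" using assms by (simp add: sum.delta)
    finally show ?thesis .
  qed
  define E where "E = A * mat_unit m n j k"
  have E: "E \<in> carrier_mat m n" using A by (auto simp: E_def)
  have "(E * B) $$ (i, l) = (\<Sum>b = 0..<n. E $$ (i, b) * B $$ (b, l))"
    using E B assms by (simp add: scalar_prod_def)
  then have "(A * mat_unit m n j k * B) $$ (i, l) = (\<Sum>b =
    0..<n. (A * mat_unit m n j k) $$ (i, b) * B $$ (b, l))"
    by (simp only: E_def)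
  also have "\<dots> = (\<Sum>b = 0..<n. if b = k then A $$ (i, j) * B $$ (b, l) else 0)"
    by (rule sum.cong) (simp_all add: 1)
  also have "\<dots> = A $$ (i, j) * B $$ (k, l)" using assms by (simp add: sum.delta)
  finally show ?thesis .
qed

section \<open>Representations\<close>

lemma carrier_GL_iff:
  "A \<in> carrier (GL n) \<longleftrightarrow>
     A \<in> carrier_mat n n \<and> (\<exists>B\<in>carrier_mat n n. B * A = 1\<^sub>m n \<and> A * B = 1\<^sub>m n)"
  by (auto simp: GL_def units_of_def Units_def ring_mat_simps)

lemma mult_GL: "x \<otimes>\<^bsub>GL n\<^esub> y = x * y" and one_GL: "\<one>\<^bsub>GL n\<^esub> = 1\<^sub>m n"
  by (simp_all add: GL_def units_of_def ring_mat_simps)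

lemma group_GL: "group (GL n)"
proof -
  interpret ring "ring_mat TYPE(complex) n ()" by (rule ring_mat)
  show ?thesis unfolding GL_def by (rule units_group)
qed

lemma GL_kernel_trivial:
  assumes "A \<in> carrier (GL n)" "v \<in> carrier_vec n" "A *\<^sub>v v = 0\<^sub>v n"
  shows "v = 0\<^sub>v n"
proof -
  obtain B where B: "A \<in> carrier_mat n n" "B \<in> carrier_mat n n" "B * A = 1\<^sub>m n"
    using assms by (auto simp: carrier_GL_iff)
  have "v = B * A *\<^sub>v v" using B assms by simp
  also have "\<dots> = B *\<^sub>v (A *\<^sub>v v)" by (rule assoc_mult_mat_vec[OF B(2,1) assms(2)])
  also have "\<dots> = B *\<^sub>v 0\<^sub>v n" using assms by simp
  also have "\<dots> = 0\<^sub>v n" using B by (intro eq_vecI) (auto simp: scalar_prod_def)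
  finally show ?thesis .
qed

lemma mat_trace_similar:
  assumes "P \<in> carrier (GL n)" "A \<in> carrier_mat n n" "B \<in> carrier_mat n n" "P * A = B * P"
  shows "mat_trace A = mat_trace B"
proof -
  from assms(1) obtain Q where PQ: "P \<in> carrier_mat n n" "Q \<in> carrier_mat n n" "Q * P =
    1\<^sub>m n" "P * Q = 1\<^sub>m n"
    by (auto simp: carrier_GL_iff)
  have "A = Q * (P * A)" using PQ(3) assoc_mult_mat[OF PQ(2,1) assms(2)] assms(2) by simp
  then have "mat_trace A = mat_trace (Q * (B * P))" using assms(4) by simp
  also have "\<dots> = mat_trace (B * P * Q)"
    using mat_trace_mult_commute PQ(2) mult_carrier_mat[OF assms(3) PQ(1)] by blast
  also have "B * P * Q = B" using assoc_mult_mat[OF assms(3) PQ(1,2)] PQ(4) assms(3) by simp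
  finally show ?thesis .
qed

section \<open>Basic facts on representations, and Schur's lemma\<close>

context group
begin

lemma reps_carrier: "(n, \<rho>) \<in> reps G \<Longrightarrow> g \<in> carrier G \<Longrightarrow> \<rho> g \<in> carrier_mat n n"
  by (auto simp: reps_def hom_def carrier_GL_iff)

lemma reps_mult:
  "(n, \<rho>) \<in> reps G \<Longrightarrow> g \<in> carrier G \<Longrightarrow> h \<in> carrier G \<Longrightarrow> \<rho> (g \<otimes> h) = \<rho> g * \<rho> h"
  by (auto simp: reps_def hom_def mult_GL)

lemma reps_one: "(n, \<rho>) \<in> reps G \<Longrightarrow> \<rho> \<one> = 1\<^sub>m n"
  using hom_one[of \<rho> G "GL n"] is_group group_GL[of n] by (auto simp: reps_def one_GL)

text \<open>Invertibility of the values is automatic: the value at the inverse element is an inverse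
  matrix.\<close>

lemma repsI:
  assumes "\<And>g. g \<in> carrier G \<Longrightarrow> \<rho> g \<in> carrier_mat n n"
    and "\<And>g h. g \<in> carrier G \<Longrightarrow> h \<in> carrier G \<Longrightarrow> \<rho> (g \<otimes> h) = \<rho> g * \<rho> h"
    and "\<rho> \<one> = 1\<^sub>m n"
  shows "(n, \<rho>) \<in> reps G"
proof -
  have "\<rho> g \<in> carrier (GL n)" if "g \<in> carrier G" for g
    using assms(1)[of g] assms(1)[of "inv g"] assms(2)[of g "inv g"] assms(2)[of "inv g" g] assms(3)
      that
    by (auto simp: carrier_GL_iff)
  then show ?thesis using assms by (auto simp: reps_def hom_def mult_GL)
qed

lemma irreps_reps: "(n, \<rho>) \<in> irreps G \<Longrightarrow> (n, \<rho>) \<in> reps G"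
  by (simp add: irreps_def)

lemma irreps_pos: "(n, \<rho>) \<in> irreps G \<Longrightarrow> n > 0"
  by (simp add: irreps_def)

lemma irrepsD:
  assumes "(n, \<rho>) \<in> irreps G" "lin_subspace n U"
    "\<And>g u. g \<in> carrier G \<Longrightarrow> u \<in> U \<Longrightarrow> \<rho> g *\<^sub>v u \<in> U"
  shows "U = {0\<^sub>v n} \<or> U = carrier_vec n"
  using assms by (auto simp: irreps_def subspace_iff_lin_subspace)

text \<open>The kernel and the range of \<open>T\<close> are invariant subspaces. As
  \<open>T\<close> is nonzero, irreducibility makes the kernel zero and the range the whole
  space.\<close>

lemma Schur_iso:
  assumes \<rho>: "(m, \<rho>) \<in> irreps G" and \<sigma>: "(n, \<sigma>) \<in> irreps G"
    and T: "T \<in> carrier_mat m n"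
    and comm: "\<And>g. g \<in> carrier G \<Longrightarrow> \<rho> g * T = T * \<sigma> g"
    and nz: "T \<noteq> 0\<^sub>m m n"
  shows "m = n" "T \<in> carrier (GL n)"
proof -
  note r = reps_carrier[OF irreps_reps[OF \<rho>]] and s = reps_carrier[OF irreps_reps[OF \<sigma>]]
  have app: "\<rho> g *\<^sub>v (T *\<^sub>v v) = T *\<^sub>v (\<sigma> g *\<^sub>v v)" if "g \<in> carrier G" "v \<in> carrier_vec n" for g v
    using assoc_mult_mat_vec[OF r[OF that(1)] T that(2)] assoc_mult_mat_vec[OF T s[OF that(1)]
      that(2)]
      comm[OF that(1)] by simp
  have not0: "\<exists>v\<in>carrier_vec n. T *\<^sub>v v \<noteq> 0\<^sub>v m"
  proof (rule ccontr)
    assume "\<not> ?thesis"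
    then have "T = 0\<^sub>m m n" using T by (intro mat_eqI_mult_vec[of _ m n]) auto
    with nz show False by simp
  qed
  have T0: "T *\<^sub>v 0\<^sub>v n = 0\<^sub>v m" using T by (intro eq_vecI) (auto simp: scalar_prod_def)
  define K where "K = {v \<in> carrier_vec n. T *\<^sub>v v = 0\<^sub>v m}"
  have "lin_subspace n K" unfolding lin_subspace_def K_def
    using T T0 by (auto simp: mult_add_distrib_mat_vec[of _ m n] mult_mat_vec[of _ m n])
  moreover have "\<sigma> g *\<^sub>v u \<in> K" if "g \<in> carrier G" "u \<in> K" for g u
  proof -
    have u: "u \<in> carrier_vec n" "T *\<^sub>v u = 0\<^sub>v m" using that by (auto simp: K_def)
    have "T *\<^sub>v (\<sigma> g *\<^sub>v u) = \<rho> g *\<^sub>v 0\<^sub>v m" using app[OF that(1) u(1)] u by simp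
    also have "\<dots> = 0\<^sub>v m" using r[OF that(1)] by (intro eq_vecI) (auto simp: scalar_prod_def)
    finally show ?thesis using s[OF that(1)] u by (auto simp: K_def)
  qed
  ultimately have "K = {0\<^sub>v n} \<or> K = carrier_vec n" by (rule irrepsD[OF \<sigma>])
  with not0 have K: "K = {0\<^sub>v n}" by (auto simp: K_def)
  define R where "R = (\<lambda>v. T *\<^sub>v v) ` carrier_vec n"
  have "lin_subspace m R" unfolding R_def by (rule lin_subspace_range[OF T])
  moreover have "\<rho> g *\<^sub>v u \<in> R" if gu: "g \<in> carrier G" "u \<in> R" for g u
  proof -
    obtain v where v: "v \<in> carrier_vec n" "u = T *\<^sub>v v" using gu(2) by (auto simp: R_def)
    then show ?thesis using app[OF gu(1) v(1)] s[OF gu(1)] by (auto simp: R_def)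
  qed
  ultimately have "R = {0\<^sub>v m} \<or> R = carrier_vec m" by (rule irrepsD[OF \<rho>])
  with not0 have R: "R = carrier_vec m" by (auto simp: R_def)
  \<comment> \<open>A right inverse is assembled from preimages of the unit vectors.\<close>
  have "\<forall>i. \<exists>y. y \<in> carrier_vec n \<and> (i < m \<longrightarrow> T *\<^sub>v y = unit_vec m i)"
  proof
    fix i
    have "unit_vec m i \<in> R" using R by simp
    then show "\<exists>y. y \<in> carrier_vec n \<and> (i < m \<longrightarrow> T *\<^sub>v y = unit_vec m i)" by (auto simp: R_def)
  qed
  then obtain y where y: "\<And>i. y i \<in> carrier_vec n" "\<And>i. i < m \<Longrightarrow> T *\<^sub>v y i = unit_vec m i" by metis
  define Y where "Y = mat n m (\<lambda>(i, j). y j $ i)"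
  have Y: "Y \<in> carrier_mat n m" by (simp add: Y_def)
  have colY: "col Y j = y j" if "j < m" for j
    using that y(1)[of j] by (intro eq_vecI) (auto simp: Y_def)
  have TY: "T * Y = 1\<^sub>m m"
  proof (rule eq_matI)
    fix i j assume "i < dim_row (1\<^sub>m m)" "j < dim_col (1\<^sub>m m)"
    then have ij: "i < m" "j < m" by auto
    have "(T * Y) $$ (i, j) = (T *\<^sub>v y j) $ i" using ij T Y colY by simp
    then show "(T * Y) $$ (i, j) = 1\<^sub>m m $$ (i, j)" using y(2)[of j] ij by simp
  qed (use T Y in auto)
  have YT: "Y * T = 1\<^sub>m n"
  proof (rule mat_eqI_mult_vec[of _ n n])
    fix v :: "complex vec" assume v: "v \<in> carrier_vec n"
    have YTv: "Y * T *\<^sub>v v \<in> carrier_vec n" using Y T v by auto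
    \<comment> \<open>\<open>T\<close> sends \<open>Y * T *\<^sub>v v\<close> and \<open>v\<close>
      to the same vector, and its kernel is zero.\<close>
    have "T *\<^sub>v (Y * T *\<^sub>v v) = T *\<^sub>v v"
      using T Y v TY assoc_mult_mat_vec[OF T mult_carrier_mat[OF Y T] v] assoc_mult_mat[OF T Y T]
        by simp
    then have "T *\<^sub>v (Y * T *\<^sub>v v - v) = 0\<^sub>v m"
      using T v YTv by (simp add: mult_minus_distrib_mat_vec[of _ m n])
    then have "Y * T *\<^sub>v v - v \<in> K" using v YTv by (auto simp: K_def)
    then have 0: "Y * T *\<^sub>v v - v = 0\<^sub>v n" using K by auto
    have coords: "(Y * T *\<^sub>v v) $ i = v $ i" if "i < n" for i
    proof -
      have "(Y * T *\<^sub>v v - v) $ i = 0" using 0 that by simp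
      then show ?thesis using v YTv that by auto
    qed
    have "Y * T *\<^sub>v v = v"
    proof (rule eq_vecI)
      fix i assume "i < dim_vec v"
      then show "(Y * T *\<^sub>v v) $ i = v $ i" using coords carrier_vecD[OF v] by simp
    next
      show "dim_vec (Y * T *\<^sub>v v) = dim_vec v"
        unfolding carrier_vecD[OF v] by (rule carrier_vecD[OF YTv])
    qed
    then show "Y * T *\<^sub>v v = 1\<^sub>m n *\<^sub>v v" using v by simp
  qed (use T Y in auto)
  \<comment> \<open>\<open>T * Y\<close> and \<open>Y * T\<close> have equal traces; both are
    identity matrices, whose trace is the degree as a complex number.\<close>
  have "mat_trace (1\<^sub>m m) = mat_trace (1\<^sub>m n)" using mat_trace_mult_commute[OF T Y] TY YT by simp
  then show mn: "m = n" by (simp add: mat_trace_def)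
  show "T \<in> carrier (GL n)" using T Y TY YT mn by (auto simp: carrier_GL_iff)
qed

text \<open>Subtracting an eigenvalue, which exists over the complex numbers as
  \<open>n > 0\<close>, leaves an intertwiner that annihilates an eigenvector. It cannot be
  invertible, so it is zero by \<open>Schur_iso\<close>.\<close>

lemma Schur_scalar:
  assumes \<rho>: "(n, \<rho>) \<in> irreps G" and T: "T \<in> carrier_mat n n"
    and comm: "\<And>g. g \<in> carrier G \<Longrightarrow> \<rho> g * T = T * \<rho> g"
  shows "\<exists>c. T = c \<cdot>\<^sub>m 1\<^sub>m n"
proof -
  note r = reps_carrier[OF irreps_reps[OF \<rho>]]
  from spectrum_non_empty[OF T irreps_pos[OF \<rho>]] obtain c v where
    ev: "eigenvector T v c" by (auto simp: spectrum_def eigenvalue_def)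
  then have v: "v \<in> carrier_vec n" "v \<noteq> 0\<^sub>v n" "T *\<^sub>v v = c \<cdot>\<^sub>v v"
    using T by (auto simp: eigenvector_def)
  define S where "S = T - c \<cdot>\<^sub>m 1\<^sub>m n"
  have S: "S \<in> carrier_mat n n" unfolding S_def by (intro minus_carrier_mat) simp
  have comS: "\<rho> g * S = S * \<rho> g" if "g \<in> carrier G" for g
    using T r[OF that] comm[OF that] unfolding S_def
    by (simp add: mult_minus_distrib_mat[of _ n n] minus_mult_distrib_mat[of _ n n]
        mult_smult_distrib[OF r[OF that] one_carrier_mat] mult_smult_assoc_mat[OF one_carrier_mat
          r[OF that]])
  have "S = 0\<^sub>m n n"
  proof (rule ccontr)
    assume "S \<noteq> 0\<^sub>m n n"
    from Schur_iso(2)[OF \<rho> \<rho> S comS this] have GL: "S \<in> carrier (GL n)" .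
    have "S *\<^sub>v v = T *\<^sub>v v - (c \<cdot>\<^sub>m 1\<^sub>m n) *\<^sub>v v"
      unfolding S_def using T v(1) by (simp add: minus_mult_distrib_mat_vec[of _ n n])
    also have "\<dots> = 0\<^sub>v n" using v by (intro eq_vecI) auto
    finally show False using GL_kernel_trivial[OF GL v(1)] v(2) by simp
  qed
  then have "T $$ (i, j) = (c \<cdot>\<^sub>m 1\<^sub>m n) $$ (i, j)" if "i < n" "j < n" for i j
  proof -
    have "S $$ (i, j) = 0" using \<open>S = 0\<^sub>m n n\<close> that by simp
    then show ?thesis using that T by (simp add: S_def)
  qed
  then have "T = c \<cdot>\<^sub>m 1\<^sub>m n" using T by (intro eq_matI) auto
  then show ?thesis ..
qed

end

section \<open>Conjugacy classes\<close>

definition conj_class :: "('a, 'm) monoid_scheme \<Rightarrow> 'a \<Rightarrow> 'a set" where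
  "conj_class G x = {g \<otimes>\<^bsub>G\<^esub> x \<otimes>\<^bsub>G\<^esub> inv\<^bsub>G\<^esub> g | g. g \<in> carrier G}"

definition conj_classes :: "('a, 'm) monoid_scheme \<Rightarrow> 'a set set" where
  "conj_classes G = conj_class G ` carrier G"

locale finite_group = group +
  assumes finite_carrier [simp]: "finite (carrier G)"

context group
begin

lemma conj_class_self: "x \<in> carrier G \<Longrightarrow> x \<in> conj_class G x"
  unfolding conj_class_def by (auto intro!: exI[of _ \<one>])

lemma conj_class_closed: "x \<in> carrier G \<Longrightarrow> y \<in> conj_class G x \<Longrightarrow> y \<in> carrier G"
  by (auto simp: conj_class_def)

lemma conj_class_subset:
  assumes x: "x \<in> carrier G" and y: "y \<in> conj_class G x"
  shows "conj_class G y \<subseteq> conj_class G x"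
proof
  fix z assume "z \<in> conj_class G y"
  with y obtain g h where gh: "g \<in> carrier G" "h \<in> carrier G" "y = g \<otimes> x \<otimes> inv g" "z =
    h \<otimes> y \<otimes> inv h"
    by (auto simp: conj_class_def)
  then have "z = (h \<otimes> g) \<otimes> x \<otimes> inv (h \<otimes> g)" using x by (simp add: inv_mult_group m_assoc)
  then show "z \<in> conj_class G x" using gh x by (auto simp: conj_class_def)
qed

lemma conj_class_sym:
  assumes x: "x \<in> carrier G" and y: "y \<in> conj_class G x"
  shows "x \<in> conj_class G y"
proof -
  from y obtain g where g: "g \<in> carrier G" "y = g \<otimes> x \<otimes> inv g" by (auto simp: conj_class_def)
  then have "x = inv g \<otimes> y \<otimes> inv (inv g)" using x
    by (simp add: m_assoc[symmetric]) (simp add: m_assoc)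
  then show ?thesis unfolding conj_class_def
    by (intro CollectI exI[of _ "inv g"] conjI inv_closed g(1))
qed

text \<open>The right-hand side contains no inverses; in this form conjugacy passes componentwise to
  products and splits into explicit conditions in wreath products.\<close>

lemma conj_class_eq_iff:
  assumes "x \<in> carrier G" "y \<in> carrier G"
  shows "conj_class G x = conj_class G y \<longleftrightarrow> (\<exists>g\<in>carrier G. y \<otimes> g = g \<otimes> x)"
proof
  assume "conj_class G x = conj_class G y"
  then have "y \<in> conj_class G x" using conj_class_self[OF assms(2)] by simp
  then obtain g where "g \<in> carrier G" "y = g \<otimes> x \<otimes> inv g" by (auto simp: conj_class_def)
  then show "\<exists>g\<in>carrier G. y \<otimes> g = g \<otimes> x" using assms(1)
    by (intro bexI[of _ g]) (simp_all add: m_assoc)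
next
  assume "\<exists>g\<in>carrier G. y \<otimes> g = g \<otimes> x"
  then obtain g where "g \<in> carrier G" "y \<otimes> g = g \<otimes> x" by auto
  then have "y = g \<otimes> x \<otimes> inv g" using assms by (metis inv_solve_right m_closed)
  then have "y \<in> conj_class G x" using \<open>g \<in> carrier G\<close> by (auto simp: conj_class_def)
  then show "conj_class G x = conj_class G y"
    using conj_class_subset conj_class_sym assms by blast
qed

end

section \<open>Orthogonality of irreducible characters\<close>

context finite_group
begin

text \<open>Replacing the summation variable \<open>g\<close> by \<open>h \<otimes> g\<close> moves
  \<open>h\<close> from the right of the average to its left.\<close>

lemma average_intertwines:
  assumes \<rho>: "(m, \<rho>) \<in> reps G" and \<sigma>: "(n, \<sigma>) \<in> reps G" and M: "M \<in> carrier_mat m n"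
    and h: "h \<in> carrier G"
  defines "T \<equiv> mat_sum m n (\<lambda>g. \<rho> g * M * \<sigma> (inv g)) (carrier G)"
  shows "\<rho> h * T = T * \<sigma> h"
proof -
  note r = reps_carrier[OF \<rho>] and s = reps_carrier[OF \<sigma>]
  have F: "\<rho> g * M * \<sigma> (inv g) \<in> carrier_mat m n" if "g \<in> carrier G" for g
    using r[OF that] s[of "inv g"] that M by auto
  have bij: "bij_betw (\<lambda>g. h \<otimes> g) (carrier G) (carrier G)"
  proof -
    have "(\<lambda>g. h \<otimes> g) ` carrier G = carrier G" using h by (rule surj_const_mult)
    then show ?thesis using h by (simp add: bij_betw_def inj_on_multc inj_on_cmult)
  qed
  have "T * \<sigma> h = mat_sum m n (\<lambda>g. \<rho> g * M * \<sigma> (inv g) * \<sigma> h) (carrier G)"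
    unfolding T_def using F by (rule mat_sum_mult[OF s[OF h]])
  also have "\<dots> = mat_sum m n (\<lambda>g. \<rho> (h \<otimes> g) * M * \<sigma> (inv (h \<otimes> g)) * \<sigma> h) (carrier G)"
    by (rule mat_sum_reindex[OF bij])
  also have "\<dots> = mat_sum m n (\<lambda>g. \<rho> h * (\<rho> g * M * \<sigma> (inv g))) (carrier G)"
  proof (rule mat_sum_cong)
    fix g assume g: "g \<in> carrier G"
    have rg: "\<rho> g \<in> carrier_mat m m" and rh: "\<rho> h \<in> carrier_mat m m" using r g h by auto
    have sg: "\<sigma> (inv g) \<in> carrier_mat n n" and sh: "\<sigma> h \<in> carrier_mat n n"
      and shg: "\<sigma> (inv (h \<otimes> g)) \<in> carrier_mat n n" using s g h by auto
    have "\<sigma> (inv (h \<otimes> g)) * \<sigma> h = \<sigma> (inv (h \<otimes> g) \<otimes> h)"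
      using reps_mult[OF \<sigma>, of "inv (h \<otimes> g)" h] g h by simp
    also have "inv (h \<otimes> g) \<otimes> h = inv g" using g h by (simp add: inv_mult_group m_assoc)
    finally have 1: "\<sigma> (inv (h \<otimes> g)) * \<sigma> h = \<sigma> (inv g)" .
    have rhg: "\<rho> (h \<otimes> g) * M \<in> carrier_mat m n" using r[of "h \<otimes> g"] g h M by auto
    have "\<rho> (h \<otimes> g) * M * \<sigma> (inv (h \<otimes> g)) * \<sigma> h = \<rho> (h \<otimes> g) * M * \<sigma> (inv g)"
      using assoc_mult_mat[OF rhg shg sh] 1 by simp
    also have "\<dots> = \<rho> h * (\<rho> g * M) * \<sigma> (inv g)"
      using reps_mult[OF \<rho> h g] assoc_mult_mat[OF rh rg M] by simp
    also have "\<dots> = \<rho> h * (\<rho> g * M * \<sigma> (inv g))"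
      using assoc_mult_mat[OF rh mult_carrier_mat[OF rg M] sg] .
    finally show "\<rho> (h \<otimes> g) * M * \<sigma> (inv (h \<otimes> g)) * \<sigma> h = \<rho> h * (\<rho> g * M * \<sigma> (inv g))" .
  qed
  also have "\<dots> = \<rho> h * T"
    unfolding T_def using F by (rule mult_mat_sum[OF r[OF h], symmetric])
  finally show ?thesis by simp
qed

text \<open>The average of a matrix unit intertwines \<open>\<sigma>\<close> with
  \<open>\<rho>\<close>, so it is zero by \<open>Schur_iso\<close>. Its entries are sums of products
  of matrix coefficients, and adding up the diagonal coefficients gives the traces.\<close>

lemma character_orthogonal:
  assumes \<rho>: "(m, \<rho>) \<in> irreps G" and \<sigma>: "(n, \<sigma>) \<in> irreps G"
    and ne: "((n, \<sigma>), (m, \<rho>)) \<notin> rep_equiv G"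
  shows "(\<Sum>g\<in>carrier G. mat_trace (\<rho> g) * mat_trace (\<sigma> (inv g))) = 0"
proof -
  note r = reps_carrier[OF irreps_reps[OF \<rho>]] and s = reps_carrier[OF irreps_reps[OF \<sigma>]]
  have 0: "(\<Sum>g\<in>carrier G. \<rho> g $$ (i, i) * \<sigma> (inv g) $$ (k, k)) = 0" if ik: "i < m" "k < n" for i k
  proof -
    define T where "T = mat_sum m n (\<lambda>g. \<rho> g * mat_unit m n i k * \<sigma> (inv g)) (carrier G)"
    have T: "T \<in> carrier_mat m n" by (simp add: T_def)
    have comm: "\<rho> g * T = T * \<sigma> g" if "g \<in> carrier G" for g
      unfolding T_def by (rule average_intertwines[OF irreps_reps[OF \<rho>] irreps_reps[OF \<sigma>] _ that])
        simp
    have "T = 0\<^sub>m m n"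
    proof (rule ccontr)
      assume nz: "T \<noteq> 0\<^sub>m m n"
      from Schur_iso[OF \<rho> \<sigma> T comm nz] have "m = n" "T \<in> carrier (GL n)" by auto
      then have "((n, \<sigma>), (m, \<rho>)) \<in> rep_equiv G"
        using irreps_reps[OF \<rho>] irreps_reps[OF \<sigma>] comm[symmetric] by (auto simp: rep_equiv_def)
      with ne show False ..
    qed
    then have "0 = T $$ (i, k)" using ik by simp
    also have "\<dots> = (\<Sum>g\<in>carrier G. \<rho> g $$ (i, i) * \<sigma> (inv g) $$ (k, k))"
      unfolding T_def using ik mult_mat_unit_mult_index[OF r s, of _ "inv _" i i k k]
      by (auto intro!: sum.cong)
    finally show ?thesis by simp
  qed
  have "(\<Sum>g\<in>carrier G. mat_trace (\<rho> g) * mat_trace (\<sigma> (inv g)))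
    = (\<Sum>g\<in>carrier G. \<Sum>i<m. \<Sum>k<n. \<rho> g $$ (i, i) * \<sigma> (inv g) $$ (k, k))"
    using mat_trace_carrier[OF r] mat_trace_carrier[OF s]
      by (intro sum.cong refl) (simp add: sum_product)
  also have "\<dots> = (\<Sum>i<m. \<Sum>g\<in>carrier G. \<Sum>k<n. \<rho> g $$ (i, i) * \<sigma> (inv g) $$ (k, k))"
    by (rule sum.swap)
  also have "\<dots> = (\<Sum>i<m. \<Sum>k<n. \<Sum>g\<in>carrier G. \<rho> g $$ (i, i) * \<sigma> (inv g) $$ (k, k))"
    by (intro sum.cong refl sum.swap)
  also have "\<dots> = 0" using 0 by simp
  finally show ?thesis .
qed

text \<open>The average of a matrix unit is scalar by \<open>Schur_scalar\<close>, and its trace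
  determines the scalar. The factor \<open>of_nat n\<close> is kept in \<open>delta\<close> and
  cancelled only at the end.\<close>

lemma character_norm:
  assumes \<rho>: "(n, \<rho>) \<in> irreps G"
  shows "(\<Sum>g\<in>carrier G. mat_trace (\<rho> g) * mat_trace (\<rho> (inv g))) = of_nat (card (carrier G))"
proof -
  note r = reps_carrier[OF irreps_reps[OF \<rho>]]
  let ?N = "of_nat (card (carrier G)) :: complex"
  have n: "n > 0" using irreps_pos[OF \<rho>] .
  have delta: "of_nat n * (\<Sum>g\<in>carrier G. \<rho> g $$ (i, i) * \<rho> (inv g) $$ (k, k)) = (if i =
    k then ?N else 0)"
    if ik: "i < n" "k < n" for i k
  proof -
    define T where "T = mat_sum n n (\<lambda>g. \<rho> g * mat_unit n n i k * \<rho> (inv g)) (carrier G)"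
    have T: "T \<in> carrier_mat n n" by (simp add: T_def)
    have comm: "\<rho> g * T = T * \<rho> g" if "g \<in> carrier G" for g
      unfolding T_def by (rule average_intertwines[OF irreps_reps[OF \<rho>] irreps_reps[OF \<rho>] _ that])
        simp
    from Schur_scalar[OF \<rho> T comm] obtain c where c: "T = c \<cdot>\<^sub>m 1\<^sub>m n" by auto
    \<comment> \<open>By cyclicity of the trace the two values of \<open>\<rho>\<close> cancel and
      leave the trace of the matrix unit.\<close>
    have tr: "mat_trace (\<rho> g * mat_unit n n i k * \<rho> (inv g)) = (if i = k then 1 else 0)"
      if g: "g \<in> carrier G" for g
    proof -
      have rg: "\<rho> g \<in> carrier_mat n n" "\<rho> (inv g) \<in> carrier_mat n n" using r g by auto
      have "mat_trace (\<rho> g * mat_unit n n i k * \<rho> (inv g)) =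
        mat_trace (\<rho> (inv g) * (\<rho> g * mat_unit n n i k))"
        using rg by (intro mat_trace_mult_commute[of _ n n]) auto
      also have "\<rho> (inv g) * (\<rho> g * mat_unit n n i k) = \<rho> (inv g) * \<rho> g * mat_unit n n i k"
        using rg assoc_mult_mat[of "\<rho> (inv g)" n n "\<rho> g" n "mat_unit n n i k" n] by simp
      also have "\<rho> (inv g) * \<rho> g = 1\<^sub>m n"
        using reps_mult[OF irreps_reps[OF \<rho>], of "inv g" g] g reps_one[OF irreps_reps[OF \<rho>]] by simp
      also have "1\<^sub>m n * mat_unit n n i k = mat_unit n n i k"
        by (rule left_mult_one_mat[OF mat_unit_carrier])
      also have "mat_trace \<dots> = (\<Sum>a<n. if a = i then (if i = k then 1 else 0) else 0)"
        unfolding mat_trace_def mat_unit_def by (auto intro!: sum.cong)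
      also have "\<dots> = (if i = k then 1 else 0)" using ik by (simp add: sum.delta)
      finally show ?thesis .
    qed
    have "mat_trace T = (\<Sum>g\<in>carrier G. mat_trace (\<rho> g * mat_unit n n i k * \<rho> (inv g)))"
    proof -
      have "mat_trace T = (\<Sum>a<n. \<Sum>g\<in>carrier G. (\<rho> g * mat_unit n n i k * \<rho> (inv g)) $$ (a, a))"
        by (simp add: mat_trace_def T_def)
      also have "\<dots> = (\<Sum>g\<in>carrier G. \<Sum>a<n. (\<rho> g * mat_unit n n i k * \<rho> (inv g)) $$ (a, a))"
        by (rule sum.swap)
      also have "\<dots> = (\<Sum>g\<in>carrier G. mat_trace (\<rho> g * mat_unit n n i k * \<rho> (inv g)))"
        using r by (intro sum.cong refl) (auto simp: mat_trace_def)
      finally show ?thesis .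
    qed
    also have "\<dots> = (if i = k then ?N else 0)" using tr by simp
    finally have 1: "of_nat n * c = (if i = k then ?N else 0)" by (simp add: c mat_trace_def)
    have "(\<Sum>g\<in>carrier G. \<rho> g $$ (i, i) * \<rho> (inv g) $$ (k, k)) = T $$ (i, k)"
      unfolding T_def using ik mult_mat_unit_mult_index[OF r r, of _ "inv _" i i k k]
      by (auto intro!: sum.cong)
    also have "\<dots> = (if i = k then c else 0)" using c ik by simp
    finally show ?thesis using 1 by auto
  qed
  have "of_nat n * (\<Sum>g\<in>carrier G. mat_trace (\<rho> g) * mat_trace (\<rho> (inv g)))
    = of_nat n * (\<Sum>g\<in>carrier G. \<Sum>i<n. \<Sum>k<n. \<rho> g $$ (i, i) * \<rho> (inv g) $$ (k, k))"
    using mat_trace_carrier[OF r]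
    by (intro arg_cong[of _ _ "\<lambda>x. of_nat n * x"] sum.cong refl) (simp add: sum_product)
  also have "\<dots> = of_nat n * (\<Sum>i<n. \<Sum>g\<in>carrier G. \<Sum>k<n. \<rho> g $$ (i, i) * \<rho> (inv g) $$ (k, k))"
    by (subst sum.swap) simp
  also have "\<dots> = of_nat n * (\<Sum>i<n. \<Sum>k<n. \<Sum>g\<in>carrier G. \<rho> g $$ (i, i) * \<rho> (inv g) $$ (k, k))"
    by (intro arg_cong[of _ _ "\<lambda>x. of_nat n * x"] sum.cong refl sum.swap)
  also have "\<dots> = (\<Sum>i<n. \<Sum>k<n. if i = k then ?N else 0)"
    unfolding sum_distrib_left by (intro sum.cong refl) (simp add: delta[unfolded sum_distrib_left])
  also have "\<dots> = of_nat n * ?N" by (simp add: sum.delta)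
  finally show ?thesis using n by simp
qed

end

section \<open>Completeness of the irreducible characters\<close>

text \<open>The standard Hermitian form, conjugate linear in the second argument; its definiteness
  is what makes \<open>normal_kernel_range\<close> work.\<close>

definition herm_prod :: "complex vec \<Rightarrow> complex vec \<Rightarrow> complex" where
  "herm_prod u v = (\<Sum>i<dim_vec u. u $ i * cnj (v $ i))"

lemma herm_prod_self_eq_0:
  assumes "u \<in> carrier_vec n" "herm_prod u u = 0"
  shows "u = 0\<^sub>v n"
proof (rule eq_vecI)
  have "herm_prod u u = of_real (\<Sum>i<n. (cmod (u $ i))\<^sup>2)"
    using assms(1) by (simp add: herm_prod_def complex_norm_square[symmetric] del: of_real_power)
  with assms(2) have "(\<Sum>i<n. (cmod (u $ i))\<^sup>2) = 0" by (metis of_real_eq_0_iff)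
  then have "\<forall>i<n. (cmod (u $ i))\<^sup>2 = 0" by (subst (asm) sum_nonneg_eq_0_iff) auto
  then show "u $ i = 0\<^sub>v n $ i" if "i < dim_vec (0\<^sub>v n)" for i using that by simp
qed (use assms in simp)

definition conj_transpose :: "complex mat \<Rightarrow> complex mat" where
  "conj_transpose A = mat (dim_col A) (dim_row A) (\<lambda>(i, j). cnj (A $$ (j, i)))"

lemma conj_transpose_carrier: "A \<in> carrier_mat m n \<Longrightarrow> conj_transpose A \<in> carrier_mat n m"
  by (simp add: conj_transpose_def)

lemma conj_transpose_conj_transpose: "conj_transpose (conj_transpose A) = A"
  by (rule eq_matI) (simp_all add: conj_transpose_def)

lemma herm_prod_adjoint:
  assumes A: "A \<in> carrier_mat n n" and u: "u \<in> carrier_vec n" and v: "v \<in> carrier_vec n"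
  shows "herm_prod (A *\<^sub>v u) v = herm_prod u (conj_transpose A *\<^sub>v v)"
proof -
  have "herm_prod (A *\<^sub>v u) v = (\<Sum>i<n. \<Sum>j<n. A $$ (i, j) * u $ j * cnj (v $ i))"
    using A u by (simp add: herm_prod_def scalar_prod_def sum_distrib_right lessThan_atLeast0)
  also have "\<dots> = (\<Sum>j<n. \<Sum>i<n. A $$ (i, j) * u $ j * cnj (v $ i))" by (rule sum.swap)
  also have "\<dots> = herm_prod u (conj_transpose A *\<^sub>v v)"
    using A u v by (auto simp: herm_prod_def scalar_prod_def sum_distrib_left lessThan_atLeast0
        conj_transpose_def algebra_simps intro!: sum.cong)
  finally show ?thesis .
qed

text \<open>Put \<open>w = A u\<close> and write \<open>A'\<close> for the adjoint. Normality gives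
  \<open>A A' w = A' A w = 0\<close>, so the norm of \<open>A' w\<close> is 0. Then the norm of
  \<open>w\<close>, which is the product of \<open>u\<close> with \<open>A' w\<close>, is 0 as
  well.\<close>

lemma normal_kernel_range:
  assumes A: "A \<in> carrier_mat n n" and normal: "A * conj_transpose A = conj_transpose A * A"
    and u: "u \<in> carrier_vec n" and 0: "A *\<^sub>v (A *\<^sub>v u) = 0\<^sub>v n"
  shows "A *\<^sub>v u = 0\<^sub>v n"
proof -
  let ?A' = "conj_transpose A"
  have A': "?A' \<in> carrier_mat n n" using conj_transpose_carrier[OF A] .
  define w where "w = A *\<^sub>v u"
  have w: "w \<in> carrier_vec n" using A u by (simp add: w_def)
  have w': "?A' *\<^sub>v w \<in> carrier_vec n" using A' w by simp
  have z: "?A' *\<^sub>v 0\<^sub>v n = 0\<^sub>v n" using A' by (intro eq_vecI) (auto simp: scalar_prod_def)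
  have "A *\<^sub>v (?A' *\<^sub>v w) = ?A' *\<^sub>v (A *\<^sub>v w)"
    using assoc_mult_mat_vec[OF A A' w] assoc_mult_mat_vec[OF A' A w] normal by simp
  also have "\<dots> = 0\<^sub>v n" using 0 z by (simp add: w_def)
  finally have 1: "A *\<^sub>v (?A' *\<^sub>v w) = 0\<^sub>v n" .
  have "herm_prod (?A' *\<^sub>v w) (?A' *\<^sub>v w) = herm_prod w (A *\<^sub>v (?A' *\<^sub>v w))"
    using herm_prod_adjoint[OF A' w w'] by (simp add: conj_transpose_conj_transpose)
  also have "\<dots> = 0" using 1 w by (simp add: herm_prod_def)
  finally have "?A' *\<^sub>v w = 0\<^sub>v n" using herm_prod_self_eq_0[OF w'] by simp
  then have "herm_prod w w = 0"
    using herm_prod_adjoint[OF A u w] u by (simp add: herm_prod_def w_def)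
  then show ?thesis using herm_prod_self_eq_0[OF w] by (simp add: w_def)
qed

lemma inj_mat_left_cancel:
  assumes B: "B \<in> carrier_mat n d" and inj: "inj_mat B" and C: "C \<in> carrier_mat d e"
    and D: "D \<in> carrier_mat d e"
    and eq: "B * C = B * D"
  shows "C = D"
proof (rule mat_eqI_mult_vec[OF C D])
  fix v :: "complex vec" assume v: "v \<in> carrier_vec e"
  have c: "C *\<^sub>v v \<in> carrier_vec d" "D *\<^sub>v v \<in> carrier_vec d" using C D v by auto
  have "B *\<^sub>v (C *\<^sub>v v) = B *\<^sub>v (D *\<^sub>v v)"
    using assoc_mult_mat_vec[OF B C v] assoc_mult_mat_vec[OF B D v] eq by simp
  then have "B *\<^sub>v (C *\<^sub>v v - D *\<^sub>v v) = 0\<^sub>v n"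
    using mult_minus_distrib_mat_vec[OF B c] mult_mat_vec_carrier[OF B c(2)] by simp
  then have 0: "C *\<^sub>v v - D *\<^sub>v v = 0\<^sub>v d" using inj_matD[OF inj B] c by simp
  show "C *\<^sub>v v = D *\<^sub>v v"
  proof (rule eq_vecI)
    fix i assume "i < dim_vec (D *\<^sub>v v)"
    then have i: "i < d" using D by simp
    have "(C *\<^sub>v v - D *\<^sub>v v) $ i = 0" using 0 i by simp
    moreover have "(C *\<^sub>v v - D *\<^sub>v v) $ i = (C *\<^sub>v v) $ i - (D *\<^sub>v v) $ i"
      by (rule index_minus_vec(1)) (use i D in simp)
    ultimately show "(C *\<^sub>v v) $ i = (D *\<^sub>v v) $ i" by simp
  qed (use C D in simp)
qed

lemma (in group) mult_inv_cancel [simp]: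
  assumes "x \<in> carrier G" "y \<in> carrier G"
  shows "x \<otimes> (inv x \<otimes> y) = y" "inv x \<otimes> (x \<otimes> y) = y"
  using assms by (simp_all add: m_assoc[symmetric])

section \<open>Class functions acting on representations\<close>

context finite_group
begin

definition class_function :: "('a \<Rightarrow> complex) \<Rightarrow> bool" where
  "class_function f \<longleftrightarrow> (\<forall>g\<in>carrier G. \<forall>h\<in>carrier G. f (h \<otimes> g \<otimes> inv h) = f g)"

lemma class_functionD:
  "class_function f \<Longrightarrow> g \<in> carrier G \<Longrightarrow> h \<in> carrier G \<Longrightarrow> f (h \<otimes> g \<otimes> inv h) = f g"
  by (simp add: class_function_def)

lemma class_function_commute:
  assumes "class_function f" "g \<in> carrier G" "h \<in> carrier G"
  shows "f (g \<otimes> h) = f (h \<otimes> g)"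
  using class_functionD[OF assms(1), of "h \<otimes> g" g] assms by (simp add: m_assoc)

text \<open>The Fourier transform of \<open>f\<close> at the representation \<open>\<rho>\<close> of
  degree \<open>n\<close>, that is, the operator by which \<open>f\<close> acts.\<close>

definition rep_sum :: "nat \<Rightarrow> ('a \<Rightarrow> complex) \<Rightarrow> ('a \<Rightarrow> complex mat) \<Rightarrow> complex mat" where
  "rep_sum n f \<rho> = mat_sum n n (\<lambda>g. f g \<cdot>\<^sub>m \<rho> g) (carrier G)"

lemma rep_sum_carrier [simp]: "rep_sum n f \<rho> \<in> carrier_mat n n"
  by (simp add: rep_sum_def)

text \<open>Conjugation by \<open>h\<close> permutes the summands and leaves the coefficients
  unchanged.\<close>

lemma class_function_rep_sum_commute:
  assumes f: "class_function f" and \<rho>: "(n, \<rho>) \<in> reps G" and h: "h \<in> carrier G"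
  shows "\<rho> h * rep_sum n f \<rho> = rep_sum n f \<rho> * \<rho> h"
proof -
  note r = reps_carrier[OF \<rho>]
  have F: "f g \<cdot>\<^sub>m \<rho> g \<in> carrier_mat n n" if "g \<in> carrier G" for g using r[OF that] by simp
  have bij: "bij_betw (\<lambda>g. h \<otimes> g \<otimes> inv h) (carrier G) (carrier G)"
    by (rule bij_betw_byWitness[where f' = "\<lambda>g. inv h \<otimes> g \<otimes> h"]) (use h in \<open>auto simp: m_assoc\<close>)
  have "rep_sum n f \<rho> * \<rho> h = mat_sum n n (\<lambda>g. f g \<cdot>\<^sub>m \<rho> g * \<rho> h) (carrier G)"
    unfolding rep_sum_def using F by (rule mat_sum_mult[OF r[OF h]])
  also have "\<dots> = mat_sum n n (\<lambda>g. f (h \<otimes> g \<otimes> inv h) \<cdot>\<^sub>m \<rho> (h \<otimes> g \<otimes> inv h) * \<rho> h) (carrier G)"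
    by (rule mat_sum_reindex[OF bij])
  also have "\<dots> = mat_sum n n (\<lambda>g. \<rho> h * (f g \<cdot>\<^sub>m \<rho> g)) (carrier G)"
  proof (rule mat_sum_cong)
    fix g assume g: "g \<in> carrier G"
    have "\<rho> (h \<otimes> g \<otimes> inv h) * \<rho> h = \<rho> (h \<otimes> g \<otimes> inv h \<otimes> h)"
      using reps_mult[OF \<rho>, of "h \<otimes> g \<otimes> inv h" h] g h by simp
    also have "h \<otimes> g \<otimes> inv h \<otimes> h = h \<otimes> g" using g h by (simp add: m_assoc)
    finally have 1: "\<rho> (h \<otimes> g \<otimes> inv h) * \<rho> h = \<rho> h * \<rho> g" using reps_mult[OF \<rho> h g] by simp
    show "f (h \<otimes> g \<otimes> inv h) \<cdot>\<^sub>m \<rho> (h \<otimes> g \<otimes> inv h) * \<rho> h = \<rho> h * (f g \<cdot>\<^sub>m \<rho> g)"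
      using class_functionD[OF f g h] 1 mult_smult_distrib[OF r[OF h] r[OF g]]
        mult_smult_assoc_mat[OF r r[OF h], of "h \<otimes> g \<otimes> inv h"] g h by simp
  qed
  also have "\<dots> = \<rho> h * rep_sum n f \<rho>"
    unfolding rep_sum_def using F by (rule mult_mat_sum[OF r[OF h], symmetric])
  finally show ?thesis by simp
qed

text \<open>The operator is a scalar by Schur's lemma, and its trace, which is \<open>n\<close>
  times the scalar, is the sum assumed to vanish.\<close>

lemma rep_sum_irrep_eq_0:
  assumes f: "class_function f" and \<rho>: "(n, \<rho>) \<in> irreps G"
    and 0: "(\<Sum>g\<in>carrier G. f g * mat_trace (\<rho> g)) = 0"
  shows "rep_sum n f \<rho> = 0\<^sub>m n n"
proof -
  note r = reps_carrier[OF irreps_reps[OF \<rho>]]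
  from Schur_scalar[OF \<rho> rep_sum_carrier class_function_rep_sum_commute[OF f irreps_reps[OF \<rho>]]]
  obtain c where c: "rep_sum n f \<rho> = c \<cdot>\<^sub>m 1\<^sub>m n" by auto
  have "mat_trace (rep_sum n f \<rho>) = (\<Sum>i<n. \<Sum>g\<in>carrier G. (f g \<cdot>\<^sub>m \<rho> g) $$ (i, i))"
    by (simp add: mat_trace_def rep_sum_def)
  also have "\<dots> = (\<Sum>g\<in>carrier G. \<Sum>i<n. (f g \<cdot>\<^sub>m \<rho> g) $$ (i, i))" by (rule sum.swap)
  also have "\<dots> = (\<Sum>g\<in>carrier G. f g * mat_trace (\<rho> g))"
  proof (rule sum.cong)
    fix g assume g: "g \<in> carrier G"
    show "(\<Sum>i<n. (f g \<cdot>\<^sub>m \<rho> g) $$ (i, i)) = f g * mat_trace (\<rho> g)"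
      using carrier_matD[OF r[OF g]] unfolding mat_trace_carrier[OF r[OF g]] sum_distrib_left
      by (intro sum.cong refl) simp
  qed simp
  finally have "of_nat n * c = 0" using 0 by (simp add: c mat_trace_def)
  then have "c = 0" using irreps_pos[OF \<rho>] by simp
  then show ?thesis using c by (intro eq_matI) auto
qed

text \<open>
  If the operator \<open>A\<close> of \<open>f\<close> on the regular representation were nonzero, a minimal nonzero invariant
  subspace of its range would carry an irreducible representation on which \<open>A\<close> vanishes; but as
  \<open>A\<close> is normal, its range meets its kernel only in \<open>0\<close>.
\<close>

lemma class_function_eq_0:
  assumes f: "class_function f"
    and 0: "\<And>n \<rho>. (n, \<rho>) \<in> irreps G \<Longrightarrow> (\<Sum>g\<in>carrier G. f g * mat_trace (\<rho> g)) = 0"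
    and x: "x \<in> carrier G"
  shows "f x = 0"
proof (rule ccontr)
  assume fx: "f x \<noteq> 0"
  define N where "N = card (carrier G)"
  obtain e where e: "bij_betw e {0..<N} (carrier G)"
    using ex_bij_betw_nat_finite[OF finite_carrier] unfolding N_def by blast
  have eG: "e i \<in> carrier G" if "i < N" for i using e that by (auto simp: bij_betw_def)
  have einj: "e i = e j \<longleftrightarrow> i = j" if "i < N" "j < N" for i j
    using e that by (auto simp: bij_betw_def inj_on_def)
  have esum: "(\<Sum>k = 0..<N. F (e k)) = (\<Sum>y\<in>carrier G. F y)" for F :: "'a \<Rightarrow> complex"
    by (rule sum.reindex_bij_betw[OF e])
  \<comment> \<open>The left regular representation, in the basis enumerated by
    \<open>e\<close>.\<close>
  define R where "R = (\<lambda>g. mat N N (\<lambda>(i, j). if e i = g \<otimes> e j then 1 else 0 :: complex))"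
  have Rc [simp]: "R g \<in> carrier_mat N N" for g by (simp add: R_def)
  have R: "(N, R) \<in> reps G"
  proof (rule repsI)
    fix g h assume g: "g \<in> carrier G" and h: "h \<in> carrier G"
    show "R (g \<otimes> h) = R g * R h"
    proof (rule eq_matI)
      fix i j assume "i < dim_row (R g * R h)" "j < dim_col (R g * R h)"
      then have ij: "i < N" "j < N" by (auto simp: R_def)
      have "(R g * R h) $$ (i, j) = (\<Sum>k = 0..<N. (if e i = g \<otimes> e k then 1 else 0) * (if e k =
        h \<otimes> e j then 1 else 0))"
        using ij by (simp add: R_def scalar_prod_def)
      also have "\<dots> = (\<Sum>y\<in>carrier G. (if e i = g \<otimes> y then 1 else 0) * (if y =
        h \<otimes> e j then 1 else 0))"
        by (rule esum[of "\<lambda>y. (if e i = g \<otimes> y then 1 else 0) * (if y = h \<otimes> e j then 1 else 0)"])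
      also have "\<dots> = (\<Sum>y\<in>carrier G. if y = h \<otimes> e j then (if e i = g \<otimes> y then 1 else 0) else 0)"
        by (rule sum.cong) auto
      also have "\<dots> = (if e i = g \<otimes> (h \<otimes> e j) then 1 else 0)"
        using h eG[OF ij(2)] by (subst sum.delta) auto
      also have "\<dots> = R (g \<otimes> h) $$ (i, j)" using ij g h eG by (simp add: R_def m_assoc)
      finally show "R (g \<otimes> h) $$ (i, j) = (R g * R h) $$ (i, j)" by simp
    qed (simp_all add: R_def)
  next
    show "R \<one> = 1\<^sub>m N" by (rule eq_matI) (auto simp: R_def eG einj)
  qed simp
  define A where "A = rep_sum N f R"
  have A: "A \<in> carrier_mat N N" by (simp add: A_def)
  have Aij: "A $$ (i, j) = f (e i \<otimes> inv (e j))" if ij: "i < N" "j < N" for i j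
  proof -
    \<comment> \<open>Exactly one group element carries \<open>e j\<close> to \<open>e i\<close>, so
      a single summand survives.\<close>
    have "A $$ (i, j) = (\<Sum>g\<in>carrier G. if g = e i \<otimes> inv (e j) then f g else 0)"
      using ij eG unfolding A_def rep_sum_def
      by (auto simp: R_def inv_solve_right intro!: sum.cong)
    also have "\<dots> = f (e i \<otimes> inv (e j))" using eG ij by (subst sum.delta) auto
    finally show ?thesis .
  qed
  have normal: "A * conj_transpose A = conj_transpose A * A"
  proof (rule eq_matI)
    fix i j assume "i < dim_row (conj_transpose A * A)" "j < dim_col (conj_transpose A * A)"
    then have ij: "i < N" "j < N" using A by (auto simp: conj_transpose_def)
    note eij = eG[OF ij(1)] eG[OF ij(2)]
    \<comment> \<open>Under this substitution the two factors of a summand trade places; for the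
      factor containing \<open>inv (e i)\<close> this uses that \<open>f\<close> is invariant under
      conjugation.\<close>
    have bij: "bij_betw (\<lambda>y. e i \<otimes> inv y \<otimes> e j) (carrier G) (carrier G)"
      by (rule bij_betw_byWitness[where f' = "\<lambda>y. e j \<otimes> inv y \<otimes> e i"])
        (use eij in \<open>auto simp: inv_mult_group m_assoc\<close>)
    have "(A * conj_transpose A) $$ (i, j)
      = (\<Sum>k = 0..<N. f (e i \<otimes> inv (e k)) * cnj (f (e j \<otimes> inv (e k))))"
      using A ij by (simp add: scalar_prod_def conj_transpose_def Aij)
    also have "\<dots> = (\<Sum>y\<in>carrier G. f (e i \<otimes> inv y) * cnj (f (e j \<otimes> inv y)))"
      by (rule esum[of "\<lambda>y. f (e i \<otimes> inv y) * cnj (f (e j \<otimes> inv y))"])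
    also have "\<dots> = (\<Sum>y\<in>carrier G.
      cnj (f ((e i \<otimes> inv y \<otimes> e j) \<otimes> inv (e i))) * f ((e i \<otimes> inv y \<otimes> e j) \<otimes> inv (e j)))"
    proof (rule sum.cong)
      fix y assume y: "y \<in> carrier G"
      have "f (e i \<otimes> inv y \<otimes> e j \<otimes> inv (e i)) = f (inv y \<otimes> e j)"
        using class_functionD[OF f, of "inv y \<otimes> e j" "e i"] y eij by (simp add: m_assoc)
      also have "\<dots> = f (e j \<otimes> inv y)" using class_function_commute[OF f] y eij by simp
      finally show "f (e i \<otimes> inv y) * cnj (f (e j \<otimes> inv y)) =
        cnj (f ((e i \<otimes> inv y \<otimes> e j) \<otimes> inv (e i))) * f ((e i \<otimes> inv y \<otimes> e j) \<otimes> inv (e j))"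
        using y eij by (simp add: m_assoc)
    qed simp
    also have "\<dots> = (\<Sum>y\<in>carrier G. cnj (f (y \<otimes> inv (e i))) * f (y \<otimes> inv (e j)))"
      by (rule sum.reindex_bij_betw[OF bij, of "\<lambda>y. cnj (f (y \<otimes> inv (e i))) * f (y \<otimes> inv (e j))"])
    also have "\<dots> = (\<Sum>k = 0..<N. cnj (f (e k \<otimes> inv (e i))) * f (e k \<otimes> inv (e j)))"
      by (rule esum[of "\<lambda>y. cnj (f (y \<otimes> inv (e i))) * f (y \<otimes> inv (e j))", symmetric])
    also have "\<dots> = (conj_transpose A * A) $$ (i, j)"
      using A ij by (simp add: scalar_prod_def conj_transpose_def Aij)
    finally show "(A * conj_transpose A) $$ (i, j) = (conj_transpose A * A) $$ (i, j)" .
  qed (use A in \<open>auto simp: conj_transpose_def\<close>)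
  have comm: "R g * A = A * R g" if "g \<in> carrier G" for g
    unfolding A_def by (rule class_function_rep_sum_commute[OF f R that])
  \<comment> \<open>The dimensions of the nonzero invariant subspaces of the range of
    \<open>A\<close>, each subspace being given by a matrix whose columns form a basis.\<close>
  define P where "P = (\<lambda>d. \<exists>B. B \<in> carrier_mat N d \<and> inj_mat B \<and> d > 0 \<and>
    (\<forall>g\<in>carrier G. \<forall>v\<in>carrier_vec d. \<exists>w\<in>carrier_vec d. R g *\<^sub>v (B *\<^sub>v v) = B *\<^sub>v w) \<and>
    (\<forall>v\<in>carrier_vec d. \<exists>u\<in>carrier_vec N. B *\<^sub>v v = A *\<^sub>v u))"
  have "\<exists>d. P d"
  proof -
    define U where "U = (\<lambda>v. A *\<^sub>v v) ` carrier_vec N"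
    have U: "lin_subspace N U" unfolding U_def by (rule lin_subspace_range[OF A])
    obtain B d where
      B: "B \<in> carrier_mat N d" "inj_mat B" "(\<lambda>v. B *\<^sub>v v) ` carrier_vec d = U"
      and "U \<noteq> carrier_vec N \<longrightarrow> d < N" and d: "U \<noteq> {0\<^sub>v N} \<longrightarrow> d > 0"
      by (rule lin_subspace_basis[OF U]) (rule that; assumption)
    have "U \<noteq> {0\<^sub>v N}"
    proof
      assume "U = {0\<^sub>v N}"
      then have "A *\<^sub>v v = 0\<^sub>v N" if "v \<in> carrier_vec N" for v using that unfolding U_def by blast
      then have "A = 0\<^sub>m N N" by (intro mat_eqI_mult_vec[OF A]) auto
      have eimg: "\<exists>i<N. e i = y" if y: "y \<in> carrier G" for y
      proof -
        from y have "y \<in> e ` {0..<N}" using bij_betw_imp_surj_on[OF e] by simp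
        then show ?thesis by auto
      qed
      \<comment> \<open>The entry of \<open>A\<close> in the row of \<open>x\<close> and the column
        of the identity is \<open>f x\<close>.\<close>
      obtain i j where ij: "i < N" "j < N" "e i = x" "e j = \<one>" using eimg[OF x] eimg[OF one_closed]
        by blast
      have "A $$ (i, j) = f (x \<otimes> inv \<one>)" using Aij[OF ij(1,2)] ij(3,4) by simp
      with \<open>A = 0\<^sub>m N N\<close> ij fx x show False by simp
    qed
    moreover have "\<exists>w\<in>carrier_vec d. R g *\<^sub>v (B *\<^sub>v v) = B *\<^sub>v w" if g: "g \<in> carrier G"
      and v: "v \<in> carrier_vec d" for g v
    proof -
      have "B *\<^sub>v v \<in> U" using B(3) v by blast
      then obtain u where u: "u \<in> carrier_vec N" "B *\<^sub>v v = A *\<^sub>v u" unfolding U_def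
        by (rule imageE) blast
      have "R g *\<^sub>v (B *\<^sub>v v) = A *\<^sub>v (R g *\<^sub>v u)"
        using u comm[OF g] assoc_mult_mat_vec[OF Rc[of g] A u(1)] assoc_mult_mat_vec[OF A Rc[of g]
          u(1)] by simp
      moreover have "R g *\<^sub>v u \<in> carrier_vec N" using mult_mat_vec_carrier[OF Rc u(1)] .
      ultimately have "R g *\<^sub>v (B *\<^sub>v v) \<in> U" unfolding U_def by (rule image_eqI)
      then have "R g *\<^sub>v (B *\<^sub>v v) \<in> (\<lambda>v. B *\<^sub>v v) ` carrier_vec d" using B(3) by simp
      then show ?thesis by (rule imageE) blast
    qed
    moreover have "\<exists>u\<in>carrier_vec N. B *\<^sub>v v = A *\<^sub>v u" if v: "v \<in> carrier_vec d" for v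
    proof -
      have "B *\<^sub>v v \<in> U" using B(3) v by blast
      then show ?thesis unfolding U_def by (rule imageE) blast
    qed
    ultimately show ?thesis unfolding P_def using B d by blast
  qed
  define d where "d = (LEAST d. P d)"
  have "P d" unfolding d_def using \<open>\<exists>d. P d\<close> by (rule LeastI_ex)
  have min: "d \<le> d'" if "P d'" for d' unfolding d_def using that by (rule Least_le)
  from \<open>P d\<close> obtain B where B: "B \<in> carrier_mat N d" and inj: "inj_mat B" and d: "d > 0"
    and inv: "\<And>g v. g \<in> carrier G \<Longrightarrow> v \<in> carrier_vec d \<Longrightarrow> \<exists>w\<in>carrier_vec d. R g *\<^sub>v (B *\<^sub>v v) =
      B *\<^sub>v w"
    and im: "\<And>v. v \<in> carrier_vec d \<Longrightarrow> \<exists>u\<in>carrier_vec N. B *\<^sub>v v = A *\<^sub>v u"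
    unfolding P_def by blast
  \<comment> \<open>The columns of \<open>C\<close> are the coordinates of the translated basis
    vectors, so \<open>C\<close> is the matrix of \<open>R g\<close> on the minimal
    subspace.\<close>
  have "\<exists>C\<in>carrier_mat d d. R g * B = B * C" if g: "g \<in> carrier G" for g
  proof -
    have "\<forall>j. \<exists>w. w \<in> carrier_vec d \<and> R g *\<^sub>v (B *\<^sub>v unit_vec d j) = B *\<^sub>v w"
      using inv[OF g] by (metis unit_vec_carrier)
    then obtain w where w: "\<And>j. w j \<in> carrier_vec d" "\<And>j. R g *\<^sub>v (B *\<^sub>v unit_vec d j) = B *\<^sub>v w j"
      by metis
    define C where "C = mat d d (\<lambda>(i, j). w j $ i)"
    have C: "C \<in> carrier_mat d d" by (simp add: C_def)
    have colC: "col C j = w j" if "j < d" for j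
      using that w(1)[of j] by (intro eq_vecI) (auto simp: C_def)
    have "R g * B = B * C"
    proof (rule eq_matI)
      fix i j assume "i < dim_row (B * C)" "j < dim_col (B * C)"
      then have ij: "i < N" "j < d" using B C by auto
      have "(R g * B) $$ (i, j) = (R g * B *\<^sub>v unit_vec d j) $ i"
        using ij B carrier_matD[OF Rc[of g]] by simp
      also have "R g * B *\<^sub>v unit_vec d j = B *\<^sub>v w j"
        using assoc_mult_mat_vec[OF Rc[of g] B, of "unit_vec d j"] w(2)[of j] by simp
      also have "(B *\<^sub>v w j) $ i = (B * C) $$ (i, j)" using ij B C colC[OF ij(2)] by simp
      finally show "(R g * B) $$ (i, j) = (B * C) $$ (i, j)" .
    qed (use B C carrier_matD[OF Rc[of g]] in auto)
    with C show ?thesis by blast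
  qed
  then obtain \<rho> where \<rho>c: "\<And>g. g \<in> carrier G \<Longrightarrow> \<rho> g \<in> carrier_mat d d"
    and \<rho>B: "\<And>g. g \<in> carrier G \<Longrightarrow> R g * B = B * \<rho> g" by metis
  have "(d, \<rho>) \<in> reps G"
  proof (rule repsI)
    fix g h assume g: "g \<in> carrier G" and h: "h \<in> carrier G"
    have "B * \<rho> (g \<otimes> h) = R g * R h * B" using \<rho>B[of "g \<otimes> h"] reps_mult[OF R g h] g h by simp
    also have "\<dots> = R g * (B * \<rho> h)" using assoc_mult_mat[OF Rc Rc B, of g h] \<rho>B[OF h] by simp
    also have "\<dots> = R g * B * \<rho> h" using assoc_mult_mat[OF Rc B \<rho>c[OF h], of g] by simp
    also have "\<dots> = B * (\<rho> g * \<rho> h)" using \<rho>B[OF g] assoc_mult_mat[OF B \<rho>c[OF g] \<rho>c[OF h]] by simp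
    finally show "\<rho> (g \<otimes> h) = \<rho> g * \<rho> h"
      using inj_mat_left_cancel[OF B inj] \<rho>c g h by (meson m_closed mult_carrier_mat)
  next
    have "B * \<rho> \<one> = B * 1\<^sub>m d" using \<rho>B[OF one_closed] reps_one[OF R] B by simp
    then show "\<rho> \<one> = 1\<^sub>m d" using inj_mat_left_cancel[OF B inj] \<rho>c
      by (meson one_carrier_mat one_closed)
  qed (rule \<rho>c)
  \<comment> \<open>\<open>B\<close> carries an invariant subspace of the coordinate space to one
    inside the range of \<open>A\<close>; a proper nonzero one would contradict the minimality of
    \<open>d\<close>.\<close>
  moreover have "U = {0\<^sub>v d} \<or> U = carrier_vec d"
    if U: "lin_subspace d U" and Uinv: "\<And>g u. g \<in> carrier G \<Longrightarrow> u \<in> U \<Longrightarrow> \<rho> g *\<^sub>v u \<in> U" for U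
  proof (rule ccontr)
    assume "\<not> ?thesis"
    then have U': "U \<noteq> {0\<^sub>v d}" "U \<noteq> carrier_vec d" by auto
    obtain C d' where
      C: "C \<in> carrier_mat d d'" "inj_mat C" "(\<lambda>v. C *\<^sub>v v) ` carrier_vec d' = U"
      and d': "U \<noteq> carrier_vec d \<longrightarrow> d' < d" "U \<noteq> {0\<^sub>v d} \<longrightarrow> d' > 0"
      by (rule lin_subspace_basis[OF U]) (rule that; assumption)
    have d'd: "d' < d" "d' > 0" using d' U' by auto
    have BCv: "B * C *\<^sub>v v = B *\<^sub>v (C *\<^sub>v v)" if "v \<in> carrier_vec d'" for v
      by (rule assoc_mult_mat_vec[OF B C(1) that])
    have Cv: "C *\<^sub>v v \<in> carrier_vec d" if "v \<in> carrier_vec d'" for v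
      by (rule mult_mat_vec_carrier[OF C(1) that])
    have "\<exists>w\<in>carrier_vec d'. R g *\<^sub>v (B * C *\<^sub>v v) = B * C *\<^sub>v w" if g: "g \<in> carrier G"
      and v: "v \<in> carrier_vec d'" for g v
    proof -
      have "\<rho> g *\<^sub>v (C *\<^sub>v v) \<in> U" using Uinv[OF g] C(3) v by blast
      then obtain w where w: "w \<in> carrier_vec d'" "\<rho> g *\<^sub>v (C *\<^sub>v v) = C *\<^sub>v w" using C(3)
        by (metis imageE)
      have "R g *\<^sub>v (B *\<^sub>v (C *\<^sub>v v)) = B *\<^sub>v (\<rho> g *\<^sub>v (C *\<^sub>v v))"
        using assoc_mult_mat_vec[OF Rc[of g] B Cv[OF v]] assoc_mult_mat_vec[OF B \<rho>c[OF g] Cv[OF v]]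
          \<rho>B[OF g] by simp
      then show ?thesis using w BCv v by metis
    qed
    moreover have "\<exists>u\<in>carrier_vec N. B * C *\<^sub>v v = A *\<^sub>v u" if "v \<in> carrier_vec d'" for v
      using im[OF Cv[OF that]] BCv[OF that] by simp
    ultimately have "P d'" unfolding P_def
      using inj_mat_mult[OF B C(1) inj C(2)] mult_carrier_mat[OF B C(1)] d'd by blast
    from min[OF this] d'd show False by simp
  qed
  ultimately have irr: "(d, \<rho>) \<in> irreps G"
    using d by (auto simp: irreps_def subspace_iff_lin_subspace)
  \<comment> \<open>On the minimal subspace \<open>A\<close> acts as
    \<open>rep_sum d f \<rho>\<close>, which vanishes by the hypothesis on \<open>f\<close>, as
    \<open>\<rho>\<close> is irreducible.\<close>
  have "A * B = mat_sum N d (\<lambda>g. f g \<cdot>\<^sub>m R g * B) (carrier G)"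
    unfolding A_def rep_sum_def by (rule mat_sum_mult[OF B]) simp
  also have "\<dots> = mat_sum N d (\<lambda>g. B * (f g \<cdot>\<^sub>m \<rho> g)) (carrier G)"
  proof (rule mat_sum_cong)
    fix g assume g: "g \<in> carrier G"
    show "f g \<cdot>\<^sub>m R g * B = B * (f g \<cdot>\<^sub>m \<rho> g)"
      using mult_smult_assoc_mat[OF Rc B, of "f g" g] mult_smult_distrib[OF B \<rho>c[OF g], of "f g"]
        \<rho>B[OF g] by simp
  qed
  also have "\<dots> = B * rep_sum d f \<rho>"
    unfolding rep_sum_def using \<rho>c by (intro mult_mat_sum[OF B, symmetric]) simp
  also have "\<dots> = 0\<^sub>m N d" using rep_sum_irrep_eq_0[OF f irr 0[OF irr]] B by simp
  finally have AB: "A * B = 0\<^sub>m N d" .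
  \<comment> \<open>As \<open>d > 0\<close>, this coordinate vector is nonzero; its image under
    \<open>B\<close> lies both in the range and in the kernel of \<open>A\<close>.\<close>
  define v where "v = (unit_vec d 0 :: complex vec)"
  have v: "v \<in> carrier_vec d" by (simp add: v_def)
  from im[OF v] obtain u where u: "u \<in> carrier_vec N" "B *\<^sub>v v = A *\<^sub>v u" by blast
  have "A *\<^sub>v (A *\<^sub>v u) = A * B *\<^sub>v v" using u assoc_mult_mat_vec[OF A B v] by simp
  also have "\<dots> = 0\<^sub>v N" unfolding AB using v by (intro eq_vecI) (auto simp: scalar_prod_def)
  finally have "A *\<^sub>v u = 0\<^sub>v N" by (rule normal_kernel_range[OF A normal u(1)])
  then have "v = 0\<^sub>v d" using inj_matD[OF inj B v] u by simp
  then have "v $ 0 = 0" using d by simp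
  then show False using d by (simp add: v_def)
qed

end

section \<open>The number of irreducible representations\<close>

context group
begin

lemma equiv_rep_equiv: "equiv (reps G) (rep_equiv G)"
proof (rule equivI)
  show "rep_equiv G \<subseteq> reps G \<times> reps G" by (auto simp: rep_equiv_def)
  show "refl_on (reps G) (rep_equiv G)"
  proof (rule refl_onI)
    fix x assume x: "x \<in> reps G"
    obtain n \<rho> where [simp]: "x = (n, \<rho>)" by (cases x)
    have "1\<^sub>m n \<in> carrier (GL n)" by (auto simp: carrier_GL_iff intro!: bexI[of _ "1\<^sub>m n"])
    moreover have "1\<^sub>m n * \<rho> g = \<rho> g * 1\<^sub>m n" if "g \<in> carrier G" for g
      using reps_carrier[of n \<rho> g] x that by simp
    ultimately show "(x, x) \<in> rep_equiv G" using x by (auto simp: rep_equiv_def)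
  qed
  show "sym (rep_equiv G)"
  proof (rule symI)
    fix x y assume xy: "(x, y) \<in> rep_equiv G"
    obtain n \<rho> m \<sigma> where [simp]: "x = (n, \<rho>)" "y = (m, \<sigma>)" by (cases x, cases y)
    from xy obtain P where [simp]: "m = n" and P: "P \<in> carrier (GL n)"
      "\<And>g. g \<in> carrier G \<Longrightarrow> P * \<rho> g = \<sigma> g * P" and reps: "(n, \<rho>) \<in> reps G" "(n, \<sigma>) \<in> reps G"
      by (auto simp: rep_equiv_def)
    from P(1) obtain Q where PQ: "P \<in> carrier_mat n n" "Q \<in> carrier_mat n n" "Q * P = 1\<^sub>m n" "P * Q
      = 1\<^sub>m n"
      by (auto simp: carrier_GL_iff)
    have "Q * \<sigma> g = \<rho> g * Q" if g: "g \<in> carrier G" for g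
    proof -
      note c = reps_carrier[OF reps(1) g] reps_carrier[OF reps(2) g]
      have "Q * \<sigma> g = Q * (\<sigma> g * (P * Q))" using c PQ by simp
      also have "\<dots> = Q * (\<sigma> g * P * Q)" using assoc_mult_mat[OF c(2) PQ(1,2)] by simp
      also have "\<dots> = Q * (P * \<rho> g * Q)" using P(2)[OF g] by simp
      also have "\<dots> = Q * (P * (\<rho> g * Q))" using assoc_mult_mat[OF PQ(1) c(1) PQ(2)] by simp
      also have "\<dots> = Q * P * (\<rho> g * Q)"
        using assoc_mult_mat[OF PQ(2,1) mult_carrier_mat[OF c(1) PQ(2)]] by simp
      also have "\<dots> = \<rho> g * Q" using PQ(3) left_mult_one_mat[OF mult_carrier_mat[OF c(1) PQ(2)]]
        by simp
      finally show ?thesis .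
    qed
    moreover have "Q \<in> carrier (GL n)" using PQ by (auto simp: carrier_GL_iff)
    ultimately show "(y, x) \<in> rep_equiv G" using reps by (auto simp: rep_equiv_def)
  qed
  show "trans (rep_equiv G)"
  proof (rule transI)
    fix x y z assume xy: "(x, y) \<in> rep_equiv G" and yz: "(y, z) \<in> rep_equiv G"
    obtain n \<rho> m \<sigma> l \<tau> where [simp]: "x = (n, \<rho>)" "y = (m, \<sigma>)" "z = (l, \<tau>)"
      by (cases x, cases y, cases z)
    from xy obtain P where [simp]: "m = n" and P: "P \<in> carrier (GL n)"
      "\<And>g. g \<in> carrier G \<Longrightarrow> P * \<rho> g = \<sigma> g * P" and reps: "(n, \<rho>) \<in> reps G" "(n, \<sigma>) \<in> reps G"
      by (auto simp: rep_equiv_def)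
    from yz obtain Q where [simp]: "l = n" and Q: "Q \<in> carrier (GL n)"
      "\<And>g. g \<in> carrier G \<Longrightarrow> Q * \<sigma> g = \<tau> g * Q" and reps': "(n, \<tau>) \<in> reps G"
      by (auto simp: rep_equiv_def)
    have Pc: "P \<in> carrier_mat n n" and Qc: "Q \<in> carrier_mat n n" using P Q
      by (auto simp: carrier_GL_iff)
    interpret GL: group "GL n" by (rule group_GL)
    have "Q * P * \<rho> g = \<tau> g * (Q * P)" if g: "g \<in> carrier G" for g
    proof -
      note c = reps_carrier[OF reps(1) g] reps_carrier[OF reps(2) g] reps_carrier[OF reps' g]
      have "Q * P * \<rho> g = Q * (P * \<rho> g)" using assoc_mult_mat[OF Qc Pc c(1)] .
      also have "\<dots> = Q * \<sigma> g * P" using P(2)[OF g] assoc_mult_mat[OF Qc c(2) Pc] by simp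
      also have "\<dots> = \<tau> g * (Q * P)" using Q(2)[OF g] assoc_mult_mat[OF c(3) Qc Pc] by simp
      finally show ?thesis .
    qed
    moreover have "Q * P \<in> carrier (GL n)" using GL.m_closed[OF Q(1) P(1)] by (simp add: mult_GL)
    ultimately show "(x, z) \<in> rep_equiv G" using reps reps' by (auto simp: rep_equiv_def)
  qed
qed

lemma rep_equiv_trace:
  assumes "((m, \<rho>), (n, \<sigma>)) \<in> rep_equiv G" "g \<in> carrier G"
  shows "mat_trace (\<rho> g) = mat_trace (\<sigma> g)"
proof -
  from assms obtain P where "m = n" "P \<in> carrier (GL n)" "P * \<rho> g = \<sigma> g * P"
    and "(n, \<rho>) \<in> reps G" "(n, \<sigma>) \<in> reps G"
    by (auto simp: rep_equiv_def)
  then show ?thesis using mat_trace_similar reps_carrier assms(2) by blast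
qed

lemma trace_conj:
  assumes \<rho>: "(n, \<rho>) \<in> reps G" and g: "g \<in> carrier G" and h: "h \<in> carrier G"
  shows "mat_trace (\<rho> (h \<otimes> g \<otimes> inv h)) = mat_trace (\<rho> g)"
proof -
  have "\<rho> h \<in> carrier (GL n)" using \<rho> h by (auto simp: reps_def hom_def)
  moreover have "\<rho> h * \<rho> g = \<rho> (h \<otimes> g \<otimes> inv h) * \<rho> h"
    using reps_mult[OF \<rho> h g] reps_mult[OF \<rho>, of "h \<otimes> g \<otimes> inv h" h] g h by (simp add: m_assoc)
  ultimately show ?thesis using mat_trace_similar[of "\<rho> h" n "\<rho> g" "\<rho> (h \<otimes> g \<otimes> inv h)"]
      reps_carrier[OF \<rho>] g h by simp
qed

text \<open>A chosen representative of the class; by \<open>rep_equiv_trace\<close> the trace on it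
  is the same for every choice.\<close>

definition irrep_of :: "(nat \<times> ('a \<Rightarrow> complex mat)) set \<Rightarrow> nat \<times> ('a \<Rightarrow> complex mat)" where
  "irrep_of c = (SOME x. x \<in> irreps G \<and> c = rep_equiv G `` {x})"

definition irr_char :: "(nat \<times> ('a \<Rightarrow> complex mat)) set \<Rightarrow> 'a \<Rightarrow> complex" where
  "irr_char c g = mat_trace (snd (irrep_of c) g)"

lemma irrep_of:
  assumes "c \<in> Irr G"
  shows "irrep_of c \<in> irreps G" "c = rep_equiv G `` {irrep_of c}"
proof -
  have "\<exists>x. x \<in> irreps G \<and> c = rep_equiv G `` {x}" using assms by (auto simp: Irr_def quotient_def)
  from someI_ex[OF this] show "irrep_of c \<in> irreps G" "c = rep_equiv G `` {irrep_of c}"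
    by (auto simp: irrep_of_def)
qed

lemma irr_char_conj:
  assumes "c \<in> Irr G" "g \<in> carrier G" "h \<in> carrier G"
  shows "irr_char c (h \<otimes> g \<otimes> inv h) = irr_char c g"
proof -
  obtain n \<rho> where x: "irrep_of c = (n, \<rho>)" by (cases "irrep_of c")
  then show ?thesis using trace_conj[of n \<rho>] irrep_of(1)[OF assms(1)] irreps_reps assms
    by (simp add: irr_char_def)
qed

end

context finite_group
begin

lemma irr_char_orthogonal:
  assumes "c \<in> Irr G" "d \<in> Irr G"
  shows "(\<Sum>g\<in>carrier G. irr_char c g * irr_char d (inv g)) = (if c =
    d then of_nat (card (carrier G)) else 0)"
proof -
  obtain m \<rho> n \<sigma> where x: "irrep_of c = (m, \<rho>)" "irrep_of d = (n, \<sigma>)"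
    by (cases "irrep_of c", cases "irrep_of d")
  note c = irrep_of[OF assms(1), unfolded x] and d = irrep_of[OF assms(2), unfolded x]
  show ?thesis
  proof (cases "c = d")
    case True
    then show ?thesis using character_norm[OF c(1)] x by (simp add: irr_char_def)
  next
    case False
    then have "((n, \<sigma>), (m, \<rho>)) \<notin> rep_equiv G"
      using c(2) d(2) equiv_class_eq[OF equiv_rep_equiv] by metis
    then show ?thesis using character_orthogonal[OF c(1) d(1)] False x by (simp add: irr_char_def)
  qed
qed

lemma conj_classes_finite [simp]: "finite (conj_classes G)"
  by (simp add: conj_classes_def)

lemma sum_over_conj_classes:
  "(\<Sum>g\<in>carrier G. F g) = (\<Sum>K\<in>conj_classes G. \<Sum>g | g \<in> carrier G \<and> conj_class G g = K. F g)"
    for F :: "'a \<Rightarrow> complex"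
  unfolding conj_classes_def using sum.image_gen[OF finite_carrier, of F "conj_class G"] by simp

text \<open>Characters are constant on conjugacy classes, so more characters than classes would
  satisfy a linear relation, against orthogonality. The bound is stated for finite subsets because
  the finiteness of \<open>Irr G\<close> is deduced from it.\<close>

lemma card_Irr_subset_le:
  assumes S: "finite S" "S \<subseteq> Irr G"
  shows "card S \<le> card (conj_classes G)"
proof (rule ccontr)
  assume "\<not> ?thesis"
  then have "card (conj_classes G) < card S" by simp
  define pick where "pick K = (SOME g. g \<in> carrier G \<and> conj_class G g = K)" for K
  have pick: "pick (conj_class G g) \<in> carrier G" "conj_class G (pick (conj_class G g)) =
    conj_class G g"
    if "g \<in> carrier G" for g
    using someI[of "\<lambda>h. h \<in> carrier G \<and> conj_class G h = conj_class G g" g] that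
      by (auto simp: pick_def)
  from homogeneous_system_nontrivial[OF conj_classes_finite S(1) \<open>card (conj_classes G) < card S\<close>,
      of "\<lambda>K c. irr_char c (pick K)"]
  obtain x where x: "\<exists>c\<in>S. x c \<noteq> 0"
    and 0: "\<And>K. K \<in> conj_classes G \<Longrightarrow> (\<Sum>c\<in>S. irr_char c (pick K) * x c) = 0" by blast
  have sum0: "(\<Sum>c\<in>S. irr_char c g * x c) = 0" if g: "g \<in> carrier G" for g
  proof -
    have "g \<in> conj_class G (pick (conj_class G g))" using pick(2)[OF g] conj_class_self[OF g]
      by simp
    then obtain h where h: "h \<in> carrier G" "g = h \<otimes> pick (conj_class G g) \<otimes> inv h"
      by (auto simp: conj_class_def)
    have "irr_char c g = irr_char c (pick (conj_class G g))" if "c \<in> S" for c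
      using irr_char_conj[of c "pick (conj_class G g)" h] that S(2) pick(1)[OF g] h by auto
    then show ?thesis using 0[of "conj_class G g"] g by (simp add: conj_classes_def)
  qed
  obtain d where d: "d \<in> S" "x d \<noteq> 0" using x by blast
  \<comment> \<open>Pairing the relation with the character of \<open>d\<close> isolates the
    coefficient \<open>x d\<close>.\<close>
  have "0 = (\<Sum>g\<in>carrier G. (\<Sum>c\<in>S. irr_char c g * x c) * irr_char d (inv g))" using sum0 by simp
  also have "\<dots> = (\<Sum>g\<in>carrier G. \<Sum>c\<in>S. x c * (irr_char c g * irr_char d (inv g)))"
    unfolding sum_distrib_right by (intro sum.cong refl) (simp add: mult_ac)
  also have "\<dots> = (\<Sum>c\<in>S. \<Sum>g\<in>carrier G. x c * (irr_char c g * irr_char d (inv g)))" by (rule sum.swap)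
  also have "\<dots> = (\<Sum>c\<in>S. x c * (\<Sum>g\<in>carrier G. irr_char c g * irr_char d (inv g)))"
    by (simp add: sum_distrib_left)
  also have "\<dots> = (\<Sum>c\<in>S. if c = d then x c * of_nat (card (carrier G)) else 0)"
    using S d by (intro sum.cong) (auto simp: irr_char_orthogonal subset_iff)
  also have "\<dots> = x d * of_nat (card (carrier G))" using S d by (simp add: sum.delta)
  finally show False using d one_closed finite_carrier by auto
qed

text \<open>With fewer irreducible characters than conjugacy classes, some nonzero class function
  would be orthogonal to all of them, contrary to \<open>class_function_eq_0\<close>.\<close>

theorem card_Irr: "finite (Irr G)" "card (Irr G) = card (conj_classes G)"
proof -
  show fin: "finite (Irr G)"
  proof (rule ccontr)
    assume "infinite (Irr G)"
    then obtain S where "finite S" "card S = Suc (card (conj_classes G))" "S \<subseteq> Irr G"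
      by (meson infinite_arbitrarily_large)
    then show False using card_Irr_subset_le[of S] by simp
  qed
  have "\<not> card (Irr G) < card (conj_classes G)"
  proof
    assume "card (Irr G) < card (conj_classes G)"
    \<comment> \<open>The unknowns are the values of a class function on the conjugacy classes, with
      one equation for each irreducible character.\<close>
    from homogeneous_system_nontrivial[OF fin conj_classes_finite this,
        of "\<lambda>c K. \<Sum>g | g \<in> carrier G \<and> conj_class G g = K. irr_char c g"]
    obtain x where x: "\<exists>K\<in>conj_classes G. x K \<noteq> 0"
      and 0: "\<And>c. c \<in> Irr G \<Longrightarrow>
        (\<Sum>K\<in>conj_classes G. (\<Sum>g | g \<in> carrier G \<and> conj_class G g = K. irr_char c g) * x K) = 0" by blast
    define f where "f g = x (conj_class G g)" for g
    have f: "class_function f" unfolding class_function_def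
    proof (intro ballI)
      fix g h assume "g \<in> carrier G" "h \<in> carrier G"
      then have "conj_class G g = conj_class G (h \<otimes> g \<otimes> inv h)"
        by (subst conj_class_eq_iff) (auto simp: m_assoc intro!: bexI[of _ h])
      then show "f (h \<otimes> g \<otimes> inv h) = f g" by (simp add: f_def)
    qed
    have "(\<Sum>g\<in>carrier G. f g * mat_trace (\<rho> g)) = 0" if \<rho>: "(n, \<rho>) \<in> irreps G" for n \<rho>
    proof -
      define c where "c = rep_equiv G `` {(n, \<rho>)}"
      have c: "c \<in> Irr G" using \<rho> by (auto simp: c_def Irr_def quotient_def)
      obtain m \<sigma> where y: "irrep_of c = (m, \<sigma>)" by (cases "irrep_of c")
      \<comment> \<open>An arbitrary irreducible representation is compared with the chosen
        representative of its class, for which the equations were set up.\<close>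
      have "((n, \<rho>), (m, \<sigma>)) \<in> rep_equiv G"
      proof -
        have "(m, \<sigma>) \<in> reps G" using irrep_of(1)[OF c] y irreps_reps by simp
        then have "(m, \<sigma>) \<in> rep_equiv G `` {(m, \<sigma>)}" using equiv_rep_equiv equiv_class_self by fast
        then have "(m, \<sigma>) \<in> c" using irrep_of(2)[OF c] y by simp
        then show ?thesis by (simp add: c_def)
      qed
      then have tr: "mat_trace (\<rho> g) = irr_char c g" if "g \<in> carrier G" for g
        using rep_equiv_trace that y by (simp add: irr_char_def)
      have "(\<Sum>g\<in>carrier G. f g * mat_trace (\<rho> g)) = (\<Sum>g\<in>carrier G. f g * irr_char c g)"
        using tr by simp
      also have "\<dots> = (\<Sum>K\<in>conj_classes G. \<Sum>g | g \<in> carrier G \<and>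
        conj_class G g = K. f g * irr_char c g)"
        by (rule sum_over_conj_classes)
      also have "\<dots> = (\<Sum>K\<in>conj_classes G. (\<Sum>g | g \<in> carrier G \<and>
        conj_class G g = K. irr_char c g) * x K)"
        unfolding sum_distrib_right by (intro sum.cong refl) (auto simp: f_def)
      also have "\<dots> = 0" using 0[OF c] .
      finally show ?thesis .
    qed
    then have "f g = 0" if "g \<in> carrier G" for g using class_function_eq_0[OF f _ that] by blast
    then show False using x by (auto simp: conj_classes_def f_def)
  qed
  moreover have "card (Irr G) \<le> card (conj_classes G)" using card_Irr_subset_le[OF fin] by simp
  ultimately show "card (Irr G) = card (conj_classes G)" by simp
qed

end

section \<open>Conjugacy classes of products and of isomorphic groups\<close>

text \<open>Both counts rest on this: the classes of an equivalence are replaced by the values of a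
  complete invariant, which has the same fibres as the map to classes.\<close>

lemma ex_bij_betw_images:
  assumes "\<And>x y. x \<in> A \<Longrightarrow> y \<in> A \<Longrightarrow> f x = f y \<longleftrightarrow> g x = g y"
  shows "\<exists>h. bij_betw h (f ` A) (g ` A)"
proof -
  define h where "h z = g (inv_into A f z)" for z
  have hf: "h (f x) = g x" if "x \<in> A" for x
  proof -
    have "f (inv_into A f (f x)) = f x" "inv_into A f (f x) \<in> A"
      using that by (auto intro: f_inv_into_f inv_into_into)
    then show ?thesis using assms that by (auto simp: h_def)
  qed
  have "bij_betw h (f ` A) (g ` A)"
  proof (rule bij_betwI')
    fix u v assume "u \<in> f ` A" "v \<in> f ` A"
    then obtain x y where "x \<in> A" "u = f x" "y \<in> A" "v = f y" by blast
    then show "h u = h v \<longleftrightarrow> u = v" using hf assms[of x y] by simp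
  next
    fix u assume "u \<in> f ` A"
    then show "h u \<in> g ` A" using hf by auto
  next
    fix w assume "w \<in> g ` A"
    then show "\<exists>u\<in>f ` A. w = h u" using hf by auto
  qed
  then show ?thesis by blast
qed

lemma restrict_eq_iff: "restrict f A = restrict g A \<longleftrightarrow> (\<forall>x\<in>A. f x = g x)"
  by (auto simp: fun_eq_iff restrict_def)

lemma (in group) card_conj_classes_invariant:
  assumes "\<And>x y. x \<in> carrier G \<Longrightarrow> y \<in> carrier G \<Longrightarrow> f x = f y \<longleftrightarrow> (\<exists>g\<in>carrier G. y \<otimes> g = g \<otimes> x)"
  shows "card (conj_classes G) = card (f ` carrier G)"
proof -
  have "\<exists>h. bij_betw h (conj_class G ` carrier G) (f ` carrier G)"
    by (rule ex_bij_betw_images) (simp add: assms conj_class_eq_iff)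
  then show ?thesis unfolding conj_classes_def using bij_betw_same_card by blast
qed

lemma card_conj_classes_iso:
  assumes "group G" "group H" "h \<in> iso G H"
  shows "card (conj_classes H) = card (conj_classes G)"
proof -
  interpret G: group G by fact
  interpret H: group H by fact
  have hom: "h \<in> hom G H" and bij: "bij_betw h (carrier G) (carrier H)" using assms(3)
    by (auto simp: iso_def)
  have hc: "h x \<in> carrier H" if "x \<in> carrier G" for x using hom that by (auto simp: hom_def)
  have inj: "inj_on h (carrier G)" and img: "h ` carrier G = carrier H" using bij
    by (auto simp: bij_betw_def)
  have "conj_classes H = (\<lambda>x. conj_class H (h x)) ` carrier G"
    unfolding conj_classes_def img[symmetric] by (simp add: image_image)
  moreover have "conj_class H (h x) = conj_class H (h y) \<longleftrightarrow> (\<exists>g\<in>carrier G. y \<otimes>\<^bsub>G\<^esub> g = g \<otimes>\<^bsub>G\<^esub> x)"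
    if xy: "x \<in> carrier G" "y \<in> carrier G" for x y
  proof -
    have "h y \<otimes>\<^bsub>H\<^esub> h g = h g \<otimes>\<^bsub>H\<^esub> h x \<longleftrightarrow> y \<otimes>\<^bsub>G\<^esub> g = g \<otimes>\<^bsub>G\<^esub> x" if "g \<in> carrier G" for g
      using hom_mult[OF hom] inj_on_eq_iff[OF inj] xy that by (metis G.m_closed)
    then show ?thesis unfolding H.conj_class_eq_iff[OF hc[OF xy(1)] hc[OF xy(2)]] img[symmetric]
      by auto
  qed
  ultimately show ?thesis
    using G.card_conj_classes_invariant[of "\<lambda>x. conj_class H (h x)"] by simp
qed

text \<open>A conjugating element of the product can be chosen one component at a time, so the tuple
  of conjugacy classes is a complete invariant, and every tuple occurs.\<close>

lemma card_conj_classes_product_group: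
  assumes I: "finite I" and G: "\<And>i. i \<in> I \<Longrightarrow> group (G i)"
  shows "card (conj_classes (product_group I G)) = (\<Prod>i\<in>I. card (conj_classes (G i)))"
proof -
  interpret P: group "product_group I G" using G by simp
  define f where "f x = (\<lambda>i\<in>I. conj_class (G i) (x i))" for x
  have "card (conj_classes (product_group I G)) = card (f ` carrier (product_group I G))"
  proof (rule P.card_conj_classes_invariant)
    fix x y assume xy: "x \<in> carrier (product_group I G)" "y \<in> carrier (product_group I G)"
    then have xi: "x i \<in> carrier (G i)" "y i \<in> carrier (G i)" if "i \<in> I" for i using that by auto
    have "f x = f y \<longleftrightarrow> (\<forall>i\<in>I. conj_class (G i) (x i) = conj_class (G i) (y i))"
      unfolding f_def by (rule restrict_eq_iff)
    also have "\<dots> \<longleftrightarrow> (\<forall>i\<in>I. \<exists>g\<in>carrier (G i). y i \<otimes>\<^bsub>G i\<^esub> g = g \<otimes>\<^bsub>G i\<^esub> x i)"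
      using group.conj_class_eq_iff[OF G xi] by simp
    also have "\<dots> \<longleftrightarrow> (\<exists>g\<in>carrier (product_group I G). y \<otimes>\<^bsub>product_group I G\<^esub> g =
      g \<otimes>\<^bsub>product_group I G\<^esub> x)"
    proof
      assume "\<forall>i\<in>I. \<exists>g\<in>carrier (G i). y i \<otimes>\<^bsub>G i\<^esub> g = g \<otimes>\<^bsub>G i\<^esub> x i"
      then obtain g where g: "\<And>i. i \<in> I \<Longrightarrow> g i \<in> carrier (G i)" "\<And>i. i \<in> I \<Longrightarrow>
        y i \<otimes>\<^bsub>G i\<^esub> g i = g i \<otimes>\<^bsub>G i\<^esub> x i"
        by metis
      then show "\<exists>g\<in>carrier (product_group I G). y \<otimes>\<^bsub>product_group I G\<^esub> g =
        g \<otimes>\<^bsub>product_group I G\<^esub> x"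
        by (intro bexI[of _ "restrict g I"]) (auto intro!: restrict_ext)
    next
      assume "\<exists>g\<in>carrier (product_group I G). y \<otimes>\<^bsub>product_group I G\<^esub> g = g \<otimes>\<^bsub>product_group I G\<^esub> x"
      then obtain g where g: "g \<in> carrier (product_group I G)"
        "(\<lambda>i\<in>I. y i \<otimes>\<^bsub>G i\<^esub> g i) = (\<lambda>i\<in>I. g i \<otimes>\<^bsub>G i\<^esub> x i)" by auto
      have "y i \<otimes>\<^bsub>G i\<^esub> g i = g i \<otimes>\<^bsub>G i\<^esub> x i" if "i \<in> I" for i
        using fun_cong[OF g(2), of i] that by simp
      moreover have "g i \<in> carrier (G i)" if "i \<in> I" for i using g(1) that by auto
      ultimately show "\<forall>i\<in>I. \<exists>g\<in>carrier (G i). y i \<otimes>\<^bsub>G i\<^esub> g = g \<otimes>\<^bsub>G i\<^esub> x i" by blast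
    qed
    finally show "f x = f y \<longleftrightarrow> (\<exists>g\<in>carrier (product_group I G). y \<otimes>\<^bsub>product_group I G\<^esub> g =
      g \<otimes>\<^bsub>product_group I G\<^esub> x)" .
  qed
  also have "f ` carrier (product_group I G) = (\<Pi>\<^sub>E i\<in>I. conj_classes (G i))"
  proof
    show "f ` carrier (product_group I G) \<subseteq> (\<Pi>\<^sub>E i\<in>I. conj_classes (G i))"
      by (auto simp: f_def conj_classes_def)
    show "(\<Pi>\<^sub>E i\<in>I. conj_classes (G i)) \<subseteq> f ` carrier (product_group I G)"
    proof
      fix t assume t: "t \<in> (\<Pi>\<^sub>E i\<in>I. conj_classes (G i))"
      then have "\<forall>i\<in>I. \<exists>x. x \<in> carrier (G i) \<and> t i = conj_class (G i) x"
        by (auto simp: conj_classes_def PiE_def Pi_def image_iff Bex_def)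
      then obtain x where x: "\<And>i. i \<in> I \<Longrightarrow> x i \<in> carrier (G i) \<and> t i = conj_class (G i) (x i)"
        by metis
      have "f (restrict x I) = t"
      proof
        fix i show "f (restrict x I) i = t i"
          using x t by (cases "i \<in> I") (auto simp: f_def PiE_def extensional_def)
      qed
      moreover have "restrict x I \<in> carrier (product_group I G)" using x by auto
      ultimately show "t \<in> f ` carrier (product_group I G)" by blast
    qed
  qed
  also have "card \<dots> = (\<Prod>i\<in>I. card (conj_classes (G i)))" using I by (rule card_PiE)
  finally show ?thesis .
qed

section \<open>Wreath products\<close>

abbreviation sym_wreath where "sym_wreath G n \<equiv> wreath G n (sym_group n)"

lemma carrier_wreath: "carrier (sym_wreath G n) = ({1..n} \<rightarrow>\<^sub>E carrier G) \<times> {p. p permutes {1..n}}"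
  by (simp add: wreath_def sym_group_def)

lemma mult_wreath:
  "(a, p) \<otimes>\<^bsub>sym_wreath G n\<^esub> (b, q) = (\<lambda>i\<in>{1..n}. a i \<otimes>\<^bsub>G\<^esub> b (inv_into UNIV p i), p \<circ> q)"
  by (simp add: wreath_def sym_group_def)

lemma one_wreath: "\<one>\<^bsub>sym_wreath G n\<^esub> = (\<lambda>i\<in>{1..n}. \<one>\<^bsub>G\<^esub>, id)"
  by (simp add: wreath_def sym_group_def)

lemma permutes_inv_in: "p permutes S \<Longrightarrow> inv_into UNIV p i \<in> S \<longleftrightarrow> i \<in> S"
  using permutes_in_image[OF permutes_inv] by metis

lemma group_wreath:
  fixes G (structure)
  assumes "group G"
  shows "group (sym_wreath G n)"
proof -
  interpret group G by fact
  show ?thesis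
  proof (rule groupI)
    fix x y assume "x \<in> carrier (sym_wreath G n)" "y \<in> carrier (sym_wreath G n)"
    then obtain a p b q where xy: "x = (a, p)" "y =
      (b, q)" "a \<in> {1..n} \<rightarrow>\<^sub>E carrier G" "b \<in> {1..n} \<rightarrow>\<^sub>E carrier G"
      "p permutes {1..n}" "q permutes {1..n}" by (auto simp: carrier_wreath)
    have "a i \<otimes> b (inv_into UNIV p i) \<in> carrier G" if "i \<in> {1..n}" for i
      using that xy permutes_inv_in[OF xy(5), of i] by (intro m_closed) (auto simp: PiE_def Pi_def)
    then show "x \<otimes>\<^bsub>sym_wreath G n\<^esub> y \<in> carrier (sym_wreath G n)"
      using xy by (auto simp: carrier_wreath mult_wreath permutes_compose)
  next
    show "\<one>\<^bsub>sym_wreath G n\<^esub> \<in> carrier (sym_wreath G n)"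
      by (auto simp: carrier_wreath one_wreath permutes_id)
  next
    fix x y z assume "x \<in> carrier (sym_wreath G n)" "y \<in> carrier (sym_wreath G n)"
      "z \<in> carrier (sym_wreath G n)"
    then obtain a p b q c s where xyz: "x = (a, p)" "y = (b, q)" "z =
      (c, s)" "a \<in> {1..n} \<rightarrow>\<^sub>E carrier G"
      "b \<in> {1..n} \<rightarrow>\<^sub>E carrier G" "c \<in> {1..n} \<rightarrow>\<^sub>E carrier G"
      "p permutes {1..n}" "q permutes {1..n}" "s permutes {1..n}" by (auto simp: carrier_wreath)
    have inv_pq: "inv_into UNIV (p \<circ> q) i = inv_into UNIV q (inv_into UNIV p i)" for i
      using o_inv_distrib[OF permutes_bij[OF xyz(7)] permutes_bij[OF xyz(8)]] by simp
    have "(a i \<otimes> b (inv_into UNIV p i)) \<otimes> c (inv_into UNIV (p \<circ> q) i)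
      = a i \<otimes> (b (inv_into UNIV p i) \<otimes> c (inv_into UNIV q (inv_into UNIV p i)))" if "i \<in> {1..n}" for i
    proof -
      have "inv_into UNIV p i \<in> {1..n}" "inv_into UNIV q (inv_into UNIV p i) \<in> {1..n}"
        using that permutes_inv_in[OF xyz(7)] permutes_inv_in[OF xyz(8)] by auto
      then show ?thesis unfolding inv_pq using that xyz
        by (intro m_assoc) (auto simp: PiE_def Pi_def)
    qed
    then show "x \<otimes>\<^bsub>sym_wreath G n\<^esub> y \<otimes>\<^bsub>sym_wreath G n\<^esub> z
      = x \<otimes>\<^bsub>sym_wreath G n\<^esub> (y \<otimes>\<^bsub>sym_wreath G n\<^esub> z)"
      using permutes_inv_in[OF xyz(7)]
        by (auto simp: xyz(1-3) mult_wreath o_assoc intro!: restrict_ext)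
  next
    fix x assume "x \<in> carrier (sym_wreath G n)"
    then obtain a p where x: "x = (a, p)" "a \<in> {1..n} \<rightarrow>\<^sub>E carrier G" "p permutes {1..n}"
      by (auto simp: carrier_wreath)
    have "\<one> \<otimes> a i = a i" if "i \<in> {1..n}" for i using x that by (intro l_one) auto
    then show "\<one>\<^bsub>sym_wreath G n\<^esub> \<otimes>\<^bsub>sym_wreath G n\<^esub> x = x"
      using x by (auto simp: one_wreath mult_wreath fun_eq_iff PiE_def extensional_def restrict_def)
    \<comment> \<open>The first component of the inverse of \<open>(a; p)\<close>: the inverted
      entries are shifted along with the inverse permutation.\<close>
    define b where "b = (\<lambda>i\<in>{1..n}. inv (a (p i)))"
    have ap: "a (p i) \<in> carrier G" if "i \<in> {1..n}" for i
      using x that permutes_in_image[OF x(3), of i] by auto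
    have "(b, inv_into UNIV p) \<in> carrier (sym_wreath G n)"
      using ap x(3) by (auto simp: b_def carrier_wreath permutes_inv)
    moreover have "(b, inv_into UNIV p) \<otimes>\<^bsub>sym_wreath G n\<^esub> x = \<one>\<^bsub>sym_wreath G n\<^esub>"
      using ap x permutes_inv_inv[OF x(3)] permutes_inv_o(2)[OF x(3)]
      by (auto simp: b_def mult_wreath one_wreath intro!: restrict_ext)
    ultimately show "\<exists>y\<in>carrier (sym_wreath G n). y \<otimes>\<^bsub>sym_wreath G n\<^esub> x = \<one>\<^bsub>sym_wreath G n\<^esub>"
      by blast
  qed
qed

lemma finite_wreath: "finite (carrier G) \<Longrightarrow> finite (carrier (sym_wreath G n))"
  unfolding carrier_wreath by (intro finite_cartesian_product finite_PiE finite_permutations) auto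

text \<open>The first components are compared at the positions \<open>s (p i)\<close>, which exhaust
  \<open>{1..n}\<close>; this choice removes the inverses of \<open>q\<close> and
  \<open>s\<close>.\<close>

lemma wreath_intertwine_iff:
  assumes "p permutes {1..n}" "q permutes {1..n}" "s permutes {1..n}"
  shows "(b, q) \<otimes>\<^bsub>sym_wreath G n\<^esub> (c, s) = (c, s) \<otimes>\<^bsub>sym_wreath G n\<^esub> (a, p) \<longleftrightarrow>
    (\<forall>i. q (s i) = s (p i)) \<and>
    (\<forall>i\<in>{1..n}. b (s (p i)) \<otimes>\<^bsub>G\<^esub> c (s i) = c (s (p i)) \<otimes>\<^bsub>G\<^esub> a (p i))"
proof -
  have A: "(\<forall>j\<in>{1..n}. b j \<otimes>\<^bsub>G\<^esub> c (inv_into UNIV q j) = c j \<otimes>\<^bsub>G\<^esub> a (inv_into UNIV s j)) \<longleftrightarrow>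
    (\<forall>i\<in>{1..n}. b (s (p i)) \<otimes>\<^bsub>G\<^esub> c (s i) = c (s (p i)) \<otimes>\<^bsub>G\<^esub> a (p i))" (is "?L \<longleftrightarrow> ?R")
    if qs: "\<forall>i. q (s i) = s (p i)"
  proof -
    have 1: "inv_into UNIV q (s (p i)) = s i" for i
      using qs permutes_inverses(2)[OF assms(2)] by metis
    have 2: "inv_into UNIV s (s (p i)) = p i" for i by (rule permutes_inverses(2)[OF assms(3)])
    have sp: "s (p i) \<in> {1..n}" if "i \<in> {1..n}" for i
      using that permutes_in_image[OF assms(1)] permutes_in_image[OF assms(3)] by simp
    have ex: "\<exists>i\<in>{1..n}. j = s (p i)" if "j \<in> {1..n}" for j
    proof -
      let ?i = "inv_into UNIV p (inv_into UNIV s j)"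
      have "?i \<in> {1..n}" using that permutes_inv_in[OF assms(1)] permutes_inv_in[OF assms(3)]
        by simp
      moreover have "j = s (p ?i)"
        using permutes_inverses(1)[OF assms(1)] permutes_inverses(1)[OF assms(3)] by simp
      ultimately show ?thesis by blast
    qed
    have eq: "b (s (p i)) \<otimes>\<^bsub>G\<^esub> c (inv_into UNIV q (s (p i))) = c (s (p i)) \<otimes>\<^bsub>G\<^esub> a (inv_into UNIV s (s (p i)))
      \<longleftrightarrow> b (s (p i)) \<otimes>\<^bsub>G\<^esub> c (s i) = c (s (p i)) \<otimes>\<^bsub>G\<^esub> a (p i)" for i unfolding 1 2 ..
    show ?thesis
    proof
      assume L: ?L
      show ?R
      proof
        fix i assume "i \<in> {1..n}"
        from L[rule_format, OF sp[OF this]] show "b (s (p i)) \<otimes>\<^bsub>G\<^esub> c (s i) =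
          c (s (p i)) \<otimes>\<^bsub>G\<^esub> a (p i)"
          unfolding eq .
      qed
    next
      assume R: ?R
      show ?L
      proof
        fix j assume "j \<in> {1..n}"
        then obtain i where i: "i \<in> {1..n}" "j = s (p i)" using ex by blast
        show "b j \<otimes>\<^bsub>G\<^esub> c (inv_into UNIV q j) = c j \<otimes>\<^bsub>G\<^esub> a (inv_into UNIV s j)"
          unfolding i(2) eq using R i(1) by blast
      qed
    qed
  qed
  have B: "(\<lambda>j\<in>{1..n}. b j \<otimes>\<^bsub>G\<^esub> c (inv_into UNIV q j)) = (\<lambda>j\<in>{1..n}. c j \<otimes>\<^bsub>G\<^esub> a (inv_into UNIV s j)) \<longleftrightarrow>
    (\<forall>j\<in>{1..n}. b j \<otimes>\<^bsub>G\<^esub> c (inv_into UNIV q j) = c j \<otimes>\<^bsub>G\<^esub> a (inv_into UNIV s j))"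
    by (rule restrict_eq_iff)
  have C: "q \<circ> s = s \<circ> p \<longleftrightarrow> (\<forall>i. q (s i) = s (p i))" by (auto simp: fun_eq_iff)
  show ?thesis unfolding mult_wreath prod.inject B C
    by (subst conj_commute) (rule conj_cong[OF refl A])
qed

section \<open>Cycle products\<close>

lemma permutes_funpow_in: "p permutes S \<Longrightarrow> (p ^^ k) i \<in> S \<longleftrightarrow> i \<in> S"
  using permutes_in_image[OF permutes_funpow] by metis

lemma funpow_intertwine: "(\<And>i. q (s i) = s (p i)) \<Longrightarrow> (q ^^ k) (s i) = s ((p ^^ k) i)"
  by (induction k) simp_all

lemma least_power_intertwine:
  assumes "\<And>i. q (s i) = s (p i)" "inj s"
  shows "least_power q (s i) = least_power p i"
  unfolding least_power_def funpow_intertwine[of q s p, OF assms(1)] inj_eq[OF assms(2)] ..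

lemma funpow_least_power_mult: "(p ^^ m) i = i \<Longrightarrow> (p ^^ (m * l)) i = i"
  by (induction l) (simp_all add: funpow_add)

text \<open>The forward orbit, which for a permutation of finite support is the cycle through
  \<open>i\<close>.\<close>

definition orbit_of :: "('i \<Rightarrow> 'i) \<Rightarrow> 'i \<Rightarrow> 'i set" where
  "orbit_of p i = range (\<lambda>k. (p ^^ k) i)"

lemma orbit_of_sym:
  assumes p: "permutation p" and j: "j \<in> orbit_of p i"
  shows "i \<in> orbit_of p j"
proof -
  obtain l where l: "j = (p ^^ l) i" using j by (auto simp: orbit_of_def)
  define m where "m = least_power p i"
  have m: "(p ^^ m) i = i" "m > 0" using least_power_of_permutation[OF p] by (auto simp: m_def)
  have "(p ^^ (m * l - l)) j = (p ^^ (m * l - l + l)) i" unfolding l funpow_add by simp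
  also have "m * l - l + l = m * l" using m(2) by simp
  finally have "(p ^^ (m * l - l)) j = i" using funpow_least_power_mult[OF m(1)] by simp
  then show ?thesis unfolding orbit_of_def by (metis rangeI)
qed

lemma orbit_of_trans:
  assumes "j \<in> orbit_of p i" "k \<in> orbit_of p j"
  shows "k \<in> orbit_of p i"
proof -
  from assms obtain l l' where "j = (p ^^ l) i" "k = (p ^^ l') j" by (auto simp: orbit_of_def)
  then have "k = (p ^^ (l' + l)) i" by (simp add: funpow_add)
  then show ?thesis unfolding orbit_of_def by (metis rangeI)
qed

lemma orbit_of_self: "i \<in> orbit_of p i"
  unfolding orbit_of_def by (rule range_eqI[of _ _ 0]) simp

lemma orbit_of_eq:
  assumes "permutation p" "j \<in> orbit_of p i"
  shows "orbit_of p j = orbit_of p i"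
proof
  show "orbit_of p j \<subseteq> orbit_of p i" by (rule subsetI) (rule orbit_of_trans[OF assms(2)])
  show "orbit_of p i \<subseteq> orbit_of p j"
    by (rule subsetI) (rule orbit_of_trans[OF orbit_of_sym[OF assms]])
qed

text \<open>The choice depends only on the orbit as a set, so all points of a cycle get the same
  root.\<close>

definition orbit_root :: "('i \<Rightarrow> 'i) \<Rightarrow> 'i \<Rightarrow> 'i" where
  "orbit_root p i = (SOME j. j \<in> orbit_of p i)"

lemma orbit_root_in: "orbit_root p i \<in> orbit_of p i"
  unfolding orbit_root_def using orbit_of_self by (rule someI)

lemma orbit_root_eq: "permutation p \<Longrightarrow> j \<in> orbit_of p i \<Longrightarrow> orbit_root p j = orbit_root p i"
  by (simp add: orbit_root_def orbit_of_eq)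

lemma orbit_root_reaches:
  assumes "permutation p"
  shows "\<exists>k. (p ^^ k) (orbit_root p i) = i"
proof -
  obtain k where "i = (p ^^ k) (orbit_root p i)"
    using orbit_of_sym[OF assms orbit_root_in[of p i]] by (auto simp: orbit_of_def)
  then show ?thesis by (intro exI[of _ k]) (rule sym)
qed

context group
begin

text \<open>The factors run from \<open>a (p i)\<close> on the right to the latest one on the left,
  which makes this the entry of the \<open>k\<close>-th power of \<open>(a; p)\<close> at the point
  \<open>(p ^^ k) i\<close>. When \<open>k\<close> is the length of the cycle, it is the cycle
  product, with \<open>a i\<close> as its leftmost factor.\<close>

primrec cycle_prod :: "('i \<Rightarrow> 'a) \<Rightarrow> ('i \<Rightarrow> 'i) \<Rightarrow> nat \<Rightarrow> 'i \<Rightarrow> 'a" where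
  "cycle_prod a p 0 i = \<one>"
| "cycle_prod a p (Suc k) i = a ((p ^^ Suc k) i) \<otimes> cycle_prod a p k i"

lemma cycle_prod_closed:
  assumes "\<And>j. j \<in> S \<Longrightarrow> a j \<in> carrier G" "p permutes S" "i \<in> S"
  shows "cycle_prod a p k i \<in> carrier G"
proof (induction k)
  case (Suc k)
  have "(p ^^ Suc k) i \<in> S" using permutes_funpow_in[OF assms(2)] assms(3) by blast
  then have "a ((p ^^ Suc k) i) \<in> carrier G" by (rule assms(1))
  then show ?case using Suc by (simp del: funpow.simps)
qed simp

lemma cycle_prod_add:
  assumes a: "\<And>j. j \<in> S \<Longrightarrow> a j \<in> carrier G" and p: "p permutes S" and i: "i \<in> S"
  shows "cycle_prod a p (k + l) i = cycle_prod a p k ((p ^^ l) i) \<otimes> cycle_prod a p l i"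
proof (induction k)
  case 0
  then show ?case using cycle_prod_closed[OF a p i] by simp
next
  case (Suc k)
  have li: "(p ^^ l) i \<in> S" using permutes_funpow_in[OF p] i by blast
  have "a ((p ^^ Suc k) ((p ^^ l) i)) \<in> carrier G" using permutes_funpow_in[OF p] li a by blast
  moreover have "(p ^^ (Suc k + l)) i = (p ^^ Suc k) ((p ^^ l) i)"
    unfolding funpow_add by simp
  then have "(p ^^ Suc (k + l)) i = (p ^^ Suc k) ((p ^^ l) i)" by (simp del: funpow.simps)
  ultimately show ?case
    using Suc cycle_prod_closed[OF a p i, where k = l] cycle_prod_closed[OF a p li, where k = k]
    by (simp add: m_assoc del: funpow.simps)
qed

text \<open>Moving the starting point along the cycle conjugates the cycle product, so only its
  class is attached to the cycle; see \<open>cycle_class_orbit\<close>.\<close>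

definition cycle_class :: "(nat \<Rightarrow> 'a) \<times> (nat \<Rightarrow> nat) \<Rightarrow> nat \<Rightarrow> 'a set" where
  "cycle_class x i = conj_class G (cycle_prod (fst x) (snd x) (least_power (snd x) i) i)"

lemma wreath_cases:
  assumes "x \<in> carrier (sym_wreath G n)"
  obtains a p where "x = (a, p)" "\<And>i. i \<in> {1..n} \<Longrightarrow>
    a i \<in> carrier G" "p permutes {1..n}" "permutation p"
proof -
  obtain a p where x: "x = (a, p)" by (cases x)
  then have "p permutes {1..n}" using assms by (simp add: carrier_wreath)
  moreover from this have "permutation p" unfolding permutation_permutes by blast
  moreover have "a i \<in> carrier G" if "i \<in> {1..n}" for i
    using assms that unfolding x carrier_wreath by auto
  ultimately show thesis using that x by blast
qed

lemma cycle_class_in: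
  assumes "x \<in> carrier (sym_wreath G n)" "i \<in> {1..n}"
  shows "cycle_class x i \<in> conj_classes G"
  using assms(1)
proof (rule wreath_cases)
  fix a p assume x: "x = (a, p)" and a: "\<And>i. i \<in> {1..n} \<Longrightarrow> a i \<in> carrier G"
    and p: "p permutes {1..n}"
  show ?thesis using cycle_prod_closed[OF a p assms(2)]
    by (auto simp: x cycle_class_def conj_classes_def)
qed

text \<open>The conditions in \<open>wreath_intertwine_iff\<close> telescope along the cycle of
  \<open>i\<close>. When the cycle closes up, the entry of \<open>g\<close> at
  \<open>snd g i\<close> conjugates one cycle product into the other.\<close>

lemma cycle_class_intertwine:
  assumes x: "x \<in> carrier (sym_wreath G n)" and y: "y \<in> carrier (sym_wreath G n)"
    and g: "g \<in> carrier (sym_wreath G n)"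
    and eq: "y \<otimes>\<^bsub>sym_wreath G n\<^esub> g = g \<otimes>\<^bsub>sym_wreath G n\<^esub> x" and i: "i \<in> {1..n}"
  shows "cycle_class y (snd g i) = cycle_class x i"
proof -
  obtain a p where [simp]: "x = (a, p)" and a: "\<And>i. i \<in> {1..n} \<Longrightarrow> a i \<in> carrier G"
    and p: "p permutes {1..n}" "permutation p"
    using wreath_cases[OF x] by metis
  obtain b q where [simp]: "y = (b, q)" and b: "\<And>i. i \<in> {1..n} \<Longrightarrow> b i \<in> carrier G"
    and q: "q permutes {1..n}"
    using wreath_cases[OF y] by metis
  obtain c s where [simp]: "g = (c, s)" and c: "\<And>i. i \<in> {1..n} \<Longrightarrow> c i \<in> carrier G"
    and s: "s permutes {1..n}"
    using wreath_cases[OF g] by metis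
  from eq have "(\<forall>i. q (s i) = s (p i)) \<and> (\<forall>i\<in>{1..n}. b (s (p i)) \<otimes> c (s i) =
    c (s (p i)) \<otimes> a (p i))"
    unfolding \<open>x = (a, p)\<close> \<open>y = (b, q)\<close> \<open>g = (c, s)\<close> wreath_intertwine_iff[OF p(1) q s] .
  then have qs: "\<And>i. q (s i) = s (p i)"
    and step: "\<And>i. i \<in> {1..n} \<Longrightarrow> b (s (p i)) \<otimes> c (s i) = c (s (p i)) \<otimes> a (p i)" by blast+
  have si: "s i \<in> {1..n}" using permutes_in_image[OF s] i by blast
  have ci: "c (s i) \<in> carrier G" using c si by blast
  have Ac: "cycle_prod a p k i \<in> carrier G" for k by (rule cycle_prod_closed[OF a p(1) i])
  have Bc: "cycle_prod b q k (s i) \<in> carrier G" for k by (rule cycle_prod_closed[OF b q si])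
  have "cycle_prod b q k (s i) \<otimes> c (s i) = c (s ((p ^^ k) i)) \<otimes> cycle_prod a p k i" for k
  proof (induction k)
    case 0
    then show ?case using ci by simp
  next
    case (Suc k)
    let ?j = "(p ^^ k) i"
    have j: "?j \<in> {1..n}" "p ?j \<in> {1..n}"
      using permutes_funpow_in[OF p(1)] permutes_in_image[OF p(1)] i by blast+
    then have sj: "s ?j \<in> {1..n}" "s (p ?j) \<in> {1..n}" using permutes_in_image[OF s] by blast+
    have "cycle_prod b q (Suc k) (s i) \<otimes> c (s i) =
      b (s (p ?j)) \<otimes> (cycle_prod b q k (s i) \<otimes> c (s i))"
      using funpow_intertwine[of q s p, OF qs, of "Suc k" i] b[OF sj(2)] ci cycle_prod_closed[OF b q
        si, where k = k]
      by (simp add: m_assoc)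
    also have "\<dots> = b (s (p ?j)) \<otimes> c (s ?j) \<otimes> cycle_prod a p k i"
      using Suc b[OF sj(2)] c[OF sj(1)] cycle_prod_closed[OF a p(1) i, where k = k]
        by (simp add: m_assoc)
    also have "\<dots> = c (s (p ?j)) \<otimes> (a (p ?j) \<otimes> cycle_prod a p k i)"
      using step[OF j(1)] c[OF sj(2)] a[OF j(2)] cycle_prod_closed[OF a p(1) i, where k = k]
        by (simp add: m_assoc)
    finally show ?case by simp
  qed
  from this[of "least_power p i"]
  have "cycle_prod b q (least_power p i) (s i) \<otimes> c (s i) =
    c (s i) \<otimes> cycle_prod a p (least_power p i) i"
    by (simp add: least_power_of_permutation[OF p(2)])
  then have "conj_class G (cycle_prod a p (least_power p i) i) =
    conj_class G (cycle_prod b q (least_power p i) (s i))"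
    using ci by (subst conj_class_eq_iff[OF Ac Bc]) (rule bexI[of _ "c (s i)"])
  then show ?thesis
    using least_power_intertwine[of q s p, OF qs permutes_inj[OF s]] by (simp add: cycle_class_def)
qed

text \<open>\<open>x\<close> commutes with itself, so \<open>cycle_class_intertwine\<close> applies
  with all three elements equal to \<open>x\<close> and moves \<open>i\<close> one step along its
  cycle.\<close>

lemma cycle_class_orbit:
  assumes x: "x \<in> carrier (sym_wreath G n)" and i: "i \<in> {1..n}"
  shows "cycle_class x ((snd x ^^ k) i) = cycle_class x i"
proof (induction k)
  case (Suc k)
  obtain a p where [simp]: "x = (a, p)" and p: "p permutes {1..n}"
    using wreath_cases[OF x] by metis
  have "(p ^^ k) i \<in> {1..n}" using permutes_funpow_in[OF p] i by blast
  from cycle_class_intertwine[OF x x x refl this] Suc show ?case by simp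
qed simp

text \<open>
  A conjugating element is determined along each cycle by its entry at one point of the cycle, and
  the equality of the cycle classes is what makes this consistent once the cycle closes up.
\<close>

lemma wreath_conjugate:
  assumes x: "x \<in> carrier (sym_wreath G n)" and y: "y \<in> carrier (sym_wreath G n)"
    and s: "s permutes {1..n}" and qs: "\<And>i. snd y (s i) = s (snd x i)"
    and cls: "\<And>i. i \<in> {1..n} \<Longrightarrow> cycle_class y (s i) = cycle_class x i"
  shows "\<exists>g\<in>carrier (sym_wreath G n).
    y \<otimes>\<^bsub>sym_wreath G n\<^esub> g = g \<otimes>\<^bsub>sym_wreath G n\<^esub> x"
proof -
  obtain a p where [simp]: "x = (a, p)" and a: "\<And>i. i \<in> {1..n} \<Longrightarrow> a i \<in> carrier G"
    and p: "p permutes {1..n}" "permutation p"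
    using wreath_cases[OF x] by metis
  obtain b q where [simp]: "y = (b, q)" and b: "\<And>i. i \<in> {1..n} \<Longrightarrow> b i \<in> carrier G"
    and q: "q permutes {1..n}"
    using wreath_cases[OF y] by metis
  have qs: "q (s i) = s (p i)" for i using qs[of i] by simp
  have s_in: "s i \<in> {1..n}" if "i \<in> {1..n}" for i using permutes_in_image[OF s] that by blast
  have p_in: "(p ^^ k) i \<in> {1..n}" if "i \<in> {1..n}" for i k using permutes_funpow_in[OF p(1)] that
    by blast
  have Ac: "cycle_prod a p k i \<in> carrier G" if "i \<in> {1..n}" for k i
    by (rule cycle_prod_closed[OF a p(1) that])
  have Bc: "cycle_prod b q k (s i) \<in> carrier G" if "i \<in> {1..n}" for k i
    by (rule cycle_prod_closed[OF b q s_in[OF that]])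
  have "\<exists>u\<in>carrier G. cycle_prod b q (least_power p i) (s i) \<otimes> u =
    u \<otimes> cycle_prod a p (least_power p i) i"
    if i: "i \<in> {1..n}" for i
  proof -
    have "conj_class G (cycle_prod a p (least_power p i) i) =
      conj_class G (cycle_prod b q (least_power p i) (s i))"
      using cls[OF i] least_power_intertwine[of q s p i, OF qs permutes_inj[OF s]]
        by (simp add: cycle_class_def)
    then show ?thesis using conj_class_eq_iff[OF Ac[OF i] Bc[OF i]] by blast
  qed
  then obtain u where uc: "\<And>i. i \<in> {1..n} \<Longrightarrow> u i \<in> carrier G"
    and u: "\<And>i. i \<in> {1..n} \<Longrightarrow> cycle_prod b q (least_power p i) (s i) \<otimes> u i =
      u i \<otimes> cycle_prod a p (least_power p i) i"
    by metis
  \<comment> \<open>\<open>u r\<close> transported \<open>k\<close> steps along the cycle from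
    \<open>r\<close>: the value forced upon the conjugating element at
    \<open>s ((p ^^ k) r)\<close>.\<close>
  define D where "D k r = cycle_prod b q k (s r) \<otimes> u r \<otimes> inv (cycle_prod a p k r)" for k r
  have Dc: "D k r \<in> carrier G" if "r \<in> {1..n}" for k r
    using that uc Ac Bc by (simp add: D_def)
  have D_Suc: "D (Suc k) r = b (s (p ((p ^^ k) r))) \<otimes> D k r \<otimes> inv (a (p ((p ^^ k) r)))"
    if r: "r \<in> {1..n}" for k r
    using a[OF p_in[OF r, of "Suc k"]] b[OF s_in[OF p_in[OF r, of "Suc k"]]] uc[OF r] Ac[OF r, of k]
      Bc[OF r, of k]
      funpow_intertwine[of q s p, OF qs, of "Suc k" r]
    by (simp add: D_def m_assoc inv_mult_group)
  \<comment> \<open>A full turn changes nothing because \<open>u r\<close> conjugates the two cycle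
    products into each other.\<close>
  have D_period: "D (k + least_power p r) r = D k r" if r: "r \<in> {1..n}" for k r
  proof -
    let ?m = "least_power p r"
    have pm: "(p ^^ ?m) r = r" by (rule least_power_of_permutation(1)[OF p(2)])
    have "cycle_prod a p (k + ?m) r = cycle_prod a p k r \<otimes> cycle_prod a p ?m r"
      using cycle_prod_add[OF a p(1) r] pm by simp
    moreover have "cycle_prod b q (k + ?m) (s r) = cycle_prod b q k (s r) \<otimes> cycle_prod b q ?m (s r)"
      using cycle_prod_add[OF b q s_in[OF r]] funpow_intertwine[of q s p, OF qs, of ?m r] pm by simp
    ultimately have "D (k + ?m) r = cycle_prod b q k (s r) \<otimes> (cycle_prod b q ?m (s r) \<otimes> u r)
        \<otimes> (inv (cycle_prod a p ?m r) \<otimes> inv (cycle_prod a p k r))"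
      using Ac[OF r] Bc[OF r] uc[OF r] by (simp add: D_def m_assoc inv_mult_group)
    also have "\<dots> = D k r"
      unfolding u[OF r] using Ac[OF r] Bc[OF r] uc[OF r] by (simp add: D_def m_assoc)
    finally show ?thesis .
  qed
  have D_period_mult: "D (k + least_power p r * l) r = D k r" if r: "r \<in> {1..n}" for k r l
  proof (induction l)
    case (Suc l)
    have "k + least_power p r * Suc l = (k + least_power p r * l) + least_power p r" by simp
    then show ?case using D_period[OF r] Suc by metis
  qed simp
  \<comment> \<open>Two numbers of steps leading to the same point differ by a multiple of the cycle
    length.\<close>
  have D_unique_le: "D k r = D l r" if r: "r \<in> {1..n}" and eq: "(p ^^ k) r = (p ^^ l) r"
    and kl: "k \<le> l" for k l r
  proof -
    have "(p ^^ (l - k)) r = r"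
      using funpow_diff[OF permutes_inj[OF p(1)] kl] eq by simp
    then have "least_power p r dvd l - k" by (rule least_power_minimal)
    then obtain t where "l - k = least_power p r * t" by blast
    then have "l = k + least_power p r * t" using kl by simp
    then show ?thesis using D_period_mult[OF r] by simp
  qed
  have D_unique: "D k r = D l r" if "r \<in> {1..n}" "(p ^^ k) r = (p ^^ l) r" for k l r
  proof (cases "k \<le> l")
    case False
    then show ?thesis by (intro D_unique_le[OF that(1) that(2)[symmetric], symmetric]) simp
  qed (rule D_unique_le[OF that])
  obtain t where t: "\<And>i. (p ^^ t i) (orbit_root p i) = i" using orbit_root_reaches[OF p(2)] by metis
  have root_in: "orbit_root p i \<in> {1..n}" if "i \<in> {1..n}" for i
    using orbit_root_in[of p i] p_in[OF that] by (auto simp: orbit_of_def)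
  \<comment> \<open>\<open>t i\<close> is some number of steps from the root of the cycle to
    \<open>i\<close>; by \<open>D_unique\<close> another such number gives the same value.\<close>
  define d where "d i = D (t i) (orbit_root p i)" for i
  have dc: "d i \<in> carrier G" if "i \<in> {1..n}" for i using Dc root_in[OF that] by (simp add: d_def)
  have d_step: "b (s (p i)) \<otimes> d i = d (p i) \<otimes> a (p i)" if i: "i \<in> {1..n}" for i
  proof -
    let ?r = "orbit_root p i"
    have pi: "p i \<in> {1..n}" using p_in[OF i, of 1] by simp
    have "p i \<in> orbit_of p i" unfolding orbit_of_def by (rule range_eqI[of _ _ 1]) simp
    then have "orbit_root p (p i) = ?r" by (rule orbit_root_eq[OF p(2)])
    then have "d (p i) = D (t (p i)) ?r" and "(p ^^ t (p i)) ?r = (p ^^ Suc (t i)) ?r"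
      using t[of i] t[of "p i"] by (simp_all add: d_def)
    then have "d (p i) = D (Suc (t i)) ?r" using D_unique[OF root_in[OF i]] by metis
    also have "\<dots> = b (s (p i)) \<otimes> d i \<otimes> inv (a (p i))"
      using D_Suc[OF root_in[OF i], of "t i"] t[of i] by (simp add: d_def)
    finally show ?thesis using a[OF pi] b[OF s_in[OF pi]] dc[OF i] by (simp add: m_assoc)
  qed
  define c where "c = (\<lambda>j\<in>{1..n}. d (inv_into UNIV s j))"
  have cs: "c (s i) = d i" if "i \<in> {1..n}" for i
    using s_in[OF that] permutes_inverses(2)[OF s] by (simp add: c_def)
  have "(c, s) \<in> carrier (sym_wreath G n)"
    using s dc permutes_inv_in[OF s] by (auto simp: carrier_wreath c_def)
  moreover have "y \<otimes>\<^bsub>sym_wreath G n\<^esub> (c, s) = (c, s) \<otimes>\<^bsub>sym_wreath G n\<^esub> x"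
  proof -
    have "b (s (p i)) \<otimes> c (s i) = c (s (p i)) \<otimes> a (p i)" if i: "i \<in> {1..n}" for i
      using d_step[OF i] cs[OF i] cs[OF p_in[OF i, of 1]] by simp
    with qs have "(b, q) \<otimes>\<^bsub>sym_wreath G n\<^esub> (c, s) = (c, s) \<otimes>\<^bsub>sym_wreath G n\<^esub> (a, p)"
      unfolding wreath_intertwine_iff[OF p(1) q s] by (intro conjI allI ballI)
    then show ?thesis by simp
  qed
  ultimately show ?thesis by blast
qed

text \<open>Each cycle carries a representative of the required class at its root and trivial
  entries elsewhere, so the cycle product from the root is that representative. Invariance of
  \<open>f\<close> under \<open>p\<close> takes care of the other points.\<close>

lemma cycle_class_surj:
  assumes p: "p permutes {1..n}" and f: "\<And>i. i \<in> {1..n} \<Longrightarrow> f i \<in> conj_classes G"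
    and fp: "\<And>i. i \<in> {1..n} \<Longrightarrow> f (p i) = f i"
  shows "\<exists>x\<in>carrier (sym_wreath G n). snd x = p \<and> (\<forall>i\<in>{1..n}. cycle_class x i = f i)"
proof -
  have perm: "permutation p" using p by (auto simp: permutation_permutes)
  have "\<exists>z. z \<in> carrier G \<and> conj_class G z = f i" if "i \<in> {1..n}" for i
    using f[OF that] by (auto simp: conj_classes_def)
  then obtain z where z: "\<And>i. i \<in> {1..n} \<Longrightarrow> z i \<in> carrier G" "\<And>i. i \<in> {1..n} \<Longrightarrow>
    conj_class G (z i) = f i" by metis
  define a where "a = (\<lambda>i\<in>{1..n}. if orbit_root p i = i then z i else \<one>)"
  have ac: "a i \<in> carrier G" if "i \<in> {1..n}" for i using that z by (auto simp: a_def)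
  define x where "x = (a, p)"
  have x: "x \<in> carrier (sym_wreath G n)" using ac p by (auto simp: x_def carrier_wreath a_def)
  have p_in: "(p ^^ k) i \<in> {1..n}" if "i \<in> {1..n}" for i k using permutes_funpow_in[OF p] that
    by blast
  have cls_root: "cycle_class x r = f r" if r: "r \<in> {1..n}" and root: "orbit_root p r = r" for r
  proof -
    let ?m = "least_power p r"
    have m: "(p ^^ ?m) r = r" "?m > 0" using least_power_of_permutation[OF perm] by auto
    \<comment> \<open>Starting from the root, the root is met again only at the last step, so all
      earlier factors are trivial.\<close>
    have one: "cycle_prod a p k r = \<one>" if "k < ?m" for k
      using that
    proof (induction k)
      case (Suc k)
      have "(p ^^ Suc k) r \<in> orbit_of p r" unfolding orbit_of_def by (rule rangeI)
      then have "orbit_root p ((p ^^ Suc k) r) = r" using orbit_root_eq[OF perm] root by metis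
      moreover have "(p ^^ Suc k) r \<noteq> r" using least_power_le[of "Suc k" p r] Suc.prems by auto
      ultimately have "a ((p ^^ Suc k) r) = \<one>" using p_in[OF r, of "Suc k"]
        by (simp add: a_def del: funpow.simps)
      then show ?case using Suc by (simp del: funpow.simps)
    qed simp
    obtain k where k: "?m = Suc k" using m(2) by (cases ?m) auto
    have "a ((p ^^ Suc k) r) = z r" using m(1) r root unfolding k
      by (simp add: a_def del: funpow.simps)
    then have "cycle_prod a p ?m r = z r" using one[of k] z(1)[OF r] unfolding k
      by (simp del: funpow.simps)
    then show ?thesis using z(2)[OF r] by (simp add: cycle_class_def x_def)
  qed
  have f_pow: "f ((p ^^ k) i) = f i" if "i \<in> {1..n}" for i k
    by (induction k) (use fp p_in[OF that] in auto)
  have "cycle_class x i = f i" if i: "i \<in> {1..n}" for i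
  proof -
    let ?r = "orbit_root p i"
    have r: "?r \<in> {1..n}" using orbit_root_in[of p i] p_in[OF i] by (auto simp: orbit_of_def)
    have "orbit_root p ?r = ?r" by (rule orbit_root_eq[OF perm orbit_root_in])
    from cls_root[OF r this] have "cycle_class x ?r = f ?r" .
    moreover obtain k where "(p ^^ k) ?r = i" using orbit_root_reaches[OF perm] by blast
    ultimately show ?thesis using cycle_class_orbit[OF x r, of k] f_pow[OF r, of k]
      by (simp add: x_def)
  qed
  then show ?thesis using x by (intro bexI[of _ x]) (auto simp: x_def)
qed

end

section \<open>Counting the conjugacy classes of a wreath product\<close>

lemma (in group) conj_class_iff:
  assumes "x \<in> carrier G"
  shows "y \<in> conj_class G x \<longleftrightarrow> y \<in> carrier G \<and> (\<exists>g\<in>carrier G. y \<otimes> g = g \<otimes> x)"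
proof
  assume y: "y \<in> conj_class G x"
  then have yc: "y \<in> carrier G" by (rule conj_class_closed[OF assms])
  have "conj_class G x = conj_class G y"
    using conj_class_subset[OF assms y] conj_class_subset[OF yc conj_class_sym[OF assms y]] by simp
  with yc show "y \<in> carrier G \<and> (\<exists>g\<in>carrier G. y \<otimes> g = g \<otimes> x)" using conj_class_eq_iff[OF assms yc]
    by simp
next
  assume "y \<in> carrier G \<and> (\<exists>g\<in>carrier G. y \<otimes> g = g \<otimes> x)"
  then have "y \<in> carrier G" "conj_class G x = conj_class G y" using conj_class_eq_iff[OF assms]
    by auto
  then show "y \<in> conj_class G x" using conj_class_self by simp
qed

text \<open>
  The isomorphism type of a permutation of an arbitrary finite set, as the conjugacy class of its
  copies in the symmetric group.
\<close>

definition perm_type :: "'b set \<Rightarrow> ('b \<Rightarrow> 'b) \<Rightarrow> (nat \<Rightarrow> nat) set" where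
  "perm_type A p = {\<sigma>. \<sigma> permutes {1..card A} \<and>
     (\<exists>h. bij_betw h {1..card A} A \<and> (\<forall>i\<in>{1..card A}. h (\<sigma> i) = p (h i)))}"

lemma finite_inj_endo_bij:
  assumes "finite S" "inj_on s S" "\<And>i. i \<in> S \<Longrightarrow> s i \<in> S"
  shows "bij_betw s S S"
  using endo_inj_surj[of S s] assms by (simp add: bij_betw_def image_subset_iff)

lemma bij_betw_extend_permutes:
  assumes "bij_betw g S S"
  shows "(\<lambda>i. if i \<in> S then g i else i) permutes S"
  by (rule bij_imp_permutes) (use assms in \<open>auto cong: bij_betw_cong\<close>)

text \<open>Two labellings of \<open>A\<close> by \<open>{1..card A}\<close> differ by a
  permutation, and this permutation conjugates the corresponding copies of \<open>p\<close>.\<close>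

lemma perm_type_eq_conj_class:
  assumes h: "bij_betw h {1..card A} A" and \<sigma>: "\<sigma> permutes {1..card A}"
    and eq: "\<And>i. i \<in> {1..card A} \<Longrightarrow> h (\<sigma> i) = p (h i)"
  shows "perm_type A p = conj_class (sym_group (card A)) \<sigma>"
proof -
  define I where "I = {1..card A}"
  interpret S: group "sym_group (card A)" by (rule sym_group_is_group)
  have \<sigma>c: "\<sigma> \<in> carrier (sym_group (card A))" using \<sigma> by (simp add: sym_group_carrier)
  have "\<tau> \<in> perm_type A p \<longleftrightarrow> \<tau> \<in> conj_class (sym_group (card A)) \<sigma>" for \<tau>
  proof
    assume "\<tau> \<in> perm_type A p"
    then obtain h' where \<tau>: "\<tau> permutes I" and h': "bij_betw h' I A"
      and eq': "\<And>i. i \<in> I \<Longrightarrow> h' (\<tau> i) = p (h' i)"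
      by (auto simp: perm_type_def I_def)
    define g where "g i = (if i \<in> I then inv_into I h' (h i) else i)" for i
    have "bij_betw (\<lambda>i. inv_into I h' (h i)) I I"
      using bij_betw_trans[OF h[folded I_def] bij_betw_inv_into[OF h']] by (simp add: comp_def)
    from bij_betw_extend_permutes[OF this] have g: "g permutes I" by (simp add: g_def[abs_def])
    have h'g: "h' (g i) = h i" if "i \<in> I" for i
      using that bij_betw_inv_into_right[OF h'] bij_betwE[OF h] by (simp add: g_def I_def)
    have "\<tau> (g i) = g (\<sigma> i)" for i
    proof (cases "i \<in> I")
      case True
      have in_I: "g i \<in> I" "\<sigma> i \<in> I" "\<tau> (g i) \<in> I" "g (\<sigma> i) \<in> I"
        using True permutes_in_image[OF g] permutes_in_image[OF \<sigma>] permutes_in_image[OF \<tau>]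
          by (auto simp: I_def)
      have "h' (\<tau> (g i)) = h' (g (\<sigma> i))"
        using eq'[OF in_I(1)] h'g[OF True] h'g[OF in_I(2)] eq[of i] True by (simp add: I_def)
      then show ?thesis using h' in_I by (auto simp: bij_betw_def inj_on_def)
    next
      case False
      then show ?thesis using permutes_not_in[OF \<sigma>] permutes_not_in[OF \<tau>] permutes_not_in[OF g]
        by (simp add: I_def)
    qed
    then have "\<tau> \<otimes>\<^bsub>sym_group (card A)\<^esub> g = g \<otimes>\<^bsub>sym_group (card A)\<^esub> \<sigma>" by (auto simp: sym_group_mult)
    then show "\<tau> \<in> conj_class (sym_group (card A)) \<sigma>"
      using \<tau> g unfolding S.conj_class_iff[OF \<sigma>c] by (auto simp: sym_group_carrier I_def)
  next
    assume "\<tau> \<in> conj_class (sym_group (card A)) \<sigma>"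
    then obtain g where \<tau>: "\<tau> permutes I" and g: "g permutes I" and \<tau>g: "\<tau> \<circ> g = g \<circ> \<sigma>"
      unfolding S.conj_class_iff[OF \<sigma>c] by (auto simp: sym_group_carrier sym_group_mult I_def)
    define h' where "h' = h \<circ> inv_into UNIV g"
    have "bij_betw (inv_into UNIV g) I I" using permutes_inv[OF g] by (rule permutes_imp_bij)
    then have "bij_betw h' I A" unfolding h'_def using h unfolding I_def[symmetric]
      by (rule bij_betw_trans)
    moreover have "h' (\<tau> i) = p (h' i)" if "i \<in> I" for i
    proof -
      define j where "j = inv_into UNIV g i"
      have j: "j \<in> I" "i = g j" using that permutes_inv_in[OF g] permutes_inverses(1)[OF g]
        by (auto simp: j_def)
      have "\<tau> i = g (\<sigma> j)" using \<tau>g j by (auto simp: fun_eq_iff)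
      then show ?thesis using eq[of j] j permutes_inverses(2)[OF g] by (simp add: h'_def I_def)
    qed
    ultimately show "\<tau> \<in> perm_type A p" using \<tau> by (auto simp: perm_type_def I_def)
  qed
  then show ?thesis by blast
qed

lemma perm_type_witness:
  assumes A: "finite A" and p: "bij_betw p A A"
  obtains h \<sigma> where "bij_betw h {1..card A} A" "\<sigma> permutes {1..card A}"
    "\<And>i. i \<in> {1..card A} \<Longrightarrow> h (\<sigma> i) = p (h i)"
proof -
  define I where "I = {1..card A}"
  obtain h where h: "bij_betw h I A" using ex_bij_betw_nat_finite_1[OF A] unfolding I_def by blast
  define \<sigma> where "\<sigma> i = (if i \<in> I then (inv_into I h \<circ> (p \<circ> h)) i else i)" for i
  have "bij_betw (inv_into I h \<circ> (p \<circ> h)) I I"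
    using bij_betw_trans[OF h p] bij_betw_inv_into[OF h] by (rule bij_betw_trans)
  then have "\<sigma> permutes I" unfolding \<sigma>_def[abs_def] by (rule bij_betw_extend_permutes)
  moreover have "h (\<sigma> i) = p (h i)" if "i \<in> I" for i
  proof -
    have "p (h i) \<in> A" using bij_betwE[OF h] bij_betwE[OF p] that by blast
    then show ?thesis using that bij_betw_inv_into_right[OF h] by (simp add: \<sigma>_def)
  qed
  ultimately show thesis using that h unfolding I_def by blast
qed

lemma perm_type_in_conj_classes:
  assumes "finite A" "bij_betw p A A"
  shows "perm_type A p \<in> conj_classes (sym_group (card A))"
  using assms
proof (rule perm_type_witness)
  fix h \<sigma> assume "bij_betw h {1..card A} A" "\<sigma> permutes {1..card A}" "\<And>i. i \<in> {1..card A} \<Longrightarrow>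
    h (\<sigma> i) = p (h i)"
  then show ?thesis using perm_type_eq_conj_class[of h A \<sigma> p]
    by (simp add: conj_classes_def sym_group_carrier)
qed

text \<open>A permutation belonging to both types comes with a labelling of \<open>A\<close> and a
  labelling of \<open>B\<close>; one composed with the inverse of the other intertwines
  \<open>p\<close> and \<open>q\<close>.\<close>

lemma perm_type_eq_imp:
  assumes A: "finite A" "bij_betw p A A" and B: "card A = card B"
    and eq: "perm_type A p = perm_type B q"
  shows "\<exists>s. bij_betw s A B \<and> (\<forall>i\<in>A. s (p i) = q (s i))"
proof -
  define I where "I = {1..card A}"
  obtain h \<sigma> where h: "bij_betw h I A" and \<sigma>: "\<sigma> permutes I"
    and eqA: "\<And>i. i \<in> I \<Longrightarrow> h (\<sigma> i) = p (h i)"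
    using perm_type_witness[OF A] unfolding I_def by blast
  then have "\<sigma> \<in> perm_type A p" by (auto simp: perm_type_def I_def)
  then have "\<sigma> \<in> perm_type B q" by (simp only: eq)
  then obtain h' where h': "bij_betw h' I B" and eqB: "\<And>i. i \<in> I \<Longrightarrow> h' (\<sigma> i) = q (h' i)"
    by (auto simp: perm_type_def I_def B)
  define s where "s = h' \<circ> inv_into I h"
  have "bij_betw s A B" unfolding s_def using bij_betw_inv_into[OF h] h' by (rule bij_betw_trans)
  moreover have "s (p i) = q (s i)" if "i \<in> A" for i
  proof -
    define j where "j = inv_into I h i"
    have j: "j \<in> I" "h j = i"
      using bij_betwE[OF bij_betw_inv_into[OF h]] bij_betw_inv_into_right[OF h] that
        by (auto simp: j_def)
    have "\<sigma> j \<in> I" using permutes_in_image[OF \<sigma>] j by simp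
    then have "s (p i) = h' (\<sigma> j)" using eqA[OF j(1)] j bij_betw_inv_into_left[OF h]
      by (metis comp_apply s_def)
    also have "\<dots> = q (s i)" using eqB[OF j(1)] by (simp add: s_def j_def)
    finally show ?thesis .
  qed
  ultimately show ?thesis by blast
qed

lemma perm_type_intertwine:
  assumes A: "finite A" "bij_betw p A A" and s: "bij_betw s A B"
    and eq: "\<And>i. i \<in> A \<Longrightarrow> s (p i) = q (s i)"
  shows "perm_type A p = perm_type B q"
proof -
  have card: "card B = card A" using bij_betw_same_card[OF s] by simp
  obtain h \<sigma> where h: "bij_betw h {1..card A} A" and \<sigma>: "\<sigma> permutes {1..card A}"
    and eqA: "\<And>i. i \<in> {1..card A} \<Longrightarrow> h (\<sigma> i) = p (h i)"
    using perm_type_witness[OF A] by blast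
  have "bij_betw (s \<circ> h) {1..card B} B" unfolding card using h s by (rule bij_betw_trans)
  moreover have "(s \<circ> h) (\<sigma> i) = q ((s \<circ> h) i)" if "i \<in> {1..card B}" for i
    using eqA[of i] eq[of "h i"] bij_betwE[OF h] that by (simp add: card)
  ultimately have "perm_type B q = conj_class (sym_group (card B)) \<sigma>"
    using \<sigma> by (intro perm_type_eq_conj_class[of "s \<circ> h"]) (simp_all add: card)
  then show ?thesis using perm_type_eq_conj_class[OF h \<sigma> eqA] by (simp add: card)
qed

section \<open>Weak compositions, with zero parts for colours that do not occur\<close>

definition compositions :: "'c set \<Rightarrow> nat \<Rightarrow> ('c \<Rightarrow> nat) set" where
  "compositions C n = {m \<in> C \<rightarrow>\<^sub>E UNIV. sum m C = n}"

lemma finite_compositions: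
  assumes "finite C"
  shows "finite (compositions C n)"
proof (rule finite_subset)
  show "compositions C n \<subseteq> C \<rightarrow>\<^sub>E {..n}"
  proof
    fix m assume m: "m \<in> compositions C n"
    have "m c \<le> n" if "c \<in> C" for c
      using member_le_sum[of c C m] m that assms by (simp add: compositions_def)
    then show "m \<in> C \<rightarrow>\<^sub>E {..n}" using m by (auto simp: compositions_def)
  qed
  show "finite (C \<rightarrow>\<^sub>E {..n})" using assms by (intro finite_PiE) auto
qed

text \<open>The first component of \<open>e\<close> is a map on \<open>{1..n}\<close> whose fibre
  sizes are the prescribed numbers \<open>m c\<close>.\<close>

lemma compositions_fibres:
  assumes "finite C" "m \<in> compositions C n"
  obtains e where "bij_betw e {1..n} (SIGMA c:C. {1..m c})"
proof -
  have "card (SIGMA c:C. {1..m c}) = n" using assms by (simp add: compositions_def)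
  moreover have "finite (SIGMA c:C. {1..m c})" using assms by auto
  ultimately show thesis using ex_bij_betw_nat_finite_1 that by metis
qed

lemma fibre_cards_in_compositions:
  assumes "finite A" "finite C" "f ` A \<subseteq> C"
  shows "(\<lambda>c\<in>C. card {i \<in> A. f i = c}) \<in> compositions C (card A)"
proof -
  have "(\<Sum>c\<in>C. card {i \<in> A. f i = c}) = card A"
    using sum.group[OF assms, of "\<lambda>_. 1 :: nat"] by simp
  then show ?thesis by (simp add: compositions_def)
qed

text \<open>For finite \<open>C\<close> this is the coefficient of \<open>t^n\<close> in the
  \<open>card C\<close>-th power of the generating function of the partition numbers, since the
  conjugacy classes of \<open>sym_group m\<close> correspond to the partitions of
  \<open>m\<close>.\<close>

definition coloured_class_count :: "'c set \<Rightarrow> nat \<Rightarrow> nat" where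
  "coloured_class_count C n = (\<Sum>m\<in>compositions C n. \<Prod>c\<in>C. card (conj_classes (sym_group (m c))))"

text \<open>This is what allows the recursions of the two sides to be compared although their
  colours are objects of different kinds.\<close>

lemma coloured_class_count_bij:
  assumes h: "bij_betw h C D"
  shows "coloured_class_count C n = coloured_class_count D n"
proof -
  have "bij_betw (\<lambda>m. \<lambda>c\<in>C. m (h c)) (compositions D n) (compositions C n)"
  proof (rule bij_betw_byWitness[where f' = "\<lambda>m. \<lambda>d\<in>D. m (inv_into C h d)"])
    note hC = bij_betwE[OF h] and hD = bij_betwE[OF bij_betw_inv_into[OF h]]
    show "\<forall>m\<in>compositions D n. (\<lambda>d\<in>D. (\<lambda>c\<in>C. m (h c)) (inv_into C h d)) = m"
      using hD bij_betw_inv_into_right[OF h]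
        by (auto simp: compositions_def fun_eq_iff PiE_def extensional_def)
    show "\<forall>m\<in>compositions C n. (\<lambda>c\<in>C. (\<lambda>d\<in>D. m (inv_into C h d)) (h c)) = m"
      using hC bij_betw_inv_into_left[OF h]
        by (auto simp: compositions_def fun_eq_iff PiE_def extensional_def)
    show "(\<lambda>m. \<lambda>c\<in>C. m (h c)) ` compositions D n \<subseteq> compositions C n"
      using sum.reindex_bij_betw[OF h] by (auto simp: compositions_def)
    show "(\<lambda>m. \<lambda>d\<in>D. m (inv_into C h d)) ` compositions C n \<subseteq> compositions D n"
      using sum.reindex_bij_betw[OF bij_betw_inv_into[OF h]] by (auto simp: compositions_def)
  qed
  from sum.reindex_bij_betw[OF this, of "\<lambda>m. \<Prod>c\<in>C. card (conj_classes (sym_group (m c)))"]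
  have "coloured_class_count C n = (\<Sum>m\<in>compositions D n. \<Prod>c\<in>C. card (conj_classes (sym_group ((\<lambda>c\<in>C.
    m (h c)) c))))"
    by (simp add: coloured_class_count_def)
  also have "\<dots> = (\<Sum>m\<in>compositions D n. \<Prod>c\<in>C. card (conj_classes (sym_group (m (h c)))))"
    by (intro sum.cong prod.cong) auto
  also have "\<dots> = coloured_class_count D n" unfolding coloured_class_count_def
    by (intro sum.cong refl prod.reindex_bij_betw[OF h, of "\<lambda>d.
      card (conj_classes (sym_group (_ d)))"])
  finally show ?thesis .
qed

section \<open>The type of an element of a wreath product as a complete invariant of
  conjugacy\<close>

context group
begin

definition colour_fibre :: "nat \<Rightarrow> (nat \<Rightarrow> 'a) \<times> (nat \<Rightarrow> nat) \<Rightarrow> 'a set \<Rightarrow> nat set" where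
  "colour_fibre n x C = {i \<in> {1..n}. cycle_class x i = C}"

lemma finite_colour_fibre [simp]: "finite (colour_fibre n x C)"
  by (simp add: colour_fibre_def)

lemma colour_fibre_bij:
  assumes x: "x \<in> carrier (sym_wreath G n)"
  shows "bij_betw (snd x) (colour_fibre n x C) (colour_fibre n x C)"
proof -
  obtain a p where [simp]: "x = (a, p)" and p: "p permutes {1..n}"
    using wreath_cases[OF x] by metis
  have "p ` colour_fibre n x C \<subseteq> colour_fibre n x C"
  proof
    fix j assume "j \<in> p ` colour_fibre n x C"
    then obtain i where i: "i \<in> {1..n}" "cycle_class x i = C" "j = p i"
      by (auto simp: colour_fibre_def)
    then have "j \<in> {1..n}" using permutes_in_image[OF p] by blast
    then show "j \<in> colour_fibre n x C" using cycle_class_orbit[OF x i(1), of 1] i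
      by (simp add: colour_fibre_def)
  qed
  moreover have "inj_on p (colour_fibre n x C)" using permutes_inj[OF p]
    by (rule inj_on_subset) simp
  ultimately show ?thesis using endo_inj_surj[of "colour_fibre n x C" p] by (simp add: bij_betw_def)
qed

text \<open>Sizes and permutation types are kept in two separate functions so that the image is a
  disjoint union over \<open>compositions\<close>.\<close>

definition wreath_type :: "nat \<Rightarrow> (nat \<Rightarrow> 'a) \<times> (nat \<Rightarrow> nat) \<Rightarrow> ('a set \<Rightarrow> nat) \<times> ('a set \<Rightarrow> (nat \<Rightarrow> nat)
  set)" where
  "wreath_type n x = (\<lambda>C\<in>conj_classes G. card (colour_fibre n x C),
     \<lambda>C\<in>conj_classes G. perm_type (colour_fibre n x C) (snd x))"

text \<open>If the types agree, bijections between colour fibres are glued to a permutation that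
  intertwines and preserves cycle classes, and \<open>wreath_conjugate\<close> lifts it. Conversely,
  the permutation part of a conjugating element maps colour fibres to colour fibres.\<close>

lemma wreath_type_eq_iff:
  assumes x: "x \<in> carrier (sym_wreath G n)" and y: "y \<in> carrier (sym_wreath G n)"
  shows "wreath_type n x = wreath_type n y \<longleftrightarrow> (\<exists>g\<in>carrier (sym_wreath G n).
    y \<otimes>\<^bsub>sym_wreath G n\<^esub> g = g \<otimes>\<^bsub>sym_wreath G n\<^esub> x)"
proof -
  obtain a p where [simp]: "x = (a, p)" and p: "p permutes {1..n}" using wreath_cases[OF x] by metis
  obtain b q where [simp]: "y = (b, q)" and q: "q permutes {1..n}" using wreath_cases[OF y] by metis
  have type_iff: "wreath_type n x = wreath_type n y \<longleftrightarrow> (\<forall>C\<in>conj_classes G.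
    card (colour_fibre n x C) = card (colour_fibre n y C) \<and>
    perm_type (colour_fibre n x C) p = perm_type (colour_fibre n y C) q)"
    by (auto simp: wreath_type_def restrict_eq_iff)
  show ?thesis
  proof
    assume eq: "wreath_type n x = wreath_type n y"
    have "\<exists>s. bij_betw s (colour_fibre n x C) (colour_fibre n y C) \<and>
        (\<forall>i\<in>colour_fibre n x C. s (p i) = q (s i))" if C: "C \<in> conj_classes G" for C
    proof (rule perm_type_eq_imp)
      show "bij_betw p (colour_fibre n x C) (colour_fibre n x C)" using colour_fibre_bij[OF x]
        by simp
    qed (use eq[unfolded type_iff] C in simp_all)
    then obtain S where S: "\<And>C. C \<in> conj_classes G \<Longrightarrow>
      bij_betw (S C) (colour_fibre n x C) (colour_fibre n y C)"
      and Sp: "\<And>C i. C \<in> conj_classes G \<Longrightarrow> i \<in> colour_fibre n x C \<Longrightarrow> S C (p i) = q (S C i)" by metis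
    \<comment> \<open>The bijections on the fibres are glued, with the identity outside
      \<open>{1..n}\<close> as \<open>permutes\<close> demands.\<close>
    define s where "s i = (if i \<in> {1..n} then S (cycle_class x i) i else i)" for i
    have fib: "i \<in> colour_fibre n x (cycle_class x i)" if "i \<in> {1..n}" for i using that
      by (simp add: colour_fibre_def)
    have s_fib: "s i \<in> colour_fibre n y (cycle_class x i)" if i: "i \<in> {1..n}" for i
      using bij_betwE[OF S[OF cycle_class_in[OF x i]]] fib[OF i] i by (simp add: s_def)
    have s_in: "s i \<in> {1..n}" and s_cls: "cycle_class y (s i) = cycle_class x i" if "i \<in> {1..n}"
      for i
      using s_fib[OF that] by (auto simp: colour_fibre_def)
    have "inj_on s {1..n}"
    proof (rule inj_onI)
      fix i j assume ij: "i \<in> {1..n}" "j \<in> {1..n}" "s i = s j"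
      then have cls: "cycle_class x i = cycle_class x j" using s_cls by metis
      then have "S (cycle_class x i) i = S (cycle_class x i) j" using ij by (simp add: s_def)
      moreover have "inj_on (S (cycle_class x i)) (colour_fibre n x (cycle_class x i))"
        using S[OF cycle_class_in[OF x ij(1)]] by (rule bij_betw_imp_inj_on)
      ultimately show "i = j" using fib[OF ij(1)] fib[OF ij(2)] cls by (simp add: inj_on_eq_iff)
    qed
    then have "bij_betw s {1..n} {1..n}" using s_in by (intro finite_inj_endo_bij) simp_all
    then have s: "s permutes {1..n}" by (rule bij_imp_permutes) (auto simp: s_def)
    have qs: "q (s i) = s (p i)" for i
    proof (cases "i \<in> {1..n}")
      case True
      have pi: "p i \<in> {1..n}" using permutes_in_image[OF p] True by blast
      have "cycle_class x (p i) = cycle_class x i" using cycle_class_orbit[OF x True, of 1] by simp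
      then have "s (p i) = S (cycle_class x i) (p i)" using pi by (simp add: s_def)
      also have "\<dots> = q (s i)" using Sp[OF cycle_class_in[OF x True] fib[OF True]] True
        by (simp add: s_def)
      finally show ?thesis by simp
    next
      case False
      then have "s i = i" unfolding s_def by (rule if_not_P)
      then show ?thesis using False permutes_not_in[OF p] permutes_not_in[OF q] by simp
    qed
    show "\<exists>g\<in>carrier (sym_wreath G n).
      y \<otimes>\<^bsub>sym_wreath G n\<^esub> g = g \<otimes>\<^bsub>sym_wreath G n\<^esub> x"
      by (rule wreath_conjugate[OF x y s]) (use qs s_cls in simp_all)
  next
    assume "\<exists>g\<in>carrier (sym_wreath G n).
      y \<otimes>\<^bsub>sym_wreath G n\<^esub> g = g \<otimes>\<^bsub>sym_wreath G n\<^esub> x"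
    then obtain g where g: "g \<in> carrier (sym_wreath G n)"
      and eq: "y \<otimes>\<^bsub>sym_wreath G n\<^esub> g = g \<otimes>\<^bsub>sym_wreath G n\<^esub> x" by blast
    obtain c s where [simp]: "g = (c, s)" and s: "s permutes {1..n}" using wreath_cases[OF g]
      by metis
    have "(\<forall>i. q (s i) = s (p i)) \<and> (\<forall>i\<in>{1..n}. b (s (p i)) \<otimes> c (s i) = c (s (p i)) \<otimes> a (p i))"
      using eq unfolding \<open>x = (a, p)\<close> \<open>y = (b, q)\<close> \<open>g = (c, s)\<close> wreath_intertwine_iff[OF p q s] .
    then have qs: "q (s i) = s (p i)" for i by blast
    have cls: "cycle_class y (s i) = cycle_class x i" if "i \<in> {1..n}" for i
      using cycle_class_intertwine[OF x y g eq that] by simp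
    have bij: "bij_betw s (colour_fibre n x C) (colour_fibre n y C)" for C
      unfolding bij_betw_def
    proof
      show "inj_on s (colour_fibre n x C)" using permutes_inj[OF s] by (rule inj_on_subset) simp
      show "s ` colour_fibre n x C = colour_fibre n y C"
      proof
        show "s ` colour_fibre n x C \<subseteq> colour_fibre n y C"
          using cls permutes_in_image[OF s] by (auto simp: colour_fibre_def)
        show "colour_fibre n y C \<subseteq> s ` colour_fibre n x C"
        proof
          fix j assume j: "j \<in> colour_fibre n y C"
          have "inv_into UNIV s j \<in> {1..n}" using j permutes_inv_in[OF s]
            by (auto simp: colour_fibre_def)
          moreover have sj: "s (inv_into UNIV s j) = j" by (rule permutes_inverses(1)[OF s])
          ultimately have "inv_into UNIV s j \<in> colour_fibre n x C"
            using cls[of "inv_into UNIV s j"] j by (simp add: colour_fibre_def)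
          then show "j \<in> s ` colour_fibre n x C" using sj by (metis imageI)
        qed
      qed
    qed
    have "perm_type (colour_fibre n x C) p = perm_type (colour_fibre n y C) q" for C
      using perm_type_intertwine[OF finite_colour_fibre _ bij] colour_fibre_bij[OF x] qs by simp
    then show "wreath_type n x = wreath_type n y" unfolding type_iff
      using bij_betw_same_card[OF bij] by simp
  qed
qed

end

context finite_group
begin

text \<open>To realise a given pair, \<open>{1..n}\<close> is identified with the disjoint union of
  blocks \<open>{1..m C}\<close>, each block is permuted by a representative of \<open>t C\<close>,
  and \<open>cycle_class_surj\<close> gives the block of \<open>C\<close> the colour
  \<open>C\<close>.\<close>

lemma wreath_type_image:
  "wreath_type n ` carrier (sym_wreath G n) =
    (SIGMA m:compositions (conj_classes G) n. \<Pi>\<^sub>E C\<in>conj_classes G. conj_classes (sym_group (m C)))"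
proof (intro subset_antisym subsetI)
  fix z assume "z \<in> wreath_type n ` carrier (sym_wreath G n)"
  then obtain x where x: "x \<in> carrier (sym_wreath G n)" "z = wreath_type n x" by blast
  have "cycle_class x ` {1..n} \<subseteq> conj_classes G" using cycle_class_in[OF x(1)] by blast
  from fibre_cards_in_compositions[OF _ conj_classes_finite this]
  have "(\<lambda>C\<in>conj_classes G. card (colour_fibre n x C)) \<in> compositions (conj_classes G) n"
    by (simp add: colour_fibre_def)
  moreover have "perm_type (colour_fibre n x C) (snd x) \<in> conj_classes (sym_group (card
    (colour_fibre n x C)))" for C
    using colour_fibre_bij[OF x(1)] by (intro perm_type_in_conj_classes) simp_all
  ultimately show "z \<in> (SIGMA m:compositions (conj_classes G) n. \<Pi>\<^sub>E C\<in>conj_classes G.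
    conj_classes (sym_group (m C)))"
    by (auto simp: x(2) wreath_type_def)
next
  fix z assume "z \<in> (SIGMA m:compositions (conj_classes G) n. \<Pi>\<^sub>E C\<in>conj_classes G.
    conj_classes (sym_group (m C)))"
  then obtain m t where z: "z = (m, t)" and m: "m \<in> compositions (conj_classes G) n"
    and t: "t \<in> (\<Pi>\<^sub>E C\<in>conj_classes G. conj_classes (sym_group (m C)))" by blast
  have "\<exists>\<sigma>. \<sigma> permutes {1..m C} \<and> conj_class (sym_group (m C)) \<sigma> = t C" if "C \<in> conj_classes G"
    for C
    using PiE_mem[OF t that] by (auto simp: conj_classes_def sym_group_carrier)
  then obtain \<sigma> where \<sigma>: "\<And>C. C \<in> conj_classes G \<Longrightarrow> \<sigma> C permutes {1..m C}"
    and \<sigma>t: "\<And>C. C \<in> conj_classes G \<Longrightarrow> conj_class (sym_group (m C)) (\<sigma> C) = t C" by metis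
  define D where "D = (SIGMA C:conj_classes G. {1..m C})"
  obtain e where e: "bij_betw e {1..n} D" unfolding D_def
    using compositions_fibres[OF conj_classes_finite m] .
  define e' where "e' = inv_into {1..n} e"
  have e'_in: "e' d \<in> {1..n}" and ee': "e (e' d) = d" if "d \<in> D" for d
    using bij_betwE[OF bij_betw_inv_into[OF e]] bij_betw_inv_into_right[OF e] that
      by (auto simp: e'_def)
  have e_in: "e i \<in> D" and e'e: "e' (e i) = i" if "i \<in> {1..n}" for i
    using bij_betwE[OF e] bij_betw_inv_into_left[OF e] that by (auto simp: e'_def)
  have D_iff: "(C, j) \<in> D \<longleftrightarrow> C \<in> conj_classes G \<and> j \<in> {1..m C}" for C j by (auto simp: D_def)
  have \<sigma>D: "(C, \<sigma> C j) \<in> D" if "(C, j) \<in> D" for C j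
    using that permutes_in_image[OF \<sigma>] unfolding D_iff by blast
  \<comment> \<open>\<open>p\<close> preserves each block, so the colouring by
    \<open>fst (e i)\<close> is invariant, as \<open>cycle_class_surj\<close> requires.\<close>
  define p where "p i = (if i \<in> {1..n} then e' (fst (e i), \<sigma> (fst (e i)) (snd (e i))) else i)" for i
  have p_e': "p (e' (C, j)) = e' (C, \<sigma> C j)" if "(C, j) \<in> D" for C j
    using e'_in[OF that] ee'[OF that] by (simp add: p_def)
  have p_in: "p i \<in> {1..n}" and fst_p: "fst (e (p i)) = fst (e i)" if i: "i \<in> {1..n}" for i
  proof -
    have "(fst (e i), snd (e i)) \<in> D" using e_in[OF i] by simp
    from \<sigma>D[OF this] show "p i \<in> {1..n}" "fst (e (p i)) = fst (e i)" using e'_in ee' i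
      by (simp_all add: p_def)
  qed
  have "inj_on p {1..n}"
  proof (rule inj_onI)
    fix i j assume ij: "i \<in> {1..n}" "j \<in> {1..n}" "p i = p j"
    have ei: "(fst (e i), snd (e i)) \<in> D" "(fst (e j), snd (e j)) \<in> D" using e_in ij by auto
    have "e (p i) = (fst (e i), \<sigma> (fst (e i)) (snd (e i)))" using ee'[OF \<sigma>D[OF ei(1)]] ij(1)
      by (simp add: p_def)
    moreover have "e (p j) = (fst (e j), \<sigma> (fst (e j)) (snd (e j)))"
      using ee'[OF \<sigma>D[OF ei(2)]] ij(2) by (simp add: p_def)
    ultimately have "(fst (e i), \<sigma> (fst (e i)) (snd (e i))) =
      (fst (e j), \<sigma> (fst (e j)) (snd (e j)))"
      using ij(3) by metis
    then have *: "fst (e i) = fst (e j)" "\<sigma> (fst (e i)) (snd (e i)) = \<sigma> (fst (e j)) (snd (e j))"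
      unfolding prod.inject by blast+
    have "fst (e i) \<in> conj_classes G" using e_in[OF ij(1)] by (auto simp: D_def)
    then have "snd (e i) = snd (e j)" using * injD[OF permutes_inj[OF \<sigma>]] by metis
    then have "e i = e j" using * by (simp add: prod_eq_iff)
    then show "i = j" using e'e ij by metis
  qed
  then have "bij_betw p {1..n} {1..n}" using p_in by (intro finite_inj_endo_bij) simp_all
  then have p: "p permutes {1..n}" by (rule bij_imp_permutes) (auto simp: p_def)
  have "fst (e i) \<in> conj_classes G" if "i \<in> {1..n}" for i using e_in[OF that] by (auto simp: D_def)
  from cycle_class_surj[of p n "\<lambda>i. fst (e i)", OF p this fst_p] obtain x
    where x: "x \<in> carrier (sym_wreath G n)"
    and xp: "snd x = p" and cls: "\<And>i. i \<in> {1..n} \<Longrightarrow> cycle_class x i = fst (e i)" by blast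
  have fib: "colour_fibre n x C = {i \<in> {1..n}. fst (e i) = C}" for C using cls
    by (auto simp: colour_fibre_def)
  have bij: "bij_betw (\<lambda>j. e' (C, j)) {1..m C} (colour_fibre n x C)" if C: "C \<in> conj_classes G"
    for C
  proof (rule bij_betw_byWitness[where f' = "\<lambda>i. snd (e i)"])
    show "\<forall>j\<in>{1..m C}. snd (e (e' (C, j))) = j" using ee' C by (auto simp: D_iff)
    show "\<forall>i\<in>colour_fibre n x C. e' (C, snd (e i)) = i" using e'e by (auto simp: fib)
    show "(\<lambda>j. e' (C, j)) ` {1..m C} \<subseteq> colour_fibre n x C" using e'_in ee' C
      unfolding fib D_iff[symmetric]
      by (auto simp: D_iff)
    show "(\<lambda>i. snd (e i)) ` colour_fibre n x C \<subseteq> {1..m C}"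
    proof
      fix j assume "j \<in> (\<lambda>i. snd (e i)) ` colour_fibre n x C"
      then obtain i where "i \<in> {1..n}" "fst (e i) = C" "j = snd (e i)" by (auto simp: fib)
      then have "(C, j) \<in> D" using e_in[of i] by auto
      then show "j \<in> {1..m C}" by (simp add: D_iff)
    qed
  qed
  have card: "card (colour_fibre n x C) = m C" if "C \<in> conj_classes G" for C
    using bij_betw_same_card[OF bij[OF that]] by simp
  have type: "perm_type (colour_fibre n x C) p = t C" if C: "C \<in> conj_classes G" for C
  proof -
    have "perm_type (colour_fibre n x C) p =
      conj_class (sym_group (card (colour_fibre n x C))) (\<sigma> C)"
      by (rule perm_type_eq_conj_class[where h = "\<lambda>j. e' (C, j)"])
        (use bij[OF C] \<sigma>[OF C] p_e' C in \<open>auto simp: card[OF C] D_iff\<close>)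
    then show ?thesis using \<sigma>t[OF C] card[OF C] by simp
  qed
  have "wreath_type n x = z"
  proof -
    have "(\<lambda>C\<in>conj_classes G. card (colour_fibre n x C)) = m"
      using card m by (auto simp: compositions_def fun_eq_iff PiE_def extensional_def)
    moreover have "(\<lambda>C\<in>conj_classes G. perm_type (colour_fibre n x C) p) = t"
      using type t by (auto simp: fun_eq_iff PiE_def extensional_def)
    ultimately show ?thesis by (simp add: wreath_type_def xp z)
  qed
  then show "z \<in> wreath_type n ` carrier (sym_wreath G n)" using x by blast
qed

theorem card_conj_classes_wreath:
  "card (conj_classes (sym_wreath G n)) = coloured_class_count (conj_classes G) n"
proof -
  interpret Wr: group "sym_wreath G n" by (rule group_wreath) (rule group_axioms)
  have fin: "finite (\<Pi>\<^sub>E C\<in>conj_classes G. conj_classes (sym_group (m C)))" for m :: "'a set \<Rightarrow> nat"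
    by (intro finite_PiE) (auto simp: conj_classes_def sym_group_def finite_permutations)
  have "card (conj_classes (sym_wreath G n)) = card (wreath_type n ` carrier (sym_wreath G n))"
    by (rule Wr.card_conj_classes_invariant) (rule wreath_type_eq_iff)
  also have "\<dots> = coloured_class_count (conj_classes G) n"
    unfolding wreath_type_image coloured_class_count_def
    by (subst card_SigmaI) (use finite_compositions[OF conj_classes_finite] fin in \<open>simp_all add: card_PiE\<close>)
  finally show ?thesis .
qed

end

section \<open>Automorphisms of the tree\<close>

lemma Nil_in_tree_verts [simp]: "[] \<in> tree_verts r (Suc k)"
  by (cases k) auto

lemma Cons_in_tree_verts [simp]:
  "i # v \<in> tree_verts r (Suc (Suc k)) \<longleftrightarrow> i \<in> {1..r (Suc (Suc k))} \<and> v \<in> tree_verts r (Suc k)"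
  by auto

lemma finite_tree_verts: "finite (tree_verts r k)"
proof (induction r k rule: tree_verts.induct)
  case (3 r k)
  have "{i # v |i v. i \<in> {1..r (Suc (Suc k))} \<and> v \<in> tree_verts r (Suc k)}
    = (\<lambda>(i, v). i # v) ` ({1..r (Suc (Suc k))} \<times> tree_verts r (Suc k))" by auto
  then show ?case using 3 by simp
qed simp_all

lemma tree_verts_prefix: "v @ w \<in> tree_verts r (Suc k) \<Longrightarrow> v \<in> tree_verts r (Suc k)"
proof (induction k arbitrary: v)
  case 0
  then show ?case by simp
next
  case (Suc k)
  show ?case
  proof (cases v)
    case (Cons i v')
    then show ?thesis using Suc.prems Suc.IH[of v'] by simp
  qed simp
qed

lemma Cons_image_eq_iff: "{i # u, j # v} = (#) a ` e \<longleftrightarrow> i = a \<and> j = a \<and> e = {u, v}"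
proof
  assume eq: "{i # u, j # v} = (#) a ` e"
  then have "i # u \<in> (#) a ` e" "j # v \<in> (#) a ` e" by auto
  then have *: "i = a" "u \<in> e" "j = a" "v \<in> e" by auto
  moreover have "x \<in> {u, v}" if "x \<in> e" for x
  proof -
    have "a # x \<in> {i # u, j # v}" unfolding eq using that by simp
    then show ?thesis by auto
  qed
  ultimately show "i = a \<and> j = a \<and> e = {u, v}" by blast
qed auto

text \<open>The recursive set of edges is traded for the parent relation on paths, in which
  automorphisms are analysed from here on.\<close>

lemma tree_edges_iff:
  assumes "u \<in> tree_verts r (Suc k)" "v \<in> tree_verts r (Suc k)"
  shows "{u, v} \<in> tree_edges r (Suc k) \<longleftrightarrow> (\<exists>j. v = u @ [j]) \<or> (\<exists>j. u = v @ [j])"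
  using assms
proof (induction k arbitrary: u v)
  case 0
  then show ?case by simp
next
  case (Suc k)
  let ?n = "r (Suc (Suc k))"
  have E: "e \<in> tree_edges r (Suc (Suc k)) \<longleftrightarrow>
    (\<exists>i\<in>{1..?n}. e = {[], [i]}) \<or> (\<exists>i\<in>{1..?n}. \<exists>e'\<in>tree_edges r (Suc k). e = (#) i ` e')" for e
    unfolding tree_edges.simps by blast
  have notNil: "[] \<notin> (#) i ` e" for i :: nat and e by auto
  show ?case
  proof (cases u)
    case Nil
    show ?thesis
    proof (cases v)
      case (Cons j w)
      have "{u, v} \<in> tree_edges r (Suc (Suc k)) \<longleftrightarrow> (\<exists>i\<in>{1..?n}. {[], j # w} = {[], [i]})"
        unfolding E Nil Cons using notNil by blast
      also have "\<dots> \<longleftrightarrow> w = []" using Suc.prems Cons by (auto simp: doubleton_eq_iff)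
      finally show ?thesis using Nil Cons by auto
    next
      case Nil2: Nil
      have "{u, v} \<notin> tree_edges r (Suc (Suc k))" unfolding E Nil Nil2 using notNil
        by (auto simp: insert_eq_iff)
      then show ?thesis using Nil Nil2 by simp
    qed
  next
    case Cons1: (Cons i u')
    show ?thesis
    proof (cases v)
      case Nil
      have "{u, v} \<in> tree_edges r (Suc (Suc k)) \<longleftrightarrow> (\<exists>a\<in>{1..?n}. {i # u', []} = {[], [a]})"
        unfolding E Nil Cons1 using notNil by blast
      also have "\<dots> \<longleftrightarrow> u' = []" using Suc.prems Cons1 by (auto simp: doubleton_eq_iff)
      finally show ?thesis using Nil Cons1 by auto
    next
      case (Cons j v')
      have "{u, v} \<in> tree_edges r (Suc (Suc k)) \<longleftrightarrow> i = j \<and> {u', v'} \<in> tree_edges r (Suc k)"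
        unfolding E Cons Cons1 Cons_image_eq_iff using Suc.prems Cons1 Cons
          by (auto simp: doubleton_eq_iff)
      also have "\<dots> \<longleftrightarrow> i = j \<and> ((\<exists>j. v' = u' @ [j]) \<or> (\<exists>j. u' = v' @ [j]))"
        using Suc.IH[of u' v'] Suc.prems Cons Cons1 by simp
      finally show ?thesis using Cons Cons1 by auto
    qed
  qed
qed

section \<open>Rooted automorphisms in terms of parents and children\<close>

lemma tree_aut_verts: "\<sigma> \<in> tree_aut r k \<Longrightarrow> \<sigma> v \<in> tree_verts r k \<longleftrightarrow> v \<in> tree_verts r k"
  by (rule permutes_in_image) (simp add: tree_aut_def)

lemma tree_aut_Nil: "\<sigma> \<in> tree_aut r k \<Longrightarrow> \<sigma> [] = []"
  by (simp add: tree_aut_def)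

lemma tree_aut_inj: "\<sigma> \<in> tree_aut r k \<Longrightarrow> inj \<sigma>"
  using permutes_inj by (auto simp: tree_aut_def)

lemma tree_autI:
  assumes "\<And>v. v \<in> tree_verts r (Suc k) \<Longrightarrow> \<sigma> v \<in> tree_verts r (Suc k)"
    and "inj_on \<sigma> (tree_verts r (Suc k))" "\<And>v. v \<notin> tree_verts r (Suc k) \<Longrightarrow> \<sigma> v = v" "\<sigma> [] = []"
    and "\<And>u v. u \<in> tree_verts r (Suc k) \<Longrightarrow> v \<in> tree_verts r (Suc k) \<Longrightarrow>
      (\<exists>j. v = u @ [j]) \<longleftrightarrow> (\<exists>j. \<sigma> v = \<sigma> u @ [j])"
  shows "\<sigma> \<in> tree_aut r (Suc k)"
  unfolding tree_aut_def
proof (intro CollectI conjI ballI)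
  show "\<sigma> permutes tree_verts r (Suc k)"
    using finite_inj_endo_bij[OF finite_tree_verts assms(2,1)] assms(3) by (rule bij_imp_permutes)
  fix u v assume uv: "u \<in> tree_verts r (Suc k)" "v \<in> tree_verts r (Suc k)"
  show "{u, v} \<in> tree_edges r (Suc k) \<longleftrightarrow> {\<sigma> u, \<sigma> v} \<in> tree_edges r (Suc k)"
    unfolding tree_edges_iff[OF uv] tree_edges_iff[OF assms(1)[OF uv(1)] assms(1)[OF uv(2)]]
    using assms(5)[OF uv] assms(5)[OF uv(2,1)] by simp
qed (rule assms(4))

text \<open>The image of an edge might point upwards; induction on the depth excludes this.
  Otherwise the image of the child would be the parent of \<open>\<sigma> v\<close>, which is
  already the image of the parent of \<open>v\<close>; and at the root there is no parent.\<close>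

lemma tree_aut_child:
  assumes \<sigma>: "\<sigma> \<in> tree_aut r (Suc k)" and v: "v @ [j] \<in> tree_verts r (Suc k)"
  shows "\<exists>j'. \<sigma> (v @ [j]) = \<sigma> v @ [j']"
  using v
proof (induction "length v" arbitrary: v j rule: less_induct)
  case less
  have vv: "v \<in> tree_verts r (Suc k)" using tree_verts_prefix less.prems by blast
  have "{v, v @ [j]} \<in> tree_edges r (Suc k)" using tree_edges_iff[OF vv less.prems] by blast
  then have "{\<sigma> v, \<sigma> (v @ [j])} \<in> tree_edges r (Suc k)" using \<sigma> vv less.prems
    by (auto simp: tree_aut_def)
  then have or: "(\<exists>i. \<sigma> (v @ [j]) = \<sigma> v @ [i]) \<or> (\<exists>i. \<sigma> v = \<sigma> (v @ [j]) @ [i])"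
    using tree_edges_iff[of "\<sigma> v" r k "\<sigma> (v @ [j])"] tree_aut_verts[OF \<sigma>] vv less.prems by blast
  show ?case
  proof (rule ccontr)
    assume "\<not> ?case"
    with or obtain i where i: "\<sigma> v = \<sigma> (v @ [j]) @ [i]" by blast
    then have "v \<noteq> []" using tree_aut_Nil[OF \<sigma>] by auto
    then obtain w l where w: "v = w @ [l]" by (cases v rule: rev_cases) auto
    from less.hyps[of w l] w vv obtain l' where "\<sigma> v = \<sigma> w @ [l']" by auto
    with i have "\<sigma> w = \<sigma> (v @ [j])" by simp
    then have "w = v @ [j]" using tree_aut_inj[OF \<sigma>] by (simp add: inj_eq)
    with w show False by simp
  qed
qed

lemma tree_aut_child_iff:
  assumes \<sigma>: "\<sigma> \<in> tree_aut r (Suc k)" and u: "u \<in> tree_verts r (Suc k)"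
    and v: "v \<in> tree_verts r (Suc k)"
  shows "(\<exists>j. v = u @ [j]) \<longleftrightarrow> (\<exists>j. \<sigma> v = \<sigma> u @ [j])"
proof
  assume "\<exists>j. v = u @ [j]"
  then show "\<exists>j. \<sigma> v = \<sigma> u @ [j]" using tree_aut_child[OF \<sigma>] v by blast
next
  assume *: "\<exists>j. \<sigma> v = \<sigma> u @ [j]"
  then have "{\<sigma> u, \<sigma> v} \<in> tree_edges r (Suc k)"
    using tree_edges_iff[of "\<sigma> u" r k "\<sigma> v"] tree_aut_verts[OF \<sigma>] u v by blast
  then have "{u, v} \<in> tree_edges r (Suc k)" using \<sigma> u v by (auto simp: tree_aut_def)
  then have or: "(\<exists>j. v = u @ [j]) \<or> (\<exists>j. u = v @ [j])" using tree_edges_iff[OF u v] by blast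
  show "\<exists>j. v = u @ [j]"
  proof (rule ccontr)
    assume "\<not> ?thesis"
    with or obtain j where "u = v @ [j]" by blast
    then obtain j' where "\<sigma> u = \<sigma> v @ [j']" using tree_aut_child[OF \<sigma>] u by blast
    with * show False by auto
  qed
qed

lemma tree_aut_prefix:
  assumes \<sigma>: "\<sigma> \<in> tree_aut r (Suc k)"
  shows "v @ w \<in> tree_verts r (Suc k) \<Longrightarrow> \<exists>w'. \<sigma> (v @ w) = \<sigma> v @ w'"
proof (induction w rule: rev_induct)
  case (snoc j w)
  have "v @ w \<in> tree_verts r (Suc k)" using snoc.prems tree_verts_prefix[of "v @ w" "[j]"] by simp
  with snoc.IH obtain w' where "\<sigma> (v @ w) = \<sigma> v @ w'" by blast
  moreover obtain j' where "\<sigma> ((v @ w) @ [j]) = \<sigma> (v @ w) @ [j']"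
    using tree_aut_child[OF \<sigma>, of "v @ w" j] snoc.prems by auto
  ultimately show ?case by auto
qed simp

text \<open>The children of the fixed root are permuted, and prefixes are preserved, so each subtree
  is mapped onto a subtree. As in \<open>vertex_act\<close>, \<open>a\<close> is indexed by the
  position at which a subtree arrives.\<close>

lemma tree_aut_decompose:
  assumes \<sigma>: "\<sigma> \<in> tree_aut r (Suc (Suc k))"
  defines "n \<equiv> r (Suc (Suc k))"
  shows "\<exists>p a. p permutes {1..n} \<and> (\<forall>i\<in>{1..n}. a i \<in> tree_aut r (Suc k)) \<and>
    (\<forall>i\<in>{1..n}. \<forall>v\<in>tree_verts r (Suc k). \<sigma> (i # v) = p i # a (p i) v)"
proof -
  have in_V: "\<sigma> v \<in> tree_verts r (Suc (Suc k)) \<longleftrightarrow> v \<in> tree_verts r (Suc (Suc k))" for v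
    by (rule tree_aut_verts[OF \<sigma>])
  have inj: "\<sigma> u = \<sigma> v \<longleftrightarrow> u = v" for u v by (rule inj_eq[OF tree_aut_inj[OF \<sigma>]])
  have "\<exists>j. \<sigma> [i] = [j]" if "i \<in> {1..n}" for i
    using tree_aut_child[OF \<sigma>, of "[]" i] tree_aut_Nil[OF \<sigma>] that by (simp add: n_def)
  then obtain q where q: "\<And>i. i \<in> {1..n} \<Longrightarrow> \<sigma> [i] = [q i]" by metis
  have q_in: "q i \<in> {1..n}" if "i \<in> {1..n}" for i
    using in_V[of "[i]"] q[OF that] that by (simp add: n_def)
  have "inj_on q {1..n}" using q inj by (intro inj_onI) (metis list.inject)
  then have "bij_betw q {1..n} {1..n}" using q_in by (intro finite_inj_endo_bij) simp_all
  define p where "p i = (if i \<in> {1..n} then q i else i)" for i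
  have p: "p permutes {1..n}" unfolding p_def[abs_def] by (rule bij_betw_extend_permutes) fact
  have pq: "p i = q i" if "i \<in> {1..n}" for i using that by (simp add: p_def)
  \<comment> \<open>Outside the tree \<open>b i\<close> is the identity because members of
    \<open>tree_aut\<close> are permutations supported on the vertices.\<close>
  define b where "b i v = (if v \<in> tree_verts r (Suc k) then tl (\<sigma> (i # v)) else v)" for i v
  have \<sigma>b: "\<sigma> (i # v) = p i # b i v" if "i \<in> {1..n}" "v \<in> tree_verts r (Suc k)" for i v
    using tree_aut_prefix[OF \<sigma>, of "[i]" v] q[OF that(1)] that by (auto simp: b_def pq n_def)
  have b: "b i \<in> tree_aut r (Suc k)" if i: "i \<in> {1..n}" for i
  proof (rule tree_autI)
    show "b i v \<in> tree_verts r (Suc k)" if "v \<in> tree_verts r (Suc k)" for v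
      using in_V[of "i # v"] \<sigma>b[OF i that] i that by (simp add: n_def)
    show "inj_on (b i) (tree_verts r (Suc k))"
    proof (rule inj_onI)
      fix u v assume "u \<in> tree_verts r (Suc k)" "v \<in> tree_verts r (Suc k)" "b i u = b i v"
      then have "\<sigma> (i # u) = \<sigma> (i # v)" using \<sigma>b[OF i] by simp
      then show "u = v" using inj by simp
    qed
    show "b i v = v" if "v \<notin> tree_verts r (Suc k)" for v using that by (simp add: b_def)
    show "b i [] = []" using \<sigma>b[OF i, of "[]"] q[OF i] by simp
    fix u v assume uv: "u \<in> tree_verts r (Suc k)" "v \<in> tree_verts r (Suc k)"
    have "i # u \<in> tree_verts r (Suc (Suc k))" "i # v \<in> tree_verts r (Suc (Suc k))" using uv i
      by (auto simp: n_def)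
    from tree_aut_child_iff[OF \<sigma> this] show "(\<exists>j. v = u @ [j]) \<longleftrightarrow> (\<exists>j. b i v = b i u @ [j])"
      using \<sigma>b[OF i] uv by simp
  qed
  \<comment> \<open>\<open>b\<close> is indexed by the old position of a subtree, \<open>a\<close>
    by the new one.\<close>
  define a where "a j = b (inv_into UNIV p j)" for j
  have "a i \<in> tree_aut r (Suc k)" if "i \<in> {1..n}" for i
    using b permutes_inv_in[OF p] that by (simp add: a_def del: atLeastAtMost_iff)
  moreover have "\<sigma> (i # v) = p i # a (p i) v" if "i \<in> {1..n}" "v \<in> tree_verts r (Suc k)" for i v
    using \<sigma>b[OF that] permutes_inverses(2)[OF p] by (simp add: a_def)
  ultimately show ?thesis using p by blast
qed

text \<open>Converse of \<open>tree_aut_decompose\<close>: the parent relation can be checked at the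
  root and inside each subtree, since no vertex has its parent in a different subtree.\<close>

lemma tree_aut_compose_subtrees:
  assumes p: "p permutes {1..r (Suc (Suc k))}"
    and a: "\<And>i. i \<in> {1..r (Suc (Suc k))} \<Longrightarrow> a i \<in> tree_aut r (Suc k)"
    and \<sigma>_Nil: "\<sigma> [] = []"
    and \<sigma>: "\<And>i v. i \<in> {1..r (Suc (Suc k))} \<Longrightarrow> v \<in> tree_verts r (Suc k) \<Longrightarrow> \<sigma> (i # v) = p i # a (p i) v"
    and \<sigma>_out: "\<And>v. v \<notin> tree_verts r (Suc (Suc k)) \<Longrightarrow> \<sigma> v = v"
  shows "\<sigma> \<in> tree_aut r (Suc (Suc k))"
proof (rule tree_autI)
  let ?n = "r (Suc (Suc k))"
  have p_in: "p i \<in> {1..?n}" if "i \<in> {1..?n}" for i using permutes_in_image[OF p] that by blast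
  have a_in: "a (p i) v \<in> tree_verts r (Suc k)" if "i \<in> {1..?n}" "v \<in> tree_verts r (Suc k)" for i v
    using tree_aut_verts[OF a[OF p_in]] that by blast
  show in_V: "\<sigma> v \<in> tree_verts r (Suc (Suc k))" if "v \<in> tree_verts r (Suc (Suc k))" for v
  proof (cases v)
    case (Cons i w)
    then show ?thesis using \<sigma>[of i w] p_in[of i] a_in[of i w] that by simp
  qed (simp add: \<sigma>_Nil)
  have \<sigma>_eq: "\<sigma> (i # v) = \<sigma> (j # w) \<longleftrightarrow> i = j \<and> v = w"
    if "i # v \<in> tree_verts r (Suc (Suc k))" "j # w \<in> tree_verts r (Suc (Suc k))" for i v j w
  proof -
    have *: "i \<in> {1..?n}" "v \<in> tree_verts r (Suc k)" "j \<in> {1..?n}" "w \<in> tree_verts r (Suc k)"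
      using that by auto
    show ?thesis
      unfolding \<sigma>[OF *(1,2)] \<sigma>[OF *(3,4)]
        using inj_eq[OF permutes_inj[OF p]] inj_eq[OF tree_aut_inj[OF a[OF p_in[OF *(1)]]]]
      by auto
  qed
  have \<sigma>_Cons: "\<sigma> (i # v) \<noteq> []" if "i # v \<in> tree_verts r (Suc (Suc k))" for i v
    using \<sigma>[of i v] that by simp
  show "inj_on \<sigma> (tree_verts r (Suc (Suc k)))"
  proof (rule inj_onI)
    fix u v assume uv: "u \<in> tree_verts r (Suc (Suc k))" "v \<in> tree_verts r (Suc (Suc k))" "\<sigma> u = \<sigma> v"
    show "u = v"
    proof (cases u)
      case Nil
      then show ?thesis using uv \<sigma>_Nil \<sigma>_Cons by (cases v) metis+
    next
      case (Cons i u')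
      then obtain j v' where "v = j # v'" using uv \<sigma>_Nil \<sigma>_Cons by (cases v) metis+
      then show ?thesis using \<sigma>_eq uv Cons by metis
    qed
  qed
  show "\<sigma> [] = []" by (rule \<sigma>_Nil)
  fix u v assume uv: "u \<in> tree_verts r (Suc (Suc k))" "v \<in> tree_verts r (Suc (Suc k))"
  show "(\<exists>j. v = u @ [j]) \<longleftrightarrow> (\<exists>j. \<sigma> v = \<sigma> u @ [j])"
  proof (cases u)
    case Nil
    show ?thesis
    proof (cases v)
      case (Cons j w)
      have *: "j \<in> {1..?n}" "w \<in> tree_verts r (Suc k)" using uv Cons by auto
      have "a (p j) w = [] \<longleftrightarrow> w = []"
        using inj_eq[OF tree_aut_inj[OF a[OF p_in[OF *(1)]]], of w "[]"] tree_aut_Nil[OF a[OF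
          p_in[OF *(1)]]] by simp
      then show ?thesis using \<sigma>[OF *] Nil Cons \<sigma>_Nil by auto
    qed (use Nil \<sigma>_Nil in simp)
  next
    case Cons1: (Cons i u')
    have 1: "i \<in> {1..?n}" "u' \<in> tree_verts r (Suc k)" using uv Cons1 by auto
    show ?thesis
    proof (cases v)
      case Nil
      then show ?thesis using Cons1 \<sigma>_Nil by simp
    next
      case (Cons j w)
      have 2: "j \<in> {1..?n}" "w \<in> tree_verts r (Suc k)" using uv Cons by auto
      have "(\<exists>l. \<sigma> v = \<sigma> u @ [l]) \<longleftrightarrow> p i = p j \<and> (\<exists>l. a (p j) w = a (p i) u' @ [l])"
        using \<sigma>[OF 1] \<sigma>[OF 2] Cons Cons1 by auto
      also have "\<dots> \<longleftrightarrow> i = j \<and> (\<exists>l. a (p i) w = a (p i) u' @ [l])"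
        using inj_eq[OF permutes_inj[OF p]] by auto
      also have "\<dots> \<longleftrightarrow> i = j \<and> (\<exists>l. w = u' @ [l])"
        using tree_aut_child_iff[OF a[OF p_in[OF 1(1)]] 1(2) 2(2)] by simp
      finally show ?thesis using Cons Cons1 by auto
    qed
  qed
qed (rule \<sigma>_out)

section \<open>The iterated wreath product and its action on the tree\<close>

lemma carrier_W_Suc:
  "carrier (W r (Suc k)) = Wr ` (({1..r (Suc k)} \<rightarrow>\<^sub>E carrier (W r k)) \<times> {p.
    p permutes {1..r (Suc k)}})"
  by (simp add: image_group_carrier carrier_wreath)

lemma group_W: "group (W r k)"
proof (induction k)
  case (Suc k)
  show ?case unfolding W.simps
    by (rule group.inj_imp_image_group_is_group[OF group_wreath[OF Suc]]) (simp add: inj_on_def)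
qed simp

lemma finite_W: "finite (carrier (W r k))"
proof (induction k)
  case (Suc k)
  then show ?case using finite_wreath[of "W r k"] by (simp add: image_group_carrier)
qed (simp add: singleton_group_def)

lemma id_tree_aut: "id \<in> tree_aut r k"
  by (simp add: tree_aut_def permutes_id)

text \<open>\<open>vertex_act\<close> may move lists that are not vertices, so it is cut off to
  become a permutation supported on the tree.\<close>

lemma vertex_act_tree_aut:
  assumes "g \<in> carrier (W r (Suc k))"
  shows "(\<lambda>v. if v \<in> tree_verts r (Suc k) then vertex_act g v else v) \<in> tree_aut r (Suc k)"
  using assms
proof (induction k arbitrary: g)
  case 0
  have "(\<lambda>v. if v \<in> tree_verts r (Suc 0) then vertex_act g v else v) = id" by auto
  then show ?case using id_tree_aut by metis
next
  case (Suc k)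
  then obtain a p where g: "g = Wr (a, p)"
    and a: "\<And>i. i \<in> {1..r (Suc (Suc k))} \<Longrightarrow> a i \<in> carrier (W r (Suc k))"
    and p: "p permutes {1..r (Suc (Suc k))}" unfolding carrier_W_Suc[of r "Suc k"]
      by (force simp del: atLeastAtMost_iff)
  show ?case
  proof (rule tree_aut_compose_subtrees[where p = p
        and a = "\<lambda>i v. if v \<in> tree_verts r (Suc k) then vertex_act (a i) v else v"])
    show "p permutes {1..r (Suc (Suc k))}" by (rule p)
    show "(\<lambda>v. if v \<in> tree_verts r (Suc k) then vertex_act (a i) v else v) \<in> tree_aut r (Suc k)"
      if "i \<in> {1..r (Suc (Suc k))}" for i by (rule Suc.IH[OF a[OF that]])
  qed (auto simp: g)
qed

text \<open>Surjectivity of the action onto the automorphism group, by lifting the pieces of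
  \<open>tree_aut_decompose\<close> one level at a time.\<close>

lemma tree_aut_vertex_act:
  assumes "\<sigma> \<in> tree_aut r (Suc k)"
  shows "\<exists>g\<in>carrier (W r (Suc k)). \<forall>v\<in>tree_verts r (Suc k). vertex_act g v = \<sigma> v"
  using assms
proof (induction k arbitrary: \<sigma>)
  case 0
  interpret group "W r (Suc 0)" by (rule group_W)
  \<comment> \<open>The tree is a single vertex, so any group element will do.\<close>
  show ?case using one_closed tree_aut_Nil[OF 0]
    by (intro bexI[of _ "\<one>\<^bsub>W r (Suc 0)\<^esub>"]) (simp_all del: W.simps)
next
  case (Suc k)
  let ?n = "r (Suc (Suc k))"
  obtain p a where p: "p permutes {1..?n}" and a: "\<forall>i\<in>{1..?n}. a i \<in> tree_aut r (Suc k)"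
    and \<sigma>: "\<forall>i\<in>{1..?n}. \<forall>v\<in>tree_verts r (Suc k). \<sigma> (i # v) = p i # a (p i) v"
    using tree_aut_decompose[OF Suc.prems] by blast
  have "\<exists>g. g \<in> carrier (W r (Suc k)) \<and> (\<forall>v\<in>tree_verts r (Suc k). vertex_act g v = a i v)"
    if "i \<in> {1..?n}" for i
    using Suc.IH a that by blast
  then obtain b where b: "\<And>i. i \<in> {1..?n} \<Longrightarrow> b i \<in> carrier (W r (Suc k))"
    and ba: "\<And>i v. i \<in> {1..?n} \<Longrightarrow> v \<in> tree_verts r (Suc k) \<Longrightarrow> vertex_act (b i) v = a i v" by metis
  define g where "g = Wr (restrict b {1..?n}, p)"
  have "g \<in> carrier (W r (Suc (Suc k)))"
    unfolding carrier_W_Suc[of r "Suc k"] g_def using b p by (intro imageI) auto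
  moreover have "vertex_act g v = \<sigma> v" if v: "v \<in> tree_verts r (Suc (Suc k))" for v
  proof (cases v)
    case Nil
    then show ?thesis using tree_aut_Nil[OF Suc.prems] by simp
  next
    case (Cons i w)
    then have iw: "i \<in> {1..?n}" "w \<in> tree_verts r (Suc k)" using v by auto
    have pi: "p i \<in> {1..?n}" using permutes_in_image[OF p] iw by blast
    have "vertex_act g v = p i # vertex_act (b (p i)) w" using pi unfolding Cons g_def by simp
    then show ?thesis using ba[OF pi iw(2)] \<sigma> iw Cons by simp
  qed
  ultimately show ?case by blast
qed

section \<open>Equivalence of labels\<close>

lemma relabel_cong:
  "(\<And>v. v \<in> tree_verts r k \<Longrightarrow> \<sigma> v = \<tau> v) \<Longrightarrow> relabel r k \<sigma> \<phi> = relabel r k \<tau> \<phi>"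
  by (auto simp: relabel_def)

lemma relabel_labels:
  assumes "\<phi> \<in> labels r k" "\<sigma> \<in> tree_aut r k"
  shows "relabel r k \<sigma> \<phi> \<in> labels r k"
  using assms(1) tree_aut_verts[OF assms(2)] by (auto simp: relabel_def labels_def)

lemma tree_aut_comp:
  assumes "\<sigma> \<in> tree_aut r k" "\<tau> \<in> tree_aut r k"
  shows "\<sigma> \<circ> \<tau> \<in> tree_aut r k"
proof -
  have edges: "{u, v} \<in> tree_edges r k \<longleftrightarrow> {\<rho> u, \<rho> v} \<in> tree_edges r k"
    if "\<rho> \<in> tree_aut r k" "u \<in> tree_verts r k" "v \<in> tree_verts r k" for \<rho> u v
    using that by (simp add: tree_aut_def)
  have "{u, v} \<in> tree_edges r k \<longleftrightarrow> {\<sigma> (\<tau> u), \<sigma> (\<tau> v)} \<in> tree_edges r k"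
    if uv: "u \<in> tree_verts r k" "v \<in> tree_verts r k" for u v
  proof -
    have "\<tau> u \<in> tree_verts r k" "\<tau> v \<in> tree_verts r k" using uv tree_aut_verts[OF assms(2)]
      by simp_all
    then show ?thesis using edges[OF assms(2) uv] edges[OF assms(1)] by simp
  qed
  moreover have "\<sigma> \<circ> \<tau> permutes tree_verts r k"
    using assms by (intro permutes_compose) (simp_all add: tree_aut_def)
  moreover have "(\<sigma> \<circ> \<tau>) [] = []" using tree_aut_Nil[OF assms(1)] tree_aut_Nil[OF assms(2)] by simp
  ultimately show ?thesis by (simp add: tree_aut_def)
qed

lemma tree_aut_inv:
  assumes "\<sigma> \<in> tree_aut r k"
  shows "inv_into UNIV \<sigma> \<in> tree_aut r k"
proof -
  have p: "\<sigma> permutes tree_verts r k" using assms by (simp add: tree_aut_def)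
  have inv_Nil: "inv_into UNIV \<sigma> [] = []"
    using permutes_inverses(2)[OF p, of "[]"] tree_aut_Nil[OF assms] by simp
  have "{u, v} \<in> tree_edges r k \<longleftrightarrow> {inv_into UNIV \<sigma> u, inv_into UNIV \<sigma> v} \<in> tree_edges r k"
    if uv: "u \<in> tree_verts r k" "v \<in> tree_verts r k" for u v
  proof -
    have "inv_into UNIV \<sigma> u \<in> tree_verts r k" "inv_into UNIV \<sigma> v \<in> tree_verts r k"
      using uv permutes_inv_in[OF p] by auto
    then have "{inv_into UNIV \<sigma> u, inv_into UNIV \<sigma> v} \<in> tree_edges r k \<longleftrightarrow>
      {\<sigma> (inv_into UNIV \<sigma> u), \<sigma> (inv_into UNIV \<sigma> v)} \<in> tree_edges r k" using assms by (simp add: tree_aut_def)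
    then show ?thesis by (simp add: permutes_inverses(1)[OF p])
  qed
  then show ?thesis using permutes_inv[OF p] inv_Nil by (simp add: tree_aut_def)
qed

lemma relabel_relabel:
  assumes "\<tau> \<in> tree_aut r k"
  shows "relabel r k \<tau> (relabel r k \<sigma> \<phi>) = relabel r k (\<sigma> \<circ> \<tau>) \<phi>"
  using tree_aut_verts[OF assms] by (auto simp: relabel_def)

lemma relabel_id: "\<phi> \<in> labels r k \<Longrightarrow> relabel r k id \<phi> = \<phi>"
  by (auto simp: relabel_def labels_def fun_eq_iff PiE_def extensional_def)

lemma equiv_label_equiv: "equiv (labels r k) (label_equiv r k)"
proof (rule equivI)
  show "label_equiv r k \<subseteq> labels r k \<times> labels r k" by (auto simp: label_equiv_def)
  show "refl_on (labels r k) (label_equiv r k)"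
    by (intro refl_onI) (auto simp: label_equiv_def relabel_id id_tree_aut intro!: bexI[of _ id])
  show "sym (label_equiv r k)"
  proof (rule symI)
    fix \<phi> \<psi> assume "(\<phi>, \<psi>) \<in> label_equiv r k"
    then obtain \<sigma> where \<phi>: "\<phi> \<in> labels r k" "\<psi> \<in> labels r k" and \<sigma>: "\<sigma> \<in> tree_aut r k"
      and \<psi>: "\<psi> = relabel r k \<sigma> \<phi>"
      by (auto simp: label_equiv_def)
    have "\<sigma> \<circ> inv_into UNIV \<sigma> = id" using \<sigma> permutes_inv_o(1) by (auto simp: tree_aut_def)
    then have "relabel r k (inv_into UNIV \<sigma>) \<psi> = \<phi>"
      unfolding \<psi> relabel_relabel[OF tree_aut_inv[OF \<sigma>]] using relabel_id[OF \<phi>(1)] by simp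
    then show "(\<psi>, \<phi>) \<in> label_equiv r k" using \<phi> tree_aut_inv[OF \<sigma>] by (auto simp: label_equiv_def)
  qed
  show "trans (label_equiv r k)"
  proof (rule transI)
    fix \<phi> \<psi> \<chi> assume "(\<phi>, \<psi>) \<in> label_equiv r k" "(\<psi>, \<chi>) \<in> label_equiv r k"
    then obtain \<sigma> \<tau> where l: "\<phi> \<in> labels r k" "\<chi> \<in> labels r k"
      and st: "\<sigma> \<in> tree_aut r k" "\<tau> \<in> tree_aut r k"
      and "\<chi> = relabel r k \<tau> (relabel r k \<sigma> \<phi>)" by (auto simp: label_equiv_def)
    then have "relabel r k (\<sigma> \<circ> \<tau>) \<phi> = \<chi>" using relabel_relabel by metis
    then show "(\<phi>, \<chi>) \<in> label_equiv r k" using l tree_aut_comp[OF st]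
      by (auto simp: label_equiv_def)
  qed
qed

text \<open>As \<open>g\<close> runs through the group so does its inverse, and on the vertices the
  action realises every member of \<open>tree_aut\<close> and nothing else.\<close>

lemma orbit_eq_label_class:
  assumes \<phi>: "\<phi> \<in> labels r (Suc k)"
  shows "orbit (W r (Suc k)) (label_act r (Suc k)) \<phi> = label_equiv r (Suc k) `` {\<phi>}"
proof -
  interpret group "W r (Suc k)" by (rule group_W)
  have act: "label_act r (Suc k) g \<phi> = relabel r (Suc k) (vertex_act (inv\<^bsub>W r (Suc k)\<^esub> g)) \<phi>" for g
    using \<phi> by (simp add: label_act_def)
  show ?thesis
  proof (intro subset_antisym subsetI)
    fix \<psi> assume "\<psi> \<in> orbit (W r (Suc k)) (label_act r (Suc k)) \<phi>"
    then obtain g where g: "g \<in> carrier (W r (Suc k))"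
      and \<psi>: "\<psi> = relabel r (Suc k) (vertex_act (inv\<^bsub>W r (Suc k)\<^esub> g)) \<phi>"
      unfolding orbit_def act by blast
    define \<sigma> where "\<sigma> v = (if v \<in> tree_verts r (Suc k) then vertex_act (inv\<^bsub>W r (Suc k)\<^esub> g) v else
      v)" for v
    have "\<sigma> \<in> tree_aut r (Suc k)" unfolding \<sigma>_def[abs_def]
      by (rule vertex_act_tree_aut) (rule inv_closed[OF g])
    moreover have "\<psi> = relabel r (Suc k) \<sigma> \<phi>" unfolding \<psi> by (rule relabel_cong) (simp add: \<sigma>_def)
    ultimately show "\<psi> \<in> label_equiv r (Suc k) `` {\<phi>}"
      using \<phi> relabel_labels by (auto simp: label_equiv_def)
  next
    fix \<psi> assume "\<psi> \<in> label_equiv r (Suc k) `` {\<phi>}"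
    then obtain \<sigma> where \<sigma>: "\<sigma> \<in> tree_aut r (Suc k)" and \<psi>: "\<psi> = relabel r (Suc k) \<sigma> \<phi>"
      by (auto simp: label_equiv_def)
    from tree_aut_vertex_act[OF \<sigma>] obtain g where g: "g \<in> carrier (W r (Suc k))"
      and v: "\<And>v. v \<in> tree_verts r (Suc k) \<Longrightarrow> vertex_act g v = \<sigma> v" by blast
    have "\<psi> = relabel r (Suc k) (vertex_act g) \<phi>" unfolding \<psi> by (rule relabel_cong) (simp add: v)
    also have "g = inv\<^bsub>W r (Suc k)\<^esub> (inv\<^bsub>W r (Suc k)\<^esub> g)" by (rule inv_inv[OF g, symmetric])
    finally have "\<psi> = label_act r (Suc k) (inv\<^bsub>W r (Suc k)\<^esub> g) \<phi>" unfolding act .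
    then show "\<psi> \<in> orbit (W r (Suc k)) (label_act r (Suc k)) \<phi>" unfolding orbit_def
      using inv_closed[OF g] by blast
  qed
qed

lemma sublabel_labels:
  assumes "\<phi> \<in> labels r (Suc (Suc k))" "i \<in> {1..r (Suc (Suc k))}"
  shows "sublabel r (Suc k) \<phi> i \<in> labels r (Suc k)"
proof -
  have "\<phi> (i # v) \<in> S_hat_star" if "v \<in> tree_verts r (Suc k)" for v
    using assms that by (auto simp: labels_def simp del: tree_verts.simps)
  then show ?thesis by (auto simp: sublabel_def labels_def)
qed

text \<open>An automorphism splits into a permutation of the children and automorphisms of the
  subtrees, which act on the sublabels separately. The permutation stands on the side of
  \<open>\<phi>\<close> because \<open>relabel\<close> evaluates \<open>\<phi>\<close> at the image
  of a vertex.\<close>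

lemma label_equiv_Suc:
  assumes \<phi>: "\<phi> \<in> labels r (Suc (Suc k))" and \<psi>: "\<psi> \<in> labels r (Suc (Suc k))"
  shows "(\<phi>, \<psi>) \<in> label_equiv r (Suc (Suc k)) \<longleftrightarrow> \<phi> [] = \<psi> [] \<and>
    (\<exists>p. p permutes {1..r (Suc (Suc k))} \<and> (\<forall>i\<in>{1..r (Suc (Suc k))}.
      (sublabel r (Suc k) \<phi> (p i), sublabel r (Suc k) \<psi> i) \<in> label_equiv r (Suc k)))"
proof
  let ?n = "r (Suc (Suc k))"
  assume "(\<phi>, \<psi>) \<in> label_equiv r (Suc (Suc k))"
  then obtain \<sigma> where \<sigma>: "\<sigma> \<in> tree_aut r (Suc (Suc k))" and eq: "relabel r (Suc (Suc k)) \<sigma> \<phi> = \<psi>"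
    by (auto simp: label_equiv_def)
  have \<psi>v: "\<psi> v = \<phi> (\<sigma> v)" if "v \<in> tree_verts r (Suc (Suc k))" for v
    using that unfolding eq[symmetric] relabel_def by (rule restrict_apply')
  obtain p a where p: "p permutes {1..?n}" and a: "\<forall>i\<in>{1..?n}. a i \<in> tree_aut r (Suc k)"
    and \<sigma>_Cons: "\<forall>i\<in>{1..?n}. \<forall>v\<in>tree_verts r (Suc k). \<sigma> (i # v) = p i # a (p i) v"
    using tree_aut_decompose[OF \<sigma>] by blast
  have "(sublabel r (Suc k) \<phi> (p i), sublabel r (Suc k) \<psi> i) \<in> label_equiv r (Suc k)"
    if i: "i \<in> {1..?n}" for i
  proof -
    have pi: "p i \<in> {1..?n}" using permutes_in_image[OF p] i by blast
    then have api: "a (p i) \<in> tree_aut r (Suc k)" using a by blast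
    have "relabel r (Suc k) (a (p i)) (sublabel r (Suc k) \<phi> (p i)) = sublabel r (Suc k) \<psi> i"
      unfolding relabel_def sublabel_def
    proof (rule restrict_ext)
      fix v assume v: "v \<in> tree_verts r (Suc k)"
      then have "i # v \<in> tree_verts r (Suc (Suc k))" using i by simp
      then have "\<psi> (i # v) = \<phi> (p i # a (p i) v)" using \<psi>v \<sigma>_Cons i v by simp
      then show "(\<lambda>v\<in>tree_verts r (Suc k). \<phi> (p i # v)) (a (p i) v) = \<psi> (i # v)"
        using tree_aut_verts[OF api] v by simp
    qed
    then show ?thesis using sublabel_labels[OF \<phi> pi] sublabel_labels[OF \<psi> i] api
      by (auto simp: label_equiv_def)
  qed
  moreover have "\<phi> [] = \<psi> []" using \<psi>v[of "[]"] tree_aut_Nil[OF \<sigma>] by simp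
  ultimately show "\<phi> [] = \<psi> [] \<and> (\<exists>p. p permutes {1..?n} \<and> (\<forall>i\<in>{1..?n}.
      (sublabel r (Suc k) \<phi> (p i), sublabel r (Suc k) \<psi> i) \<in> label_equiv r (Suc k)))" using p by blast
next
  let ?n = "r (Suc (Suc k))"
  assume "\<phi> [] = \<psi> [] \<and> (\<exists>p. p permutes {1..?n} \<and> (\<forall>i\<in>{1..?n}.
      (sublabel r (Suc k) \<phi> (p i), sublabel r (Suc k) \<psi> i) \<in> label_equiv r (Suc k)))"
  then obtain p where root: "\<phi> [] = \<psi> []" and p: "p permutes {1..?n}"
    and sub: "\<And>i. i \<in> {1..?n} \<Longrightarrow>
      (sublabel r (Suc k) \<phi> (p i), sublabel r (Suc k) \<psi> i) \<in> label_equiv r (Suc k)" by blast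
  have "\<exists>a. a \<in> tree_aut r (Suc k) \<and> relabel r (Suc k) a (sublabel r (Suc k) \<phi> (p i)) =
    sublabel r (Suc k) \<psi> i"
    if "i \<in> {1..?n}" for i using sub[OF that] by (auto simp: label_equiv_def)
  then obtain b where b: "\<And>i. i \<in> {1..?n} \<Longrightarrow> b i \<in> tree_aut r (Suc k)"
    and b_eq: "\<And>i. i \<in> {1..?n} \<Longrightarrow> relabel r (Suc k) (b i) (sublabel r (Suc k) \<phi> (p i)) =
      sublabel r (Suc k) \<psi> i" by metis
  \<comment> \<open>\<open>b i\<close> belongs to the child \<open>i\<close>, whose subtree is sent
    to position \<open>p i\<close>; \<open>a\<close> is reindexed by that position.\<close>
  define a where "a j = b (inv_into UNIV p j)" for j
  have a: "a i \<in> tree_aut r (Suc k)" if "i \<in> {1..?n}" for i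
    using b permutes_inv_in[OF p] that by (simp add: a_def del: atLeastAtMost_iff)
  have ap: "a (p i) = b i" for i by (simp add: a_def permutes_inverses(2)[OF p])
  define \<sigma> where "\<sigma> u = (if u \<in> tree_verts r (Suc (Suc k)) then
      (case u of [] \<Rightarrow> [] | i # v \<Rightarrow> p i # a (p i) v) else u)" for u
  have \<sigma>_Cons: "\<sigma> (i # v) = p i # a (p i) v" if "i \<in> {1..?n}" "v \<in> tree_verts r (Suc k)" for i v
    using that by (simp add: \<sigma>_def del: tree_verts.simps)
  have \<sigma>_Nil: "\<sigma> [] = []" by (simp add: \<sigma>_def)
  have \<sigma>: "\<sigma> \<in> tree_aut r (Suc (Suc k))"
    by (rule tree_aut_compose_subtrees[where p = p and a = a])
      (use p a \<sigma>_Nil \<sigma>_Cons in \<open>simp_all add: \<sigma>_def del: tree_verts.simps\<close>)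
  have "relabel r (Suc (Suc k)) \<sigma> \<phi> = \<psi>"
  proof
    fix u show "relabel r (Suc (Suc k)) \<sigma> \<phi> u = \<psi> u"
    proof (cases "u \<in> tree_verts r (Suc (Suc k))")
      case False
      then show ?thesis using \<psi>
        by (auto simp: relabel_def labels_def PiE_def extensional_def simp del: tree_verts.simps)
    next
      case True
      then have eq: "relabel r (Suc (Suc k)) \<sigma> \<phi> u = \<phi> (\<sigma> u)" unfolding relabel_def
        by (rule restrict_apply')
      show ?thesis
      proof (cases u)
        case Nil
        then show ?thesis using eq root \<sigma>_Nil by simp
      next
        case (Cons i v)
        then have iv: "i \<in> {1..?n}" "v \<in> tree_verts r (Suc k)" using True by auto
        have "\<psi> u = sublabel r (Suc k) \<psi> i v" using iv Cons by (simp add: sublabel_def)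
        also have "\<dots> = sublabel r (Suc k) \<phi> (p i) (b i v)"
          unfolding b_eq[OF iv(1), symmetric] using iv by (simp add: relabel_def)
        also have "\<dots> = \<phi> (p i # b i v)" using tree_aut_verts[OF b[OF iv(1)]] iv
          by (simp add: sublabel_def)
        finally show ?thesis using eq \<sigma>_Cons[OF iv] Cons ap by simp
      qed
    qed
  qed
  then show "(\<phi>, \<psi>) \<in> label_equiv r (Suc (Suc k))" using \<phi> \<psi> \<sigma> by (auto simp: label_equiv_def)
qed

section \<open>Counting the classes of valid labels\<close>

text \<open>Zero multiplicities are dropped, because parts of a partition are positive. For the
  multiplicities of the sublabel classes this is \<open>root_partition\<close>; see
  \<open>root_partition_eq_shape\<close>.\<close>

definition shape :: "'c set \<Rightarrow> ('c \<Rightarrow> nat) \<Rightarrow> nat list" where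
  "shape C m = rev (sorted_list_of_multiset (image_mset m (mset_set {c \<in> C. m c > 0})))"

lemma mset_shape: "mset (shape C m) = image_mset m (mset_set {c \<in> C. m c > 0})"
  by (simp add: shape_def)

lemma shape_partition:
  assumes C: "finite C" and m: "m \<in> compositions C n"
  shows "shape C m \<in> partitions n"
proof -
  have "sum_list (shape C m) = sum_mset (image_mset m (mset_set {c \<in> C. m c > 0}))"
    unfolding mset_shape[symmetric] by (rule sum_mset_sum_list[symmetric])
  also have "\<dots> = sum m {c \<in> C. m c > 0}" by (rule sum_unfold_sum_mset[symmetric])
  also have "\<dots> = sum m C" using C by (intro sum.mono_neutral_left) auto
  finally have "sum_list (shape C m) = n" using m by (simp add: compositions_def)
  moreover have "a \<ge> 1" if "a \<in> set (shape C m)" for a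
  proof -
    have "a \<in># mset (shape C m)" using that by simp
    then show ?thesis unfolding mset_shape using C by auto
  qed
  moreover have "sorted_wrt (\<ge>) (shape C m)"
    unfolding shape_def sorted_wrt_rev by (rule sorted_sorted_list_of_multiset)
  ultimately show ?thesis by (simp add: partitions_def)
qed

lemma finite_group_sym_group: "finite_group (sym_group n)"
  unfolding finite_group_def finite_group_axioms_def
  by (simp add: sym_group_is_group) (simp add: sym_group_def finite_permutations)

lemma finite_group_S_part: "finite_group (S_part \<alpha>)"
  unfolding finite_group_def finite_group_axioms_def S_part_def
  using finite_group.finite_carrier[OF finite_group_sym_group]
  by (auto simp: sym_group_is_group intro!: finite_PiE)

text \<open>\<open>card_Irr\<close> is applied to the group \<open>S_part \<alpha>\<close>, whose
  conjugacy classes are counted factor by factor.\<close>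

lemma card_S_hat:
  "finite (S_hat \<alpha>)" "card (S_hat \<alpha>) = (\<Prod>a\<leftarrow>\<alpha>. card (conj_classes (sym_group a)))"
proof -
  show "finite (S_hat \<alpha>)"
    using finite_group.card_Irr(1)[OF finite_group_S_part] by (simp add: S_hat_def)
  have "card (S_hat \<alpha>) = card (conj_classes (S_part \<alpha>))"
    using finite_group.card_Irr(2)[OF finite_group_S_part]
      by (simp add: S_hat_def card_cartesian_product)
  also have "\<dots> = (\<Prod>j<length \<alpha>. card (conj_classes (sym_group (\<alpha> ! j))))"
    unfolding S_part_def by (rule card_conj_classes_product_group) (simp_all
      add: sym_group_is_group)
  also have "\<dots> = (\<Prod>a\<leftarrow>\<alpha>. card (conj_classes (sym_group a)))"
    by (simp add: prod.list_conv_set_nth atLeast0LessThan)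
  finally show "card (S_hat \<alpha>) = (\<Prod>a\<leftarrow>\<alpha>. card (conj_classes (sym_group a)))" .
qed

lemma card_conj_classes_sym_group_0: "card (conj_classes (sym_group 0)) = 1"
  by (simp add: conj_classes_def sym_group_def)

text \<open>The parts of the shape are the positive values of \<open>m\<close>. A value 0
  contributes a factor 1 because \<open>sym_group 0\<close> is trivial, so the product extends to
  all of \<open>C\<close>.\<close>

lemma card_S_hat_shape:
  assumes "finite C"
  shows "card (S_hat (shape C m)) = (\<Prod>c\<in>C. card (conj_classes (sym_group (m c))))"
proof -
  let ?F = "\<lambda>a. card (conj_classes (sym_group a))"
  have "card (S_hat (shape C m)) = prod_mset (image_mset ?F (mset (shape C m)))"
    unfolding card_S_hat(2) prod_mset_prod_list[symmetric] by simp
  also have "\<dots> = (\<Prod>c | c \<in> C \<and> m c > 0. ?F (m c))"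
    unfolding mset_shape prod_unfold_prod_mset by (simp add: image_mset.compositionality comp_def)
  also have "\<dots> = (\<Prod>c\<in>C. ?F (m c))"
    using assms card_conj_classes_sym_group_0 by (intro prod.mono_neutral_left) auto
  finally show ?thesis .
qed

section \<open>Classes of valid labels and a complete invariant for them\<close>

definition label_class :: "(nat \<Rightarrow> nat) \<Rightarrow> nat \<Rightarrow> (nat list \<Rightarrow> label) \<Rightarrow> (nat list \<Rightarrow> label) set" where
  "label_class r k \<phi> = label_equiv r k `` {\<phi>}"

definition valid_classes :: "(nat \<Rightarrow> nat) \<Rightarrow> nat \<Rightarrow> (nat list \<Rightarrow> label) set set" where
  "valid_classes r k = label_class r k ` valid_labels r k"

lemma valid_labels_labels: "\<phi> \<in> valid_labels r k \<Longrightarrow> \<phi> \<in> labels r k"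
  by (cases "(r, k, \<phi>)" rule: valid_label.cases) (auto simp: valid_labels_def)

lemma label_class_eq_iff:
  assumes "\<phi> \<in> labels r k" "\<psi> \<in> labels r k"
  shows "label_class r k \<phi> = label_class r k \<psi> \<longleftrightarrow> (\<phi>, \<psi>) \<in> label_equiv r k"
  unfolding label_class_def by (rule eq_equiv_class_iff[OF equiv_label_equiv assms])

lemma mem_label_class_iff:
  assumes "\<phi> \<in> labels r k" "\<psi> \<in> labels r k"
  shows "\<psi> \<in> label_class r k \<phi> \<longleftrightarrow> label_class r k \<psi> = label_class r k \<phi>"
  using label_class_eq_iff[OF assms] unfolding label_class_def by auto

text \<open>Equal fibre sizes mean equal multisets of values, and families with the same multiset of
  values differ by a permutation of the indices.\<close>

lemma ex_permutation_iff_fibres: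
  fixes f g :: "'a \<Rightarrow> 'b"
  assumes "finite A" "f ` A \<subseteq> C" "g ` A \<subseteq> C"
  shows "(\<exists>p. p permutes A \<and> (\<forall>i\<in>A. f (p i) = g i)) \<longleftrightarrow>
    (\<forall>c\<in>C. card {i \<in> A. f i = c} = card {i \<in> A. g i = c})"
proof
  assume "\<exists>p. p permutes A \<and> (\<forall>i\<in>A. f (p i) = g i)"
  then obtain p where p: "p permutes A" "\<And>i. i \<in> A \<Longrightarrow> f (p i) = g i" by blast
  show "\<forall>c\<in>C. card {i \<in> A. f i = c} = card {i \<in> A. g i = c}"
  proof
    fix c
    have "p ` {i \<in> A. g i = c} = {i \<in> A. f i = c}"
    proof (intro subset_antisym subsetI)
      fix i assume "i \<in> p ` {i \<in> A. g i = c}"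
      then show "i \<in> {i \<in> A. f i = c}" using p permutes_in_image[OF p(1)] by auto
    next
      fix i assume i: "i \<in> {i \<in> A. f i = c}"
      then have "inv_into UNIV p i \<in> {i \<in> A. g i = c}"
        using p(2)[of "inv_into UNIV p i"] permutes_inv_in[OF p(1)] permutes_inverses(1)[OF p(1)]
          by auto
      moreover have "i = p (inv_into UNIV p i)" by (rule permutes_inverses(1)[OF p(1), symmetric])
      ultimately show "i \<in> p ` {i \<in> A. g i = c}" by (rule image_eqI[rotated])
    qed
    then show "card {i \<in> A. f i = c} = card {i \<in> A. g i = c}"
      using card_image[OF inj_on_subset[OF permutes_inj[OF p(1)] subset_UNIV], of "{i \<in> A. g i =
        c}"] by simp
  qed
next
  assume eq: "\<forall>c\<in>C. card {i \<in> A. f i = c} = card {i \<in> A. g i = c}"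
  have "image_mset g (mset_set A) = image_mset f (mset_set A)"
  proof (rule multiset_eqI)
    fix c
    have count: "count (image_mset h (mset_set A)) c = card {i \<in> A. h i = c}" for h :: "'a \<Rightarrow> 'b"
    proof -
      have "count (image_mset h (mset_set A)) c = card (h -` {c} \<inter> A)"
        using assms(1) by (simp add: count_image_mset)
      also have "h -` {c} \<inter> A = {i \<in> A. h i = c}" by auto
      finally show ?thesis .
    qed
    have "card {i \<in> A. f i = c} = card {i \<in> A. g i = c}"
    proof (cases "c \<in> C")
      case False
      then have "{i \<in> A. f i = c} = {}" "{i \<in> A. g i = c} = {}" using assms(2,3) by auto
      then show ?thesis by (simp only:)
    qed (use eq in blast)
    then show "count (image_mset g (mset_set A)) c = count (image_mset f (mset_set A)) c"
      by (simp add: count)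
  qed
  from image_mset_eq_implies_permutes[OF assms(1) this]
  obtain p where "p permutes A" "\<forall>i\<in>A. g i = f (p i)" by blast
  then show "\<exists>p. p permutes A \<and> (\<forall>i\<in>A. f (p i) = g i)" by auto
qed

text \<open>The restriction to \<open>valid_classes\<close> makes this a member of
  \<open>compositions\<close> when the sublabels are valid.\<close>

definition sublabel_count :: "(nat \<Rightarrow> nat) \<Rightarrow> nat \<Rightarrow> (nat list \<Rightarrow> label) \<Rightarrow> (nat list \<Rightarrow> label) set \<Rightarrow> nat"
  where
  "sublabel_count r k \<phi> = (\<lambda>C\<in>valid_classes r k. card {i \<in> {1..r (Suc k)}.
    label_class r k (sublabel r k \<phi> i) = C})"

text \<open>\<open>root_partition\<close> runs over the classes of all labels, but valid sublabels
  only meet classes in \<open>valid_classes\<close>.\<close>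

lemma root_partition_eq_shape:
  assumes \<phi>: "\<And>i. i \<in> {1..r (Suc k)} \<Longrightarrow> sublabel r k \<phi> i \<in> valid_labels r k"
  shows "root_partition r k \<phi> = shape (valid_classes r k) (sublabel_count r k \<phi>)"
proof -
  let ?I = "{1..r (Suc k)}" and ?L = "valid_classes r k" and ?s = "sublabel r k \<phi>"
  have s: "?s i \<in> labels r k" if "i \<in> ?I" for i using \<phi>[OF that] by (rule valid_labels_labels)
  have mem: "?s i \<in> C \<longleftrightarrow> label_class r k (?s i) = C" if i: "i \<in> ?I"
    and C: "C \<in> labels r k // label_equiv r k" for i C
  proof -
    obtain \<chi> where "\<chi> \<in> labels r k" "C = label_class r k \<chi>" using C
      by (auto simp: label_class_def quotient_def)
    then show ?thesis using mem_label_class_iff s[OF i] by simp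
  qed
  have L_sub: "?L \<subseteq> labels r k // label_equiv r k"
    using valid_labels_labels by (auto simp: valid_classes_def label_class_def quotient_def)
  have fib: "{i \<in> ?I. ?s i \<in> C} = {i \<in> ?I. label_class r k (?s i) = C}"
    if "C \<in> labels r k // label_equiv r k" for C
    using mem[OF _ that] by blast
  have pos: "sublabel_count r k \<phi> C > 0 \<longleftrightarrow> (\<exists>i\<in>?I. label_class r k (?s i) = C)" if "C \<in> ?L" for C
    using that by (auto simp: sublabel_count_def card_gt_0_iff)
  have Cs: "{C \<in> labels r k // label_equiv r k. \<exists>i\<in>?I. ?s i \<in> C} =
    {C \<in> ?L. sublabel_count r k \<phi> C > 0}"
  proof (intro subset_antisym subsetI)
    fix C assume C: "C \<in> {C \<in> labels r k // label_equiv r k. \<exists>i\<in>?I. ?s i \<in> C}"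
    then obtain i where i: "i \<in> ?I" "label_class r k (?s i) = C" using mem by blast
    then have "C \<in> ?L" using \<phi> unfolding valid_classes_def by blast
    then show "C \<in> {C \<in> ?L. sublabel_count r k \<phi> C > 0}" using pos i by blast
  next
    fix C assume "C \<in> {C \<in> ?L. sublabel_count r k \<phi> C > 0}"
    then have "C \<in> ?L" "\<exists>i\<in>?I. label_class r k (?s i) = C" using pos by auto
    then show "C \<in> {C \<in> labels r k // label_equiv r k. \<exists>i\<in>?I. ?s i \<in> C}" using mem L_sub by blast
  qed
  have "image_mset (\<lambda>C. card {i \<in> ?I. ?s i \<in> C}) (mset_set {C \<in> ?L. sublabel_count r k \<phi> C > 0})
    = image_mset (sublabel_count r k \<phi>) (mset_set {C \<in> ?L. sublabel_count r k \<phi> C > 0})"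
  proof (rule image_mset_cong)
    fix C assume "C \<in># mset_set {C \<in> ?L. sublabel_count r k \<phi> C > 0}"
    then have "C \<in> ?L" by (cases "finite {C \<in> ?L. sublabel_count r k \<phi> C > 0}") auto
    then show "card {i \<in> ?I. ?s i \<in> C} = sublabel_count r k \<phi> C"
      using fib[of C] L_sub by (auto simp: sublabel_count_def)
  qed
  then show ?thesis unfolding root_partition_def Let_def Cs shape_def by simp
qed

lemma valid_labels_Suc_iff:
  "\<phi> \<in> valid_labels r (Suc (Suc k)) \<longleftrightarrow> \<phi> \<in> labels r (Suc (Suc k)) \<and>
    (\<forall>i\<in>{1..r (Suc (Suc k))}. sublabel r (Suc k) \<phi> i \<in> valid_labels r (Suc k)) \<and>
    \<phi> [] \<in> S_hat (root_partition r (Suc k) \<phi>)"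
  by (simp add: valid_labels_def)

text \<open>The counterpart of \<open>wreath_type\<close>: multiplicities of colours, together with
  a datum whose range depends on them.\<close>

definition label_type :: "(nat \<Rightarrow> nat) \<Rightarrow> nat \<Rightarrow> (nat list \<Rightarrow> label) \<Rightarrow> ((nat list \<Rightarrow> label) set \<Rightarrow> nat) \<times>
  label" where
  "label_type r k \<phi> = (sublabel_count r k \<phi>, \<phi> [])"

lemma sublabel_class_image:
  assumes "\<phi> \<in> valid_labels r (Suc (Suc k))"
  shows "(\<lambda>i. label_class r (Suc k) (sublabel r (Suc k) \<phi> i)) ` {1..r (Suc (Suc k))} \<subseteq> valid_classes
    r (Suc k)"
  using assms unfolding valid_labels_Suc_iff valid_classes_def by blast

text \<open>By \<open>label_equiv_Suc\<close> the sublabels have to match up to a permutation of the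
  children, which \<open>ex_permutation_iff_fibres\<close> expresses through multiplicities.\<close>

lemma label_type_eq_iff:
  assumes \<phi>: "\<phi> \<in> valid_labels r (Suc (Suc k))" and \<psi>: "\<psi> \<in> valid_labels r (Suc (Suc k))"
  shows "label_class r (Suc (Suc k)) \<phi> = label_class r (Suc (Suc k)) \<psi> \<longleftrightarrow>
    label_type r (Suc k) \<phi> = label_type r (Suc k) \<psi>"
proof -
  let ?I = "{1..r (Suc (Suc k))}"
  note l = valid_labels_labels[OF \<phi>] valid_labels_labels[OF \<psi>]
  have "(sublabel r (Suc k) \<phi> (p i), sublabel r (Suc k) \<psi> i) \<in> label_equiv r (Suc k) \<longleftrightarrow>
    label_class r (Suc k) (sublabel r (Suc k) \<phi> (p i)) = label_class r (Suc k) (sublabel r (Suc k) \<psi> i)"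
    if "p permutes ?I" "i \<in> ?I" for p i
    using label_class_eq_iff sublabel_labels[OF l(1)] sublabel_labels[OF l(2) that(2)]
      permutes_in_image[OF that(1)] that(2)
    by blast
  then have "label_class r (Suc (Suc k)) \<phi> = label_class r (Suc (Suc k)) \<psi> \<longleftrightarrow> \<phi> [] = \<psi> [] \<and>
    (\<exists>p. p permutes ?I \<and> (\<forall>i\<in>?I. label_class r (Suc k) (sublabel r (Suc k) \<phi> (p i)) =
      label_class r (Suc k) (sublabel r (Suc k) \<psi> i)))"
    unfolding label_class_eq_iff[OF l] label_equiv_Suc[OF l] by (simp cong: conj_cong)
  also have "\<dots> \<longleftrightarrow> \<phi> [] = \<psi> [] \<and> (\<forall>C\<in>valid_classes r (Suc k).
      card {i \<in> ?I. label_class r (Suc k) (sublabel r (Suc k) \<phi> i) = C} =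
      card {i \<in> ?I. label_class r (Suc k) (sublabel r (Suc k) \<psi> i) = C})"
    by (subst ex_permutation_iff_fibres[OF _ sublabel_class_image[OF \<phi>] sublabel_class_image[OF \<psi>]])
      simp_all
  also have "\<dots> \<longleftrightarrow> label_type r (Suc k) \<phi> = label_type r (Suc k) \<psi>"
    unfolding label_type_def sublabel_count_def prod.inject restrict_eq_iff by blast
  finally show ?thesis .
qed

text \<open>To realise \<open>m\<close> and \<open>x\<close>, each child is assigned a class so that
  \<open>C\<close> is used \<open>m C\<close> times, and it receives a valid representative of its
  class; the root receives \<open>x\<close>. Validity imposes nothing further.\<close>

lemma label_type_image:
  assumes n: "r (Suc (Suc k)) \<ge> 1" and fin: "finite (valid_classes r (Suc k))"
  shows "label_type r (Suc k) ` valid_labels r (Suc (Suc k)) =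
    (SIGMA m:compositions (valid_classes r (Suc k)) (r (Suc (Suc k))). S_hat (shape (valid_classes r (Suc k)) m))"
proof (intro subset_antisym subsetI)
  let ?n = "r (Suc (Suc k))" and ?L = "valid_classes r (Suc k)"
  fix z assume "z \<in> label_type r (Suc k) ` valid_labels r (Suc (Suc k))"
  then obtain \<phi> where \<phi>: "\<phi> \<in> valid_labels r (Suc (Suc k))" "z = label_type r (Suc k) \<phi>" by blast
  have "sublabel_count r (Suc k) \<phi> \<in> compositions ?L (card {1..?n})"
    unfolding sublabel_count_def using fin sublabel_class_image[OF \<phi>(1)]
      by (intro fibre_cards_in_compositions) simp_all
  moreover have "\<phi> [] \<in> S_hat (shape ?L (sublabel_count r (Suc k) \<phi>))"
    using \<phi>(1) root_partition_eq_shape[of r "Suc k" \<phi>] unfolding valid_labels_Suc_iff by simp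
  ultimately show "z \<in> (SIGMA m:compositions ?L ?n. S_hat (shape ?L m))"
    by (simp add: \<phi>(2) label_type_def)
next
  let ?n = "r (Suc (Suc k))" and ?L = "valid_classes r (Suc k)"
  fix z assume "z \<in> (SIGMA m:compositions ?L ?n. S_hat (shape ?L m))"
  then obtain m x where z: "z = (m, x)" and m: "m \<in> compositions ?L ?n"
    and x: "x \<in> S_hat (shape ?L m)" by blast
  obtain e where e: "bij_betw e {1..?n} (SIGMA C:?L. {1..m C})"
    using compositions_fibres[OF fin m] .
  have e_in: "e i \<in> (SIGMA C:?L. {1..m C})" if "i \<in> {1..?n}" for i using bij_betwE[OF e] that
    by blast
  have "\<exists>\<chi>. \<chi> \<in> valid_labels r (Suc k) \<and> label_class r (Suc k) \<chi> = fst (e i)" if "i \<in> {1..?n}" for i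
    using e_in[OF that] by (auto simp: valid_classes_def)
  then obtain \<chi> where \<chi>: "\<And>i. i \<in> {1..?n} \<Longrightarrow> \<chi> i \<in> valid_labels r (Suc k)"
    and \<chi>_class: "\<And>i. i \<in> {1..?n} \<Longrightarrow> label_class r (Suc k) (\<chi> i) = fst (e i)" by metis
  define \<phi> where "\<phi> = (\<lambda>v\<in>tree_verts r (Suc (Suc k)). case v of [] \<Rightarrow> x | i # w \<Rightarrow> \<chi> i w)"
  have \<phi>_Nil: "\<phi> [] = x" by (simp add: \<phi>_def)
  have \<phi>_Cons: "\<phi> (i # w) = \<chi> i w" if "i \<in> {1..?n}" "w \<in> tree_verts r (Suc k)" for i w
    using that by (simp add: \<phi>_def del: tree_verts.simps)
  have sub: "sublabel r (Suc k) \<phi> i = \<chi> i" if i: "i \<in> {1..?n}" for i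
  proof
    fix v show "sublabel r (Suc k) \<phi> i v = \<chi> i v"
    proof (cases "v \<in> tree_verts r (Suc k)")
      case True
      then show ?thesis using \<phi>_Cons[OF i] by (simp add: sublabel_def)
    next
      case False
      then show ?thesis using valid_labels_labels[OF \<chi>[OF i]]
        by (auto simp: sublabel_def labels_def PiE_def extensional_def)
    qed
  qed
  \<comment> \<open>\<open>S_hat_star\<close> collects the partitions of positive numbers only; here
    the positivity of \<open>?n\<close> enters.\<close>
  have "x \<in> S_hat_star" unfolding S_hat_star_def using x n shape_partition[OF fin m] by auto
  have "\<phi> v \<in> S_hat_star" if v: "v \<in> tree_verts r (Suc (Suc k))" for v
  proof (cases v)
    case Nil
    then show ?thesis using \<open>x \<in> S_hat_star\<close> \<phi>_Nil by simp
  next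
    case (Cons i w)
    then have iw: "i \<in> {1..?n}" "w \<in> tree_verts r (Suc k)" using v by auto
    then show ?thesis using valid_labels_labels[OF \<chi>[OF iw(1)]] \<phi>_Cons[OF iw] Cons
      by (auto simp: labels_def)
  qed
  then have \<phi>_labels: "\<phi> \<in> labels r (Suc (Suc k))" unfolding labels_def
    by (intro PiE_I) (simp_all add: \<phi>_def del: tree_verts.simps)
  have mult: "sublabel_count r (Suc k) \<phi> = m"
  proof
    fix C show "sublabel_count r (Suc k) \<phi> C = m C"
    proof (cases "C \<in> ?L")
      case False
      then show ?thesis using m
        by (auto simp: sublabel_count_def compositions_def PiE_def extensional_def)
    next
      case True
      \<comment> \<open>The children assigned to \<open>C\<close> correspond under \<open>e\<close>
        to the block over \<open>C\<close>.\<close>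
      have "e ` {i \<in> {1..?n}. fst (e i) = C} = {C} \<times> {1..m C}"
      proof (intro subset_antisym subsetI)
        fix d assume "d \<in> e ` {i \<in> {1..?n}. fst (e i) = C}"
        then obtain i where "i \<in> {1..?n}" "fst (e i) = C" "d = e i" by blast
        then show "d \<in> {C} \<times> {1..m C}" using e_in[of i] by (auto simp: mem_Times_iff)
      next
        fix d assume "d \<in> {C} \<times> {1..m C}"
        then have "d \<in> (SIGMA C:?L. {1..m C})" "fst d = C" using True by auto
        then show "d \<in> e ` {i \<in> {1..?n}. fst (e i) = C}"
          unfolding bij_betw_imp_surj_on[OF e, symmetric] by auto
      qed
      moreover have "inj_on e {i \<in> {1..?n}. fst (e i) = C}"
        using bij_betw_imp_inj_on[OF e] by (rule inj_on_subset) blast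
      ultimately have "card {i \<in> {1..?n}. fst (e i) = C} = m C" using card_image by fastforce
      moreover have "{i \<in> {1..?n}. label_class r (Suc k) (sublabel r (Suc k) \<phi> i) = C} =
        {i \<in> {1..?n}. fst (e i) = C}"
        using sub \<chi>_class by auto
      ultimately show ?thesis using True by (simp add: sublabel_count_def)
    qed
  qed
  have "\<phi> \<in> valid_labels r (Suc (Suc k))"
    unfolding valid_labels_Suc_iff
  proof (intro conjI ballI)
    show "\<phi> \<in> labels r (Suc (Suc k))" by (rule \<phi>_labels)
    show "sublabel r (Suc k) \<phi> i \<in> valid_labels r (Suc k)" if "i \<in> {1..?n}" for i
      using sub[OF that] \<chi>[OF that] by simp
    show "\<phi> [] \<in> S_hat (root_partition r (Suc k) \<phi>)"
      using root_partition_eq_shape[of r "Suc k" \<phi>] sub \<chi> x by (simp add: mult \<phi>_Nil)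
  qed
  moreover have "label_type r (Suc k) \<phi> = z" by (simp add: label_type_def mult \<phi>_Nil z)
  ultimately show "z \<in> label_type r (Suc k) ` valid_labels r (Suc (Suc k))" by blast
qed

lemma card_valid_classes_Suc:
  assumes n: "r (Suc (Suc k)) \<ge> 1" and fin: "finite (valid_classes r (Suc k))"
  shows "finite (valid_classes r (Suc (Suc k)))"
    and "card (valid_classes r (Suc (Suc k))) =
      coloured_class_count (valid_classes r (Suc k)) (r (Suc (Suc k)))"
proof -
  let ?L = "valid_classes r (Suc k)" and ?n = "r (Suc (Suc k))"
  obtain h where "bij_betw h (valid_classes r (Suc (Suc k))) (label_type r (Suc k) ` valid_labels r
    (Suc (Suc k)))"
    using ex_bij_betw_images[of "valid_labels r (Suc (Suc k))" "label_class r (Suc (Suc k))"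
      "label_type r (Suc k)"]
      label_type_eq_iff unfolding valid_classes_def by blast
  then have h: "bij_betw h (valid_classes r (Suc (Suc k))) (SIGMA m:compositions ?L ?n.
    S_hat (shape ?L m))"
    unfolding label_type_image[of r k, OF n fin] .
  have finS: "finite (SIGMA m:compositions ?L ?n. S_hat (shape ?L m))"
    using finite_compositions[OF fin] card_S_hat(1) by (intro finite_SigmaI) simp_all
  then show "finite (valid_classes r (Suc (Suc k)))" using bij_betw_finite[OF h] by simp
  have "card (valid_classes r (Suc (Suc k))) =
    card (SIGMA m:compositions ?L ?n. S_hat (shape ?L m))"
    by (rule bij_betw_same_card[OF h])
  also have "\<dots> = coloured_class_count ?L ?n"
    using finite_compositions[OF fin] card_S_hat(1)
    by (subst card_SigmaI) (simp_all add: coloured_class_count_def card_S_hat_shape[OF fin])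
  finally show "card (valid_classes r (Suc (Suc k))) = coloured_class_count ?L ?n" .
qed

text \<open>The tree has one vertex and only the identity automorphism, so a class amounts to an
  element of \<open>S_hat [r 1]\<close>.\<close>

lemma valid_classes_1:
  assumes "r 1 \<ge> 1"
  shows "finite (valid_classes r (Suc 0))" "card (valid_classes r (Suc 0)) =
    card (conj_classes (sym_group (r 1)))"
proof -
  have part: "[r 1] \<in> partitions (r 1)" using assms by (simp add: partitions_def)
  have S: "x \<in> S_hat_star" if "x \<in> S_hat [r 1]" for x
    unfolding S_hat_star_def using that part assms by auto
  have valid: "\<phi> \<in> valid_labels r (Suc 0) \<longleftrightarrow> \<phi> \<in> labels r (Suc 0) \<and> \<phi> [] \<in> S_hat [r 1]" for \<phi>
    by (simp add: valid_labels_def)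
  have "label_class r (Suc 0) \<phi> = label_class r (Suc 0) \<psi> \<longleftrightarrow> \<phi> [] = \<psi> []"
    if "\<phi> \<in> valid_labels r (Suc 0)" "\<psi> \<in> valid_labels r (Suc 0)" for \<phi> \<psi>
  proof -
    note l = valid_labels_labels[OF that(1)] valid_labels_labels[OF that(2)]
    have "relabel r (Suc 0) \<sigma> \<phi> = \<psi> \<longleftrightarrow> \<phi> [] = \<psi> []" if "\<sigma> \<in> tree_aut r (Suc 0)" for \<sigma>
      using l tree_aut_Nil[OF that]
        by (auto simp: relabel_def labels_def fun_eq_iff PiE_def extensional_def)
    then show ?thesis
      unfolding label_class_eq_iff[OF l] label_equiv_def using l id_tree_aut by auto
  qed
  then obtain h where h: "bij_betw h (valid_classes r (Suc 0)) ((\<lambda>\<phi>.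
    \<phi> []) ` valid_labels r (Suc 0))"
    unfolding valid_classes_def
      using ex_bij_betw_images[of "valid_labels r (Suc 0)" "label_class r (Suc 0)" "\<lambda>\<phi>. \<phi> []"]
    by blast
  have "(\<lambda>\<phi>. \<phi> []) ` valid_labels r (Suc 0) = S_hat [r 1]"
  proof (intro subset_antisym subsetI)
    fix x assume "x \<in> S_hat [r 1]"
    then have "(\<lambda>v\<in>{[]}. x) \<in> valid_labels r (Suc 0)" using S by (auto simp: valid labels_def)
    then show "x \<in> (\<lambda>\<phi>. \<phi> []) ` valid_labels r (Suc 0)" by (rule image_eqI[rotated]) simp
  qed (auto simp: valid)
  with h have h: "bij_betw h (valid_classes r (Suc 0)) (S_hat [r 1])" by simp
  show "finite (valid_classes r (Suc 0))" using bij_betw_finite[OF h] card_S_hat(1) by simp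
  show "card (valid_classes r (Suc 0)) = card (conj_classes (sym_group (r 1)))"
    using bij_betw_same_card[OF h] card_S_hat(2)[of "[r 1]"] by simp
qed

section \<open>The common recursion and the comparison of the two counts\<close>

lemma coloured_class_count_singleton: "coloured_class_count {c} n =
  card (conj_classes (sym_group n))"
proof -
  have "compositions {c} n = {\<lambda>_\<in>{c}. n}"
    by (auto simp: compositions_def fun_eq_iff PiE_def extensional_def)
  then show ?thesis by (simp add: coloured_class_count_def)
qed

lemma finite_group_W: "finite_group (W r k)"
  unfolding finite_group_def finite_group_axioms_def using group_W finite_W by blast

lemma card_conj_classes_W_Suc:
  "card (conj_classes (W r (Suc k))) = coloured_class_count (conj_classes (W r k)) (r (Suc k))"
proof -
  have "Wr \<in> iso (sym_wreath (W r k) (r (Suc k))) (W r (Suc k))"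
    unfolding W.simps by (rule inj_imp_image_group_iso) (simp add: inj_on_def)
  then have "card (conj_classes (W r (Suc k))) =
    card (conj_classes (sym_wreath (W r k) (r (Suc k))))"
    by (rule card_conj_classes_iso[OF group_wreath[OF group_W] group_W])
  then show ?thesis using finite_group.card_conj_classes_wreath[OF finite_group_W] by simp
qed

lemma card_valid_classes:
  assumes r: "\<And>j. j \<ge> 1 \<Longrightarrow> r j \<ge> 1"
  shows "finite (valid_classes r (Suc k)) \<and>
    card (valid_classes r (Suc k)) = card (conj_classes (W r (Suc k)))"
proof (induction k)
  case 0
  \<comment> \<open>The trivial group offers a single colour, so the first step of the recursion
    gives the conjugacy classes of \<open>sym_group (r 1)\<close>.\<close>
  have "conj_classes (W r 0) = {conj_class (W r 0) Triv}"
    by (simp add: conj_classes_def singleton_group_def)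
  then have "card (conj_classes (W r (Suc 0))) = card (conj_classes (sym_group (r 1)))"
    unfolding card_conj_classes_W_Suc by (simp add: coloured_class_count_singleton)
  then show ?case using valid_classes_1[of r] r[of 1] by simp
next
  case (Suc k)
  have n: "r (Suc (Suc k)) \<ge> 1" using r by simp
  have "finite (conj_classes (W r (Suc k)))"
    by (rule finite_group.conj_classes_finite[OF finite_group_W])
  \<comment> \<open>The induction hypothesis is turned into a bijection between the colours of the
    two sides.\<close>
  then obtain h where "bij_betw h (valid_classes r (Suc k)) (conj_classes (W r (Suc k)))"
    using Suc finite_same_card_bij by blast
  then have "card (valid_classes r (Suc (Suc k))) = card (conj_classes (W r (Suc (Suc k))))"
    unfolding card_conj_classes_W_Suc[of r "Suc k"]
      using card_valid_classes_Suc(2)[of r k, OF n] Suc coloured_class_count_bij by metis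
  then show ?case using card_valid_classes_Suc(1)[of r k, OF n] Suc by blast
qed

theorem theorem3:
  fixes r :: "nat \<Rightarrow> nat" and k :: nat
  assumes "\<And>j. j \<ge> 1 \<Longrightarrow> r j \<ge> 1" and "k \<ge> 1"
  shows "(\<exists>f. bij_betw f (Irr (W r k)) (orbits (W r k) (valid_labels r k) (label_act r k))) \<and>
    (\<forall>\<phi>\<in>valid_labels r k. \<forall>\<psi>\<in>valid_labels r k.
       orbit (W r k) (label_act r k) \<phi> = orbit (W r k) (label_act r k) \<psi> \<longleftrightarrow>
       (\<phi>, \<psi>) \<in> label_equiv r k)"
proof -
  obtain k' where k: "k = Suc k'" using assms(2) by (cases k) auto
  have orbit: "orbit (W r k) (label_act r k) \<phi> = label_class r k \<phi>" if "\<phi> \<in> valid_labels r k" for \<phi>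
    using orbit_eq_label_class valid_labels_labels that unfolding k label_class_def by blast
  have "orbits (W r k) (valid_labels r k) (label_act r k) = valid_classes r k"
    unfolding orbits_def valid_classes_def using orbit by blast
  \<comment> \<open>Both sets are finite, of the size of
    \<open>conj_classes (W r k)\<close>.\<close>
  moreover have "\<exists>f. bij_betw f (Irr (W r k)) (valid_classes r k)"
    using finite_group.card_Irr[OF finite_group_W[of r k]] card_valid_classes[of r k', OF assms(1)]
    unfolding k by (intro finite_same_card_bij) (simp_all del: W.simps)
  moreover have "orbit (W r k) (label_act r k) \<phi> = orbit (W r k) (label_act r k) \<psi> \<longleftrightarrow>
    (\<phi>, \<psi>) \<in> label_equiv r k"
    if "\<phi> \<in> valid_labels r k" "\<psi> \<in> valid_labels r k" for \<phi> \<psi>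
    unfolding orbit[OF that(1)] orbit[OF that(2)]
    by (rule label_class_eq_iff) (rule valid_labels_labels, rule that)+
  ultimately show ?thesis by simp
qed

end
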